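(* Let $T>0$ and let $U\in\mathcal{H}_T$ (with $U_0=0$) be the driver of the Loewner evolution. Then: (i) For all $y>0$ and $t\in[0,T]$, $$|f_t'(iy+U_t)|\le \exp\Bigl[\tfrac14\|U\|_t^2\Bigr].$$ (ii) The Loewner trace $\gamma=:\Phi_{SL}(U)$ exists and is a simple curve. (iii) The trace is uniformly $1/2$-H\"older in the sense that, for some constant $C$ (not depending on $U$), $$\|\gamma\|_{1/2}\le C\exp\bigl[C\|U\|_T^2\bigr].$$ (iv) The map $t\mapsto\gamma(t^2)$ is Lipschitz continuous on $[0,\sqrt T]$. As a consequence, the trace $\gamma$ is of bounded variation on $[0,T]$, and Lipschitz away from $0+$ (i.e. Lipschitz on $[\delta,T]$ for every $\delta\in(0,T]$). (v) On bounded sets in $\mathcal{H}_T$, the Schramm--Loewner map $\Phi_{SL}$ is continuous from $C[0,T]$ to $C^{1/2-\epsilon}([0,T],\overline{\mathbb{H}})$ for any $\epsilon>0$; that is, $\Phi_{SL}$ restricted to any subset of $\mathcal{H}_T$ bounded in $\|\cdot\|_T$ is continuous when the subset carries the uniform topology of $C[0,T]$ and the target the $(1/2-\epsilon)$-H\"older topology. (vi) The Schramm--Loewner map $\Phi_{SL}$ is continuous from $\mathcal{H}_T$ (with the topology of $\|\cdot\|_T$) to $C^{(1+\epsilon)\text{-var}}$ (paths on $[0,T]$ with the $(1+\epsilon)$-variation topology), for any $\epsilon>0$.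
   Context: $\mathbb{H}$ is the open complex upper half-plane and $\overline{\mathbb{H}}$ its closure. For a continuous driver $U:[0,T]\to\mathbb{R}$ with $U_0=0$ and $z\in\overline{\mathbb{H}}\setminus\{0\}$, $g_t(z)$ denotes the solution of Loewner's differential equation $$\dot g_t(z)=\frac{2}{g_t(z)-U_t},\qquad g_0(z)=z,$$ (up to its lifetime), and $f_t=g_t^{-1}$, a conformal map defined on $\mathbb{H}$; $f_t'$ is its complex derivative. The Loewner trace exists if, for every $t\in[0,T]$, the limit $\gamma_t:=\lim_{y\to0+}f_t(iy+U_t)$ exists and $t\mapsto\gamma_t$ is continuous on $[0,T]$; then $\gamma$ is the trace, and the Schramm--Loewner map is $\Phi_{SL}:U\mapsto\gamma$. $\mathcal{H}_t$ is the space of absolutely continuous $h:[0,t]\to\mathbb{R}$ with square-integrable derivative $\dot h$, with $\|h\|_t^2:=\int_0^t|\dot h_s|^2ds$. Loewner drivers are started at $0$. For a path $U$ on $[0,T]$ and $t\le T$, $\|U\|_t$ is the norm of its restriction to $[0,t]$. $\|\gamma\|_{1/2}:=\sup_{0\le s<t\le T}|\gamma_t-\gamma_s|/|t-s|^{1/2}$. *)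

theory Defs
  imports "HOL-Analysis.Analysis"
begin

section \<open>Finite-energy paths\<close>

definition absolutely_continuous_path :: "real \<Rightarrow> real \<Rightarrow> (real \<Rightarrow> real) \<Rightarrow> bool" where
  "absolutely_continuous_path a b h \<longleftrightarrow>
     (\<forall>\<epsilon>>0. \<exists>\<delta>>0. \<forall>(n::nat) x y.
        (\<forall>i<n. a \<le> x i \<and> x i \<le> y i \<and> y i \<le> b) \<and>
        disjoint_family_on (\<lambda>i. {x i<..<y i}) {..<n} \<and>
        (\<Sum>i<n. y i - x i) < \<delta> \<longrightarrow>
        (\<Sum>i<n. \<bar>h (y i) - h (x i)\<bar>) < \<epsilon>)"

definition path_deriv :: "real \<Rightarrow> (real \<Rightarrow> real) \<Rightarrow> real \<Rightarrow> real" where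
  "path_deriv t h s = vector_derivative h (at s within {0..t})"

text \<open>
  Almost everywhere differentiability of an absolutely continuous function is automatic by
  Lebesgue's theorem. It is recorded explicitly because \<^const>\<open>vector_derivative\<close> only denotes
  the derivative where the latter exists.
\<close>

definition finite_energy :: "real \<Rightarrow> (real \<Rightarrow> real) set" where
  "finite_energy t = {h. absolutely_continuous_path 0 t h \<and>
     (AE s in lebesgue_on {0..t}. h differentiable (at s within {0..t})) \<and>
     set_integrable lebesgue {0..t} (\<lambda>s. (path_deriv t h s)\<^sup>2)}"

definition energy_norm :: "real \<Rightarrow> (real \<Rightarrow> real) \<Rightarrow> real" where
  "energy_norm t h = sqrt (set_lebesgue_integral lebesgue {0..t} (\<lambda>s. (path_deriv t h s)\<^sup>2))"

definition drivers :: "real \<Rightarrow> (real \<Rightarrow> real) set" where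
  "drivers T = {U \<in> finite_energy T. U 0 = 0}"


section \<open>Loewner evolution\<close>

definition loewner_solution ::
  "(real \<Rightarrow> real) \<Rightarrow> complex \<Rightarrow> real \<Rightarrow> (real \<Rightarrow> complex) \<Rightarrow> bool" where
  "loewner_solution U z t g \<longleftrightarrow> g 0 = z \<and>
     (\<forall>s\<in>{0..t}. g s \<noteq> complex_of_real (U s) \<and>
        (g has_vector_derivative 2 / (g s - complex_of_real (U s))) (at s within {0..t}))"

text \<open>
  The points of the closed upper half-plane minus the origin whose lifetime exceeds \<open>t\<close>:
  the solution exists on the whole of \<open>{0..t}\<close> without meeting the driver.
\<close>

definition loewner_domain :: "(real \<Rightarrow> real) \<Rightarrow> real \<Rightarrow> complex set" where
  "loewner_domain U t = {z. 0 \<le> Im z \<and> z \<noteq> 0 \<and> (\<exists>g. loewner_solution U z t g)}"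

definition loewner_g :: "(real \<Rightarrow> real) \<Rightarrow> real \<Rightarrow> complex \<Rightarrow> complex" where
  "loewner_g U t z = (THE w. \<exists>g. loewner_solution U z t g \<and> w = g t)"

definition loewner_f :: "(real \<Rightarrow> real) \<Rightarrow> real \<Rightarrow> complex \<Rightarrow> complex" where
  "loewner_f U t = the_inv_into (loewner_domain U t) (loewner_g U t)"

text \<open>The point \<open>iy + U\<^sub>t\<close>.\<close>

definition above_tip :: "(real \<Rightarrow> real) \<Rightarrow> real \<Rightarrow> real \<Rightarrow> complex" where
  "above_tip U t y = \<i> * complex_of_real y + complex_of_real (U t)"

text \<open>The Schramm--Loewner map, sending a driver to its trace.\<close>

definition loewner_trace :: "(real \<Rightarrow> real) \<Rightarrow> real \<Rightarrow> complex" where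
  "loewner_trace U t = Lim (at_right 0) (\<lambda>y. loewner_f U t (above_tip U t y))"

definition loewner_trace_exists :: "real \<Rightarrow> (real \<Rightarrow> real) \<Rightarrow> bool" where
  "loewner_trace_exists T U \<longleftrightarrow>
     (\<forall>t\<in>{0..T}. \<exists>l. ((\<lambda>y. loewner_f U t (above_tip U t y)) \<longlongrightarrow> l) (at_right 0)) \<and>
     continuous_on {0..T} (loewner_trace U)"


section \<open>Path spaces\<close>

text \<open>
  Norms are \<^typ>\<open>ennreal\<close>-valued, so that they are infinite, rather than unspecified,
  on paths outside the corresponding space.
\<close>

definition sup_norm :: "real \<Rightarrow> (real \<Rightarrow> 'a::real_normed_vector) \<Rightarrow> ennreal" where
  "sup_norm T x = (SUP t\<in>{0..T}. ennreal (norm (x t)))"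

definition holder_seminorm :: "real \<Rightarrow> real \<Rightarrow> (real \<Rightarrow> 'a::real_normed_vector) \<Rightarrow> ennreal" where
  "holder_seminorm \<alpha> T x =
     (SUP (s, t)\<in>{(s, t). 0 \<le> s \<and> s < t \<and> t \<le> T}.
        ennreal (norm (x t - x s) / \<bar>t - s\<bar> powr \<alpha>))"

definition holder_norm :: "real \<Rightarrow> real \<Rightarrow> (real \<Rightarrow> 'a::real_normed_vector) \<Rightarrow> ennreal" where
  "holder_norm \<alpha> T x = sup_norm T x + holder_seminorm \<alpha> T x"

definition holder_space :: "real \<Rightarrow> real \<Rightarrow> 'a::real_normed_vector set \<Rightarrow> (real \<Rightarrow> 'a) set" where
  "holder_space \<alpha> T S = {x. continuous_on {0..T} x \<and> x ` {0..T} \<subseteq> S \<and> holder_norm \<alpha> T x < \<infinity>}"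

definition variation :: "real \<Rightarrow> real \<Rightarrow> (real \<Rightarrow> 'a::real_normed_vector) \<Rightarrow> ennreal" where
  "variation p T x =
     (SUP (n, \<tau>)\<in>{(n::nat, \<tau>::nat \<Rightarrow> real). mono_on {..n} \<tau> \<and> \<tau> ` {..n} \<subseteq> {0..T}}.
        ennreal ((\<Sum>i<n. norm (x (\<tau> (Suc i)) - x (\<tau> i)) powr p) powr (1 / p)))"

definition variation_norm :: "real \<Rightarrow> real \<Rightarrow> (real \<Rightarrow> 'a::real_normed_vector) \<Rightarrow> ennreal" where
  "variation_norm p T x = sup_norm T x + variation p T x"

definition variation_space :: "real \<Rightarrow> real \<Rightarrow> (real \<Rightarrow> 'a::real_normed_vector) set" where
  "variation_space p T = {x. continuous_on {0..T} x \<and> variation_norm p T x < \<infinity>}"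

text \<open>Continuity on \<open>S\<close> for the topologies given by two (extended) norms on paths.\<close>

definition norm_continuous_on ::
  "('a::minus \<Rightarrow> ennreal) \<Rightarrow> ('b::minus \<Rightarrow> ennreal) \<Rightarrow> 'a set \<Rightarrow> ('a \<Rightarrow> 'b) \<Rightarrow> bool" where
  "norm_continuous_on N M S F \<longleftrightarrow>
     (\<forall>u\<in>S. \<forall>\<epsilon>>0. \<exists>\<delta>>0. \<forall>v\<in>S.
        N (v - u) < ennreal \<delta> \<longrightarrow> M (F v - F u) < ennreal \<epsilon>)"

end

theory Submission
  imports Defs
begin

text \<open>
  Write \<open>g\<close> for a Loewner flow line, \<open>Z = g - U = X + \<i> Y\<close> for its position relative to the driver,
  \<open>R = \<bar>Z\<bar>\<close>, and \<open>u\<close> for the derivative of \<open>U\<close>, which exists almost everywhere. The inverse map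
  \<open>f\<^sub>t\<close> sends \<open>w\<close> to the starting point of the flow line that ends in \<open>w\<close> at time \<open>t\<close>, so that all
  estimates run from the known endpoint back to time \<open>0\<close>. Points of the open half-plane never
  reach the driver in that direction because \<open>Y\<close> increases.

  Everything rests on two differential inequalities in which the rough term \<open>X u / R\<^sup>2\<close> is absorbed by
  completing the square:
  \<^item> \<open>(ln (R / Y))' = 4 X\<^sup>2 / R\<^sup>4 - X u / R\<^sup>2 \<ge> - u\<^sup>2 / 16\<close>. Flow lines traced back from a cone with apex at
    the tip stay in a wider cone, whose aperture is controlled by the energy (\<open>aspect_ratio_bound\<close>). As
    \<open>(Y\<^sup>2)' = - 4 Y\<^sup>2 / R\<^sup>2\<close>, their height at time \<open>0\<close> is at least of order \<open>\<surd>t\<close> (\<open>height_growth\<close>).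
  \<^item> With \<open>\<Lambda>\<close> the integral of \<open>Re (2 / Z\<^sup>2)\<close> from \<open>0\<close>, the modulus of \<open>f\<^sub>t'\<close> is \<open>exp (\<Lambda> t)\<close> and
    \<open>(- \<Lambda> + 2 ln R - ln Y)' = 4 X\<^sup>2 / R\<^sup>4 - 2 X u / R\<^sup>2 \<ge> - u\<^sup>2 / 4\<close>. This bounds
    \<open>\<bar>f\<^sub>t'(w)\<bar>\<close> by \<open>\<bar>w - U\<^sub>t\<bar>\<^sup>2 / (Im w \<sqdot> Im (f\<^sub>t w))\<close> times the exponential of a quarter of the energy
    (\<open>deriv_bound\<close>). On the vertical line through the tip the first factor is at most \<open>1\<close>, which is the
    pointwise derivative estimate.

  Combining both, \<open>\<bar>f\<^sub>t'(w)\<bar>\<close> is of order \<open>Im w / \<surd>((Im w)\<^sup>2 + t)\<close> in a cone. Integration along the vertical line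
  gives the limit that defines the trace. To compare the times \<open>s < t\<close>, one moves up to height
  \<open>\<surd>(t - s)\<close>, where the flow over the time interval displaces points by an amount comparable to
  the height, and obtains an increment of order \<open>(t - s) / \<surd>t\<close> (\<open>trace_increment\<close>). This single
  bound contains the Hoelder estimate, because \<open>(t - s) / \<surd>t \<le> \<surd>(t - s)\<close>, as well as Lipschitz continuity
  in the square root of time, because \<open>(t - s) / \<surd>t \<le> 2 (\<surd>t - \<surd>s)\<close>.

  The trace is simple because the flow lines that lead to \<open>\<gamma>\<^sub>s\<close> and \<open>\<gamma>\<^sub>t\<close> for \<open>s < t\<close> are apart at time \<open>s\<close>, one being
  at the tip and the other at positive height, and cannot merge before time \<open>0\<close>: the logarithmic derivative
  of their distance is bounded by \<open>2 / (Y\<^sub>1 Y\<^sub>2)\<close>, with \<open>Y\<^sub>1\<close> bounded below and \<open>1 / Y\<^sub>2\<close> integrable by the growth of the height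
  (\<open>tips_separated\<close>). Finally, the trace at time \<open>t\<close> is approximated by \<open>f\<^sub>t (U\<^sub>t + \<i> y)\<close> uniformly over bounded
  energy, and for fixed \<open>y\<close> this point depends on the driver continuously in the uniform norm
  (\<open>trace_stability\<close>). Interpolating uniform closeness with the uniform Hoelder and variation bounds gives
  continuity of the Schramm--Loewner map in both topologies.
\<close>

section \<open>Absolutely continuous functions\<close>

lemma absolutely_continuous_pathE:
  assumes "absolutely_continuous_path a b f" "0 < e"
  obtains \<delta> where "0 < \<delta>"
    "\<And>(n::nat) x y. (\<forall>i<n. a \<le> x i \<and> x i \<le> y i \<and> y i \<le> b) \<and>
        disjoint_family_on (\<lambda>i. {x i<..<y i}) {..<n} \<and> (\<Sum>i<n. y i - x i) < \<delta> \<Longrightarrow>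
        (\<Sum>i<n. \<bar>f (y i) - f (x i)\<bar>) < e"
proof -
  from assms(1)[unfolded absolutely_continuous_path_def, THEN spec, THEN mp, OF assms(2)]
  obtain \<delta> where d: "0 < \<delta>" "\<forall>(n::nat) x y. (\<forall>i<n. a \<le> x i \<and> x i \<le> y i \<and> y i \<le> b) \<and>
        disjoint_family_on (\<lambda>i. {x i<..<y i}) {..<n} \<and> (\<Sum>i<n. y i - x i) < \<delta> \<longrightarrow>
        (\<Sum>i<n. \<bar>f (y i) - f (x i)\<bar>) < e" by (elim exE conjE)
  show thesis by (rule that[OF d(1)]) (rule d(2)[THEN spec, THEN spec, THEN spec, THEN mp])
qed

text \<open>
  The intervals of a Riemann sum are indexed by the sum itself, so absolute continuity is needed
  for families over an arbitrary finite index set instead of an initial segment of the naturals.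
\<close>

lemma absolutely_continuous_finite_family:
  assumes "absolutely_continuous_path a b f" "0 < e"
  obtains \<delta> where "0 < \<delta>"
    "\<And>(P :: 'i set) l r. finite P \<Longrightarrow> (\<And>i. i \<in> P \<Longrightarrow> a \<le> l i \<and> l i \<le> r i \<and> r i \<le> b) \<Longrightarrow>
       disjoint_family_on (\<lambda>i. {l i<..<r i}) P \<Longrightarrow> (\<Sum>i\<in>P. r i - l i) < \<delta> \<Longrightarrow>
       (\<Sum>i\<in>P. \<bar>f (r i) - f (l i)\<bar>) < e"
proof -
  obtain \<delta> where \<delta>: "0 < \<delta>" "\<And>(n::nat) x y.
        (\<forall>i<n. a \<le> x i \<and> x i \<le> y i \<and> y i \<le> b) \<and>
        disjoint_family_on (\<lambda>i. {x i<..<y i}) {..<n} \<and>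
        (\<Sum>i<n. y i - x i) < \<delta> \<Longrightarrow> (\<Sum>i<n. \<bar>f (y i) - f (x i)\<bar>) < e"
    by (rule absolutely_continuous_pathE[OF assms]) blast
  show thesis
  proof (rule that[OF \<delta>(1)])
    fix P :: "'i set" and l r
    assume P: "finite P" "\<And>i. i \<in> P \<Longrightarrow> a \<le> l i \<and> l i \<le> r i \<and> r i \<le> b"
      and disj: "disjoint_family_on (\<lambda>i. {l i<..<r i}) P" and small: "(\<Sum>i\<in>P. r i - l i) < \<delta>"
    obtain h where h: "bij_betw h {..<card P} P"
      using ex_bij_betw_nat_finite[OF P(1)] by (auto simp: atLeast0LessThan)
    have "(\<Sum>i<card P. \<bar>f (r (h i)) - f (l (h i))\<bar>) < e"
    proof (rule \<delta>(2), intro conjI)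
      show "\<forall>i<card P. a \<le> l (h i) \<and> l (h i) \<le> r (h i) \<and> r (h i) \<le> b"
        using P(2) bij_betwE[OF h] by auto
      show "disjoint_family_on (\<lambda>i. {l (h i)<..<r (h i)}) {..<card P}"
        unfolding disjoint_family_on_def
      proof (intro ballI impI)
        fix m n assume mn: "m \<in> {..<card P}" "n \<in> {..<card P}" "m \<noteq> n"
        then have "h m \<in> P" "h n \<in> P" "h m \<noteq> h n"
          using h by (auto simp: bij_betw_def inj_on_def)
        then show "{l (h m)<..<r (h m)} \<inter> {l (h n)<..<r (h n)} = {}"
          using disj unfolding disjoint_family_on_def by blast
      qed
      show "(\<Sum>i<card P. r (h i) - l (h i)) < \<delta>"
        using small sum.reindex_bij_betw[OF h, of "\<lambda>i. r i - l i"] by simp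
    qed
    then show "(\<Sum>i\<in>P. \<bar>f (r i) - f (l i)\<bar>) < e"
      using sum.reindex_bij_betw[OF h, of "\<lambda>i. \<bar>f (r i) - f (l i)\<bar>"] by simp
  qed
qed

text \<open>
  The cells of a tagged division have disjoint interiors, which makes lengths additive under
  Lebesgue measure.
\<close>

lemma sum_length_tagged_in_open:
  fixes G :: "real set"
  assumes p: "p tagged_division_of {a..b}" and Q: "Q \<subseteq> p"
    and G: "G \<in> lmeasurable" and sub: "\<And>x K. (x, K) \<in> Q \<Longrightarrow> K \<subseteq> G"
  shows "(\<Sum>(x, K)\<in>Q. Sup K - Inf K) \<le> measure lebesgue G"
proof -
  have fin: "finite Q" using p Q finite_subset by blast
  have K: "\<exists>u v. u \<le> v \<and> K = {u..v}" if "(x, K) \<in> Q" for x K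
  proof -
    have xK: "(x, K) \<in> p" using Q \<open>(x, K) \<in> Q\<close> by (rule subsetD)
    have "\<exists>u v. K = cbox u v" by (rule tagged_division_ofD(4)[OF p xK])
    then obtain u v where "K = {u..v}" by auto
    moreover have "x \<in> K" by (rule tagged_division_ofD(2)[OF p xK])
    ultimately have "K = {u..v}" "u \<le> x" "x \<le> v" by auto
    then show ?thesis by (intro exI[of _ u] exI[of _ v]) auto
  qed
  have "(\<Sum>(x, K)\<in>Q. Sup K - Inf K) = (\<Sum>i\<in>Q. measure lebesgue (interior (snd i)))"
  proof (rule sum.cong[OF refl], clarify)
    fix x K assume "(x, K) \<in> Q"
    then obtain u v where "u \<le> v" "K = {u..v}" using K by blast
    then show "Sup K - Inf K = measure lebesgue (interior (snd (x, K)))" by simp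
  qed
  also have "\<dots> = measure lebesgue (\<Union>i\<in>Q. interior (snd i))"
  proof (rule measure_UNION'[symmetric, OF fin])
    show "interior (snd i) \<in> lmeasurable" if "i \<in> Q" for i
      using K[of "fst i" "snd i"] that by auto
    show "pairwise (\<lambda>i j. disjnt (interior (snd i)) (interior (snd j))) Q"
      using tagged_division_ofD(5)[OF p] Q unfolding pairwise_def disjnt_def
      by (metis prod.collapse subsetD)
  qed
  also have "\<dots> \<le> measure lebesgue G"
  proof (rule measure_mono_fmeasurable[OF _ _ G])
    show "(\<Union>i\<in>Q. interior (snd i)) \<subseteq> G" using sub interior_subset by fastforce
    show "(\<Union>i\<in>Q. interior (snd i)) \<in> sets lebesgue"
      by (intro borel_open[THEN sets_completionI_sets[of _ lborel, simplified]] open_UN) auto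
  qed
  finally show ?thesis .
qed

text \<open>
  The fundamental theorem of calculus with a null set of exceptional points, proved on Riemann
  sums. Cells tagged outside \<open>N\<close> obey the usual straddle estimate. The gauge forces
  the cells tagged in \<open>N\<close> into an open set of tiny measure, and there absolute
  continuity makes the increments of \<open>f\<close>, which those cells fail to reproduce, sum up
  to little.
\<close>

lemma absolutely_continuous_ftc:
  assumes ab: "a \<le> b" and ac: "absolutely_continuous_path a b f" and N: "negligible N"
    and f': "\<And>x. x \<in> {a..b} - N \<Longrightarrow> (f has_real_derivative f' x) (at x within {a..b})"
  shows "(f' has_integral f b - f a) {a..b}"
proof -
  define F where "F x = (if x \<in> N then 0 else f' x)" for x
  have "(F has_integral f b - f a) {a..b}"
    unfolding has_integral_real
  proof (intro allI impI)
    fix e :: real assume e: "0 < e"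
    \<comment> \<open>Half of \<open>e\<close> pays for the cells with regular tags, the other half for those tagged in \<open>N\<close>.\<close>
    define e1 where "e1 = e / (2 * (b - a + 1))"
    have e1: "0 < e1" using e ab by (auto simp: e1_def intro!: divide_pos_pos)
    have "e1 * (b - a) < e / 2"
      using e ab by (auto simp: e1_def field_simps)
    have "\<forall>x. \<exists>d>0. x \<in> {a..b} - N \<longrightarrow>
         (\<forall>y\<in>{a..b}. norm (y-x) < d \<longrightarrow> norm (f y - f x - f' x * (y - x)) \<le> e1 * norm (y-x))"
      using f'[unfolded has_field_derivative_def has_derivative_within_alt] e1 by blast
    then obtain d where d: "\<And>x. 0 < d x"
      "\<And>x y. \<lbrakk>x \<in> {a..b} - N; y \<in> {a..b}; norm (y-x) < d x\<rbrakk>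
         \<Longrightarrow> \<bar>f y - f x - f' x * (y - x)\<bar> \<le> e1 * \<bar>y-x\<bar>"
      unfolding real_norm_def by metis
    obtain \<delta> where \<delta>: "0 < \<delta>" "\<And>(P :: (real \<times> real set) set) l r. finite P \<Longrightarrow>
       (\<And>i. i \<in> P \<Longrightarrow> a \<le> l i \<and> l i \<le> r i \<and> r i \<le> b) \<Longrightarrow>
       disjoint_family_on (\<lambda>i. {l i<..<r i}) P \<Longrightarrow> (\<Sum>i\<in>P. r i - l i) < \<delta> \<Longrightarrow>
       (\<Sum>i\<in>P. \<bar>f (r i) - f (l i)\<bar>) < e / 2"
      by (rule absolutely_continuous_finite_family[OF ac half_gt_zero[OF e]]) blast
    obtain G where G: "open G" "N \<subseteq> G" "(G - N) \<in> lmeasurable" "emeasure lebesgue (G - N) < ennreal \<delta>"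
      using sets_lebesgue_outer_open[OF negligible_imp_sets[OF N] \<delta>(1)] by blast
    have N0: "N \<in> null_sets lebesgue" using N negligible_iff_null_sets by blast
    have Gm: "G \<in> lmeasurable"
      using fmeasurable.Un[OF G(3), of N] N0 G(2)
      by (simp add: Un_absorb2 negligible_imp_measurable N)
    have "emeasure lebesgue G = emeasure lebesgue (G - N)"
      using emeasure_Diff_null_set[OF N0, of G] Gm by (simp add: fmeasurableD)
    then have Gs: "measure lebesgue G < \<delta>"
      using G(4) \<delta>(1) Gm by (metis emeasure_eq_measure2 ennreal_less_iff measure_nonneg)
    define \<gamma> where "\<gamma> x = (if x \<in> N then G else ball x (d x))" for x
    have "gauge \<gamma>" unfolding gauge_def \<gamma>_def using G d(1) by auto
    moreover have "norm ((\<Sum>(x, K)\<in>p. measure lborel K *\<^sub>R F x) - (f b - f a)) < e"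
      if p: "p tagged_division_of {a..b}" and fine: "\<gamma> fine p" for p
    proof -
      have fin: "finite p" using p by blast
      define Q where "Q = {i \<in> p. fst i \<in> N}"
      define err where "err = (\<lambda>(x, K). measure lborel K * F x - (f (Sup K) - f (Inf K)))"
      have K: "\<exists>u v. u \<le> v \<and> K = {u..v} \<and> a \<le> u \<and> v \<le> b \<and> u \<le> x \<and> x \<le> v" if "(x, K) \<in> p" for x K
      proof -
        note xK = \<open>(x, K) \<in> p\<close>
        have "\<exists>u v. K = cbox u v" by (rule tagged_division_ofD(4)[OF p xK])
        then obtain u v where "K = {u..v}" by auto
        moreover have "x \<in> K" by (rule tagged_division_ofD(2)[OF p xK])
        moreover have "K \<subseteq> {a..b}" by (rule tagged_division_ofD(3)[OF p xK])
        ultimately have *: "K = {u..v}" "u \<le> x" "x \<le> v" "{u..v} \<subseteq> {a..b}" by auto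
        then show ?thesis by (intro exI[of _ u] exI[of _ v]) auto
      qed
      have "f b - f a = (\<Sum>(x, K)\<in>p. f (Sup K) - f (Inf K))"
        by (rule additive_tagged_division_1[OF ab p, of f, symmetric])
      then have "(\<Sum>(x, K)\<in>p. measure lborel K *\<^sub>R F x) - (f b - f a) = (\<Sum>i\<in>p. err i)"
        by (simp add: err_def sum_subtractf split_def)
      also have "\<dots> = (\<Sum>i\<in>Q. err i) + (\<Sum>i\<in>p - Q. err i)"
        using sum.subset_diff[of Q p err] fin by (simp add: Q_def add.commute)
      also have "norm \<dots> \<le> (\<Sum>i\<in>Q. \<bar>err i\<bar>) + (\<Sum>i\<in>p - Q. \<bar>err i\<bar>)"
        unfolding real_norm_def by (intro order_trans[OF abs_triangle_ineq] add_mono sum_abs)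
      also have "(\<Sum>i\<in>Q. \<bar>err i\<bar>) = (\<Sum>i\<in>Q. \<bar>f (Sup (snd i)) - f (Inf (snd i))\<bar>)"
        by (rule sum.cong) (auto simp: err_def Q_def F_def)
      also have "\<dots> < e / 2"
      proof (rule \<delta>(2)[of Q "\<lambda>i. Inf (snd i)" "\<lambda>i. Sup (snd i)"])
        show "finite Q" using fin by (simp add: Q_def)
        show "a \<le> Inf (snd i) \<and> Inf (snd i) \<le> Sup (snd i) \<and> Sup (snd i) \<le> b" if "i \<in> Q" for i
          using K[of "fst i" "snd i"] that by (auto simp: Q_def)
        show "disjoint_family_on (\<lambda>i. {Inf (snd i)<..<Sup (snd i)}) Q"
          unfolding disjoint_family_on_def
        proof (intro ballI impI)
          fix i j assume ij: "i \<in> Q" "j \<in> Q" "i \<noteq> j"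
          have "interior (snd k) = {Inf (snd k)<..<Sup (snd k)}" if "k \<in> Q" for k
            using K[of "fst k" "snd k"] that by (auto simp: Q_def)
          then show "{Inf (snd i)<..<Sup (snd i)} \<inter> {Inf (snd j)<..<Sup (snd j)} = {}"
            using tagged_division_ofD(5)[OF p, of "fst i" "snd i" "fst j" "snd j"] ij
            by (auto simp: Q_def)
        qed
        have "(\<Sum>(x, K)\<in>Q. Sup K - Inf K) \<le> measure lebesgue G"
        proof (rule sum_length_tagged_in_open[OF p _ Gm])
          show "Q \<subseteq> p" by (auto simp: Q_def)
          show "K \<subseteq> G" if "(x, K) \<in> Q" for x K
            using fineD[OF fine, of x K] that by (simp add: Q_def \<gamma>_def)
        qed
        then show "(\<Sum>i\<in>Q. Sup (snd i) - Inf (snd i)) < \<delta>"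
          using Gs by (simp add: split_def)
      qed
      also have "(\<Sum>i\<in>p - Q. \<bar>err i\<bar>) \<le> (\<Sum>i\<in>p - Q. e1 * (Sup (snd i) - Inf (snd i)))"
      proof (rule sum_mono)
        fix i assume i: "i \<in> p - Q"
        obtain x k where ik: "i = (x, k)" by fastforce
        with i obtain u v where uv: "u \<le> v" "k = {u..v}" "a \<le> u" "v \<le> b" "u \<le> x" "x \<le> v"
          using K by blast
        have x: "x \<in> {a..b} - N" using i ik uv by (auto simp: Q_def)
        have sub: "k \<subseteq> ball x (d x)" using fineD[OF fine, of x k] i ik x by (simp add: \<gamma>_def)
        have near: "norm (u - x) < d x" "norm (v - x) < d x"
          using subsetD[OF sub, of u] subsetD[OF sub, of v] uv by (auto simp: dist_norm norm_minus_commute)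
        have "\<bar>f u - f x - f' x * (u - x)\<bar> \<le> e1 * (x - u)" "\<bar>f v - f x - f' x * (v - x)\<bar> \<le> e1 * (v - x)"
          using d(2)[OF x _ near(1)] d(2)[OF x _ near(2)] uv by auto
        then have "\<bar>f' x * (v - u) - (f v - f u)\<bar> \<le> e1 * (v - u)"
          by (simp add: algebra_simps abs_le_iff)
        then show "\<bar>err i\<bar> \<le> e1 * (Sup (snd i) - Inf (snd i))"
          using x uv by (simp add: err_def ik F_def mult.commute)
      qed
      also have "\<dots> \<le> (\<Sum>i\<in>p. e1 * (Sup (snd i) - Inf (snd i)))"
        using e1 K by (intro sum_mono2 fin) (fastforce intro!: mult_nonneg_nonneg)+
      also have "\<dots> = e1 * (b - a)"
        using additive_tagged_division_1[OF ab p, of "\<lambda>x. x"]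
        by (simp add: split_def flip: sum_distrib_left)
      also have "\<dots> < e / 2" by fact
      finally show ?thesis by simp
    qed
    ultimately show "\<exists>\<gamma>. gauge \<gamma> \<and> (\<forall>\<D>. \<D> tagged_division_of {a..b} \<and> \<gamma> fine \<D> \<longrightarrow>
        norm ((\<Sum>(x, K)\<in>\<D>. measure lborel K *\<^sub>R F x) - (f b - f a)) < e)" by (intro exI[of _ \<gamma>] conjI allI impI) (assumption, elim conjE)
  qed
  then show ?thesis
    by (rule has_integral_spike[OF N, rotated]) (auto simp: F_def)
qed

text \<open>
  An almost everywhere differential inequality may be integrated. Every energy estimate below
  enters through this lemma.
\<close>

lemma absolutely_continuous_increment_ge:
  assumes ab: "a \<le> b" and ac: "absolutely_continuous_path a b f" and N: "negligible N"
    and f': "\<And>x. x \<in> {a<..<b} - N \<Longrightarrow> (f has_real_derivative f' x) (at x)"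
    and g: "g integrable_on {a..b}" and ge: "\<And>x. x \<in> {a<..<b} - N \<Longrightarrow> g x \<le> f' x"
  shows "integral {a..b} g \<le> f b - f a"
proof -
  define N' where "N' = insert a (insert b N)"
  define h where "h x = (if x \<in> N' then g x else f' x)" for x
  have "(h has_integral f b - f a) {a..b}"
  proof (rule absolutely_continuous_ftc[OF ab ac])
    show "negligible N'" using N by (simp add: N'_def)
    fix x assume x: "x \<in> {a..b} - N'"
    then have "(f has_real_derivative f' x) (at x)" using f' by (auto simp: N'_def)
    then show "(f has_real_derivative h x) (at x within {a..b})"
      using x by (auto simp: h_def intro: has_field_derivative_at_within)
  qed
  with integrable_integral[OF g] show ?thesis
  proof (rule has_integral_le)
    show "g x \<le> h x" if "x \<in> {a..b}" for x
      using ge[of x] that by (auto simp: h_def N'_def)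
  qed
qed

lemma absolutely_continuous_path_mono:
  assumes "absolutely_continuous_path a b f" "a \<le> c" "d \<le> b"
  shows "absolutely_continuous_path c d f"
  unfolding absolutely_continuous_path_def
proof (intro allI impI)
  fix e :: real assume "0 < e"
  obtain \<delta> where "0 < \<delta>" and \<delta>: "\<And>(n::nat) x y.
        (\<forall>i<n. a \<le> x i \<and> x i \<le> y i \<and> y i \<le> b) \<and>
        disjoint_family_on (\<lambda>i. {x i<..<y i}) {..<n} \<and>
        (\<Sum>i<n. y i - x i) < \<delta> \<Longrightarrow> (\<Sum>i<n. \<bar>f (y i) - f (x i)\<bar>) < e"
    by (rule absolutely_continuous_pathE[OF assms(1) \<open>0 < e\<close>]) blast
  have *: "(\<Sum>i<n. \<bar>f (y i) - f (x i)\<bar>) < e"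
    if "(\<forall>i<n. c \<le> x i \<and> x i \<le> y i \<and> y i \<le> d) \<and>
        disjoint_family_on (\<lambda>i. {x i<..<y i}) {..<n} \<and> (\<Sum>i<n. y i - x i) < \<delta>" for n :: nat and x y
    using that assms(2,3) by (intro \<delta>) force
  from \<open>0 < \<delta>\<close> show "\<exists>\<delta>>0. \<forall>(n::nat) x y. (\<forall>i<n. c \<le> x i \<and> x i \<le> y i \<and> y i \<le> d) \<and>
        disjoint_family_on (\<lambda>i. {x i<..<y i}) {..<n} \<and> (\<Sum>i<n. y i - x i) < \<delta> \<longrightarrow>
        (\<Sum>i<n. \<bar>f (y i) - f (x i)\<bar>) < e"
    by (intro exI[of _ \<delta>] conjI allI impI) (assumption, rule *)
qed

text \<open>
  Absolute continuity passes to any function whose increments are controlled by those of two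
  absolutely continuous ones. This replaces separate closure rules for sums, differences and
  compositions with locally Lipschitz functions.
\<close>

lemma absolutely_continuous_path_dominated:
  assumes f: "absolutely_continuous_path a b f" and g: "absolutely_continuous_path a b g"
    and le: "\<And>x y. a \<le> x \<Longrightarrow> x \<le> y \<Longrightarrow> y \<le> b \<Longrightarrow>
      \<bar>\<phi> y - \<phi> x\<bar> \<le> L * (\<bar>f y - f x\<bar> + \<bar>g y - g x\<bar>)"
  shows "absolutely_continuous_path a b \<phi>"
  unfolding absolutely_continuous_path_def
proof (intro allI impI)
  fix e :: real assume e: "0 < e"
  define K where "K = \<bar>L\<bar> + 1"
  have K: "0 < K" "L \<le> K" by (auto simp: K_def)
  define e' where "e' = e / (2 * K)"
  have e': "0 < e'" "K * (e' + e') = e" using e K by (auto simp: e'_def)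
  obtain d1 where "0 < d1" and d1: "\<And>(n::nat) x y.
        (\<forall>i<n. a \<le> x i \<and> x i \<le> y i \<and> y i \<le> b) \<and>
        disjoint_family_on (\<lambda>i. {x i<..<y i}) {..<n} \<and>
        (\<Sum>i<n. y i - x i) < d1 \<Longrightarrow> (\<Sum>i<n. \<bar>f (y i) - f (x i)\<bar>) < e'"
    by (rule absolutely_continuous_pathE[OF f e'(1)]) blast
  obtain d2 where "0 < d2" and d2: "\<And>(n::nat) x y.
        (\<forall>i<n. a \<le> x i \<and> x i \<le> y i \<and> y i \<le> b) \<and>
        disjoint_family_on (\<lambda>i. {x i<..<y i}) {..<n} \<and>
        (\<Sum>i<n. y i - x i) < d2 \<Longrightarrow> (\<Sum>i<n. \<bar>g (y i) - g (x i)\<bar>) < e'"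
    by (rule absolutely_continuous_pathE[OF g e'(1)]) blast
  have *: "(\<Sum>i<n. \<bar>\<phi> (y i) - \<phi> (x i)\<bar>) < e"
    if "(\<forall>i<n. a \<le> x i \<and> x i \<le> y i \<and> y i \<le> b) \<and>
        disjoint_family_on (\<lambda>i. {x i<..<y i}) {..<n} \<and> (\<Sum>i<n. y i - x i) < min d1 d2" for n :: nat and x y
  proof -
    have "(\<Sum>i<n. \<bar>\<phi> (y i) - \<phi> (x i)\<bar>) \<le> (\<Sum>i<n. K * (\<bar>f (y i) - f (x i)\<bar> + \<bar>g (y i) - g (x i)\<bar>))"
    proof (rule sum_mono)
      fix i assume "i \<in> {..<n}"
      then have "\<bar>\<phi> (y i) - \<phi> (x i)\<bar> \<le> L * (\<bar>f (y i) - f (x i)\<bar> + \<bar>g (y i) - g (x i)\<bar>)"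
        using that by (intro le) auto
      also have "\<dots> \<le> K * (\<bar>f (y i) - f (x i)\<bar> + \<bar>g (y i) - g (x i)\<bar>)"
        using K by (intro mult_right_mono) auto
      finally show "\<bar>\<phi> (y i) - \<phi> (x i)\<bar> \<le> K * (\<bar>f (y i) - f (x i)\<bar> + \<bar>g (y i) - g (x i)\<bar>)" .
    qed
    also have "\<dots> = K * ((\<Sum>i<n. \<bar>f (y i) - f (x i)\<bar>) + (\<Sum>i<n. \<bar>g (y i) - g (x i)\<bar>))"
      by (simp add: sum_distrib_left sum.distrib distrib_left)
    also have "\<dots> < K * (e' + e')"
      using that K by (intro mult_strict_left_mono add_strict_mono d1 d2) auto
    finally show ?thesis using e' by simp
  qed
  have "0 < min d1 d2" using \<open>0 < d1\<close> \<open>0 < d2\<close> by simp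
  then show "\<exists>\<delta>>0. \<forall>(n::nat) x y. (\<forall>i<n. a \<le> x i \<and> x i \<le> y i \<and> y i \<le> b) \<and>
        disjoint_family_on (\<lambda>i. {x i<..<y i}) {..<n} \<and> (\<Sum>i<n. y i - x i) < \<delta> \<longrightarrow>
        (\<Sum>i<n. \<bar>\<phi> (y i) - \<phi> (x i)\<bar>) < e"
    by (intro exI[of _ "min d1 d2"] conjI allI impI) (assumption, rule *)
qed

lemma absolutely_continuous_path_ident: "absolutely_continuous_path a b (\<lambda>x. x)"
  unfolding absolutely_continuous_path_def by (intro allI impI exI conjI) auto

lemma absolutely_continuous_imp_continuous_on:
  assumes "absolutely_continuous_path a b f"
  shows "continuous_on {a..b} f"
  unfolding continuous_on_iff
proof (intro ballI allI impI)
  fix x e :: real assume x: "x \<in> {a..b}" and e: "0 < e"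
  obtain \<delta> where "0 < \<delta>" and \<delta>: "\<And>(n::nat) x y.
        (\<forall>i<n. a \<le> x i \<and> x i \<le> y i \<and> y i \<le> b) \<and>
        disjoint_family_on (\<lambda>i. {x i<..<y i}) {..<n} \<and>
        (\<Sum>i<n. y i - x i) < \<delta> \<Longrightarrow> (\<Sum>i<n. \<bar>f (y i) - f (x i)\<bar>) < e"
    by (rule absolutely_continuous_pathE[OF assms \<open>0 < e\<close>]) blast
  have "dist (f x') (f x) < e" if "x' \<in> {a..b}" "dist x' x < \<delta>" for x'
    using \<delta>[of 1 "\<lambda>_. min x x'" "\<lambda>_. max x x'"] x that
    by (cases "x \<le> x'") (auto simp: dist_real_def disjoint_family_on_def)
  then show "\<exists>d>0. \<forall>x'\<in>{a..b}. dist x' x < d \<longrightarrow> dist (f x') (f x) < e"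
    using \<open>0 < \<delta>\<close> by blast
qed

section \<open>Gronwall estimates and terminal value problems\<close>

lemma nondecreasing_within:
  fixes f :: "real \<Rightarrow> real"
  assumes "a \<le> b"
    and "\<And>x. x \<in> {a..b} \<Longrightarrow> (f has_real_derivative f' x) (at x within {a..b})"
    and "\<And>x. x \<in> {a..b} \<Longrightarrow> 0 \<le> f' x"
  shows "f a \<le> f b"
proof -
  have "(f' has_integral f b - f a) {a..b}"
    using assms by (intro fundamental_theorem_of_calculus)
      (auto simp: has_real_derivative_iff_has_vector_derivative[symmetric])
  then have "0 \<le> f b - f a" using assms(3) by (rule has_integral_nonneg)
  then show ?thesis by simp
qed

lemma has_real_derivative_norm_sq:
  fixes \<delta> :: "real \<Rightarrow> 'a::real_inner"
  assumes "(\<delta> has_vector_derivative d) (at s within S)"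
  shows "((\<lambda>s. (norm (\<delta> s))\<^sup>2) has_real_derivative 2 * (\<delta> s \<bullet> d)) (at s within S)"
proof -
  have "((\<lambda>s. \<delta> s \<bullet> \<delta> s) has_vector_derivative (\<delta> s \<bullet> d + d \<bullet> \<delta> s)) (at s within S)"
    using bounded_bilinear.has_vector_derivative[OF bounded_bilinear_inner assms assms] .
  then show ?thesis
    by (simp add: has_real_derivative_iff_has_vector_derivative power2_norm_eq_inner inner_commute)
qed

text \<open>
  Working with squared norms avoids differentiating the norm at the origin. The factor
  \<open>3\<close> comes from \<open>2 a (a + \<eta>) \<le> 3 (a\<^sup>2 +
  \<eta>\<^sup>2)\<close>. The hypothesis is symmetric in time, hence the estimate in both
  directions.
\<close>

lemma gronwall_norm_sq:
  fixes \<delta> :: "real \<Rightarrow> 'a::real_inner"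
  assumes ab: "a \<le> b"
    and der: "\<And>s. s \<in> {a..b} \<Longrightarrow> (\<delta> has_vector_derivative \<delta>' s) (at s within {a..b})"
    and bd: "\<And>s. s \<in> {a..b} \<Longrightarrow> norm (\<delta>' s) \<le> k * (norm (\<delta> s) + \<eta>)" and k: "0 \<le> k" and \<eta>: "0 \<le> \<eta>"
  shows "(norm (\<delta> a))\<^sup>2 + \<eta>\<^sup>2 \<le> exp (3 * k * (b - a)) * ((norm (\<delta> b))\<^sup>2 + \<eta>\<^sup>2)"
    and "(norm (\<delta> b))\<^sup>2 + \<eta>\<^sup>2 \<le> exp (3 * k * (b - a)) * ((norm (\<delta> a))\<^sup>2 + \<eta>\<^sup>2)"
proof -
  have le: "\<bar>2 * (\<delta> s \<bullet> \<delta>' s)\<bar> \<le> 3 * k * ((norm (\<delta> s))\<^sup>2 + \<eta>\<^sup>2)" if "s \<in> {a..b}" for s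
  proof -
    have "\<bar>\<delta> s \<bullet> \<delta>' s\<bar> \<le> norm (\<delta> s) * norm (\<delta>' s)" by (rule Cauchy_Schwarz_ineq2)
    also have "\<dots> \<le> norm (\<delta> s) * (k * (norm (\<delta> s) + \<eta>))"
      by (intro mult_left_mono bd that) auto
    also have "\<dots> = k * ((norm (\<delta> s))\<^sup>2 + norm (\<delta> s) * \<eta>)" by (simp add: power2_eq_square algebra_simps)
    finally have 1: "\<bar>\<delta> s \<bullet> \<delta>' s\<bar> \<le> k * ((norm (\<delta> s))\<^sup>2 + norm (\<delta> s) * \<eta>)" .
    have "2 * (norm (\<delta> s) * \<eta>) \<le> (norm (\<delta> s))\<^sup>2 + \<eta>\<^sup>2"
      using sum_squares_bound[of "norm (\<delta> s)" \<eta>] by (simp add: mult.assoc)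
    then have "2 * ((norm (\<delta> s))\<^sup>2 + norm (\<delta> s) * \<eta>) \<le> 3 * ((norm (\<delta> s))\<^sup>2 + \<eta>\<^sup>2)"
      using zero_le_power2[of \<eta>] unfolding distrib_left by linarith
    from mult_left_mono[OF this k] 1 show ?thesis by (simp add: algebra_simps)
  qed
  have "((norm (\<delta> a))\<^sup>2 + \<eta>\<^sup>2) * exp (3 * k * a) \<le> ((norm (\<delta> b))\<^sup>2 + \<eta>\<^sup>2) * exp (3 * k * b)"
  proof (rule nondecreasing_within[OF ab])
    fix s assume s: "s \<in> {a..b}"
    show "((\<lambda>s. ((norm (\<delta> s))\<^sup>2 + \<eta>\<^sup>2) * exp (3 * k * s)) has_real_derivative
        exp (3 * k * s) * (2 * (\<delta> s \<bullet> \<delta>' s) + 3 * k * ((norm (\<delta> s))\<^sup>2 + \<eta>\<^sup>2))) (at s within {a..b})"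
      by (rule derivative_eq_intros has_real_derivative_norm_sq[OF der[OF s]] refl)+
        (simp add: algebra_simps)
    show "0 \<le> exp (3 * k * s) * (2 * (\<delta> s \<bullet> \<delta>' s) + 3 * k * ((norm (\<delta> s))\<^sup>2 + \<eta>\<^sup>2))"
      using le[OF s] by (intro mult_nonneg_nonneg) (auto simp: abs_le_iff)
  qed
  then show "(norm (\<delta> a))\<^sup>2 + \<eta>\<^sup>2 \<le> exp (3 * k * (b - a)) * ((norm (\<delta> b))\<^sup>2 + \<eta>\<^sup>2)"
    by (simp add: right_diff_distrib exp_diff field_simps)
  have "- (((norm (\<delta> a))\<^sup>2 + \<eta>\<^sup>2) * exp (- (3 * k * a))) \<le> - (((norm (\<delta> b))\<^sup>2 + \<eta>\<^sup>2) * exp (- (3 * k * b)))"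
  proof (rule nondecreasing_within[OF ab])
    fix s assume s: "s \<in> {a..b}"
    show "((\<lambda>s. - (((norm (\<delta> s))\<^sup>2 + \<eta>\<^sup>2) * exp (- (3 * k * s)))) has_real_derivative
        exp (- (3 * k * s)) * (3 * k * ((norm (\<delta> s))\<^sup>2 + \<eta>\<^sup>2) - 2 * (\<delta> s \<bullet> \<delta>' s))) (at s within {a..b})"
      by (rule derivative_eq_intros has_real_derivative_norm_sq[OF der[OF s]] refl)+
        (simp add: algebra_simps)
    show "0 \<le> exp (- (3 * k * s)) * (3 * k * ((norm (\<delta> s))\<^sup>2 + \<eta>\<^sup>2) - 2 * (\<delta> s \<bullet> \<delta>' s))"
      using le[OF s] by (intro mult_nonneg_nonneg) (auto simp: abs_le_iff)
  qed
  then show "(norm (\<delta> b))\<^sup>2 + \<eta>\<^sup>2 \<le> exp (3 * k * (b - a)) * ((norm (\<delta> a))\<^sup>2 + \<eta>\<^sup>2)"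
    by (simp add: right_diff_distrib exp_diff exp_minus field_simps)
qed

text \<open>
  Picard iteration in a weighted supremum norm: with weight \<open>e s\<close>, the integral
  operator is a contraction with factor \<open>1/2\<close> on the entire interval, so no
  continuation argument is needed.
\<close>

lemma terminal_value_problem:
  fixes F :: "real \<Rightarrow> 'a::banach \<Rightarrow> 'a"
  assumes t: "0 \<le> t" and K: "0 < K"
    and cont: "\<And>g. continuous_on {0..t} g \<Longrightarrow> continuous_on {0..t} (\<lambda>s. F s (g s))"
    and lip: "\<And>s x y. s \<in> {0..t} \<Longrightarrow> norm (F s x - F s y) \<le> K * norm (x - y)"
  shows "\<exists>g. g t = w \<and> (\<forall>s\<in>{0..t}. (g has_vector_derivative F s (g s)) (at s within {0..t}))"
proof -
  define e where "e s = exp (2 * K * (t - s))" for s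
  \<comment> \<open>Constant extension beyond the interval turns continuous functions on it into bounded ones on the line.\<close>
  define c where "c s = max 0 (min t s)" for s :: real
  have c: "c s \<in> {0..t}" "s \<in> {0..t} \<Longrightarrow> c s = s" for s using t by (auto simp: c_def)
  define I where "I y s = integral {0..s} (\<lambda>r. F r (e r *\<^sub>R apply_bcontfun y r))" for y :: "real \<Rightarrow>\<^sub>C 'a" and s
  define G where "G y s = (1 / e s) *\<^sub>R (w - (I y t - I y s))" for y s
  have econt: "continuous_on S e" for S unfolding e_def by (intro continuous_intros)
  have epos: "0 < e s" for s by (simp add: e_def)
  have ycont: "continuous_on {0..t} (\<lambda>r. e r *\<^sub>R apply_bcontfun y r)" for y :: "real \<Rightarrow>\<^sub>C 'a"
    by (intro continuous_intros econt continuous_on_apply_bcontfun)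
  have I: "(I y has_vector_derivative F s (e s *\<^sub>R apply_bcontfun y s)) (at s within {0..t})"
    if "s \<in> {0..t}" for y s
    unfolding I_def by (rule integral_has_vector_derivative[OF cont[OF ycont] that])
  have Icont: "continuous_on {0..t} (I y)" for y
    by (rule continuous_on_vector_derivative) (rule I)
  have Gcont: "continuous_on {0..t} (G y)" for y
    unfolding G_def using epos by (intro continuous_intros econt Icont) (auto simp: less_imp_neq[symmetric])
  have mem: "(\<lambda>s. G y (c s)) \<in> bcontfun" for y
  proof -
    have "continuous_on UNIV (\<lambda>s. G y (c s))"
      by (rule continuous_on_compose2[OF Gcont]) (use c in \<open>auto simp: c_def intro!: continuous_intros\<close>)
    moreover have "bounded (range (\<lambda>s. G y (c s)))"
      by (rule bounded_subset[OF compact_imp_bounded[OF compact_continuous_image[OF Gcont compact_Icc]]])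
        (use c(1) in auto)
    ultimately show ?thesis by (simp add: bcontfun_def)
  qed
  define \<Psi> where "\<Psi> y = Bcontfun (\<lambda>s. G y (c s))" for y
  have \<Psi>: "apply_bcontfun (\<Psi> y) s = G y (c s)" for y s
    unfolding \<Psi>_def by (simp add: Bcontfun_inverse[OF mem])
  have contr: "dist (\<Psi> y) (\<Psi> y') \<le> 1 / 2 * dist y y'" for y y'
  proof (rule dist_bound)
    fix s0
    define s where "s = c s0"
    have s: "s \<in> {0..t}" using c by (simp add: s_def)
    define D where "D r = I y r - I y' r" for r
    define d where "d = dist y y'"
    have "norm (D t - D s) \<le> (- (d * e t / 2)) - (- (d * e s / 2))"
    proof (cases "s = t")
      case False
      then have "s < t" using s by auto
      then show ?thesis
      proof (rule differentiable_bound_general)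
        show "continuous_on {s..t} D" unfolding D_def
          using s by (intro continuous_intros continuous_on_subset[OF Icont]) auto
        show "continuous_on {s..t} (\<lambda>r. - (d * e r / 2))"
          by (intro continuous_intros econt) auto
        fix r assume r: "s < r" "r < t"
        then have r': "r \<in> {0..t}" and at: "at r within {0..t} = at r"
          using s by (auto intro!: at_within_interior)
        show "(D has_vector_derivative (F r (e r *\<^sub>R apply_bcontfun y r) - F r (e r *\<^sub>R apply_bcontfun y' r))) (at r)"
          unfolding D_def using I[OF r', of y] I[OF r', of y'] at
          by (auto intro: has_vector_derivative_diff)
        have "((\<lambda>r. - (d * e r / 2)) has_real_derivative K * e r * d) (at r)"
          unfolding e_def by (auto intro!: derivative_eq_intros)
        then show "((\<lambda>r. - (d * e r / 2)) has_vector_derivative K * e r * d) (at r)"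
          by (simp add: has_real_derivative_iff_has_vector_derivative)
        have "norm (F r (e r *\<^sub>R apply_bcontfun y r) - F r (e r *\<^sub>R apply_bcontfun y' r))
            \<le> K * norm (e r *\<^sub>R apply_bcontfun y r - e r *\<^sub>R apply_bcontfun y' r)"
          by (rule lip[OF r'])
        also have "\<dots> = K * (e r * dist (apply_bcontfun y r) (apply_bcontfun y' r))"
          using epos[of r] by (simp add: dist_norm flip: scaleR_diff_right)
        also have "\<dots> \<le> K * (e r * d)"
          unfolding d_def using K epos[of r] by (intro mult_left_mono dist_bounded) auto
        finally show "norm (F r (e r *\<^sub>R apply_bcontfun y r) - F r (e r *\<^sub>R apply_bcontfun y' r)) \<le> K * e r * d"
          by simp
      qed
    qed simp
    also have "\<dots> \<le> d * e s / 2" using epos[of t] by (simp add: d_def)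
    finally have le: "norm (D t - D s) \<le> d * e s / 2" .
    have "dist (G y s) (G y' s) = norm ((1 / e s) *\<^sub>R (D s - D t))"
      unfolding dist_norm G_def D_def scaleR_diff_right[symmetric] by (simp add: algebra_simps)
    also have "\<dots> = (1 / e s) * norm (D t - D s)" using epos[of s] by (simp add: norm_minus_commute)
    also have "\<dots> \<le> (1 / e s) * (d * e s / 2)" using epos[of s] by (intro mult_left_mono le) auto
    also have "\<dots> = 1 / 2 * d" using epos[of s] by simp
    finally show "dist (apply_bcontfun (\<Psi> y) s0) (apply_bcontfun (\<Psi> y') s0) \<le> 1 / 2 * dist y y'"
      by (simp add: \<Psi> s_def d_def)
  qed
  obtain y where y: "\<Psi> y = y"
    using banach_fix_type[of "1/2" \<Psi>] contr by auto
  define g where "g s = w - (I y t - I y s)" for s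
  have g: "e s *\<^sub>R apply_bcontfun y s = g s" if "s \<in> {0..t}" for s
  proof -
    have "apply_bcontfun y s = G y s" using \<Psi>[of y s] y c(2)[OF that] by simp
    then show ?thesis using epos[of s] by (simp add: G_def g_def)
  qed
  show ?thesis
  proof (intro exI conjI ballI)
    show "g t = w" by (simp add: g_def)
    fix s assume s: "s \<in> {0..t}"
    have "(g has_vector_derivative 0 - (0 - F s (e s *\<^sub>R apply_bcontfun y s))) (at s within {0..t})"
      unfolding g_def by (intro has_vector_derivative_diff has_vector_derivative_const I s)
    then show "(g has_vector_derivative F s (g s)) (at s within {0..t})" by (simp add: g[OF s])
  qed
qed

section \<open>The inverse flow on the half-plane\<close>

lemma loewner_solution_derivative:
  assumes "loewner_solution U z t g" "s \<in> S" "S \<subseteq> {0..t}"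
  shows "(g has_vector_derivative 2 / (g s - complex_of_real (U s))) (at s within S)"
  using assms unfolding loewner_solution_def
  by (blast intro: has_vector_derivative_within_subset)

lemma loewner_solution_restrict:
  assumes "loewner_solution U z t g" "s \<le> t"
  shows "loewner_solution U z s g"
  using assms loewner_solution_derivative[OF assms(1), of _ "{0..s}"]
  unfolding loewner_solution_def by auto

lemma loewner_solution_continuous:
  assumes "loewner_solution U z t g"
  shows "continuous_on {0..t} g"
  using assms unfolding loewner_solution_def
  by (intro continuous_on_vector_derivative) auto

text \<open>
  The difference of two flow lines with the same driver solves a linear equation. Uniqueness,
  injectivity, the derivative of \<open>f\<^sub>t\<close> and simplicity of the trace all exploit
  this.
\<close>

lemma diff_of_velocities:
  fixes a b :: complex
  assumes "a \<noteq> 0" "b \<noteq> 0"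
  shows "2 / a - 2 / b = - (2 / (a * b)) * (a - b)"
  using assms by (simp add: field_simps)

lemma norm_diff_of_velocities:
  fixes a b :: complex
  assumes "c \<le> norm a" "c \<le> norm b" "0 < c"
  shows "norm (2 / a - 2 / b) \<le> 2 / c\<^sup>2 * norm (a - b)"
proof -
  have "a \<noteq> 0" "b \<noteq> 0" using assms by auto
  then have "norm (2 / a - 2 / b) = 2 / (norm a * norm b) * norm (a - b)"
    unfolding diff_of_velocities[OF \<open>a \<noteq> 0\<close> \<open>b \<noteq> 0\<close>] norm_mult norm_minus_cancel norm_divide by simp
  also have "\<dots> \<le> 2 / c\<^sup>2 * norm (a - b)"
  proof (intro mult_right_mono divide_left_mono)
    show "c\<^sup>2 \<le> norm a * norm b"
      unfolding power2_eq_square using assms by (intro mult_mono) auto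
    show "0 < norm a * norm b * c\<^sup>2" using assms by (intro mult_pos_pos) auto
  qed auto
  finally show ?thesis .
qed

text \<open>
  A flow line stays away from the driver on the compact time interval, so the linear equation for
  the difference has bounded coefficient. Boundary points are included: injectivity of
  \<open>g\<^sub>t\<close> is needed on the entire domain of the inverse.
\<close>

lemma loewner_solution_unique:
  assumes g1: "loewner_solution U z1 t g1" and g2: "loewner_solution U z2 t g2"
    and U: "continuous_on {0..t} U" and ab: "0 \<le> a" "a \<le> b" "b \<le> t"
  shows "g1 a = g2 a \<longleftrightarrow> g1 b = g2 b"
proof -
  define D where "D s = min (norm (g1 s - U s)) (norm (g2 s - U s))" for s
  have "continuous_on {0..t} D" unfolding D_def
    by (intro continuous_intros loewner_solution_continuous[OF g1] loewner_solution_continuous[OF g2] U)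
  then obtain m where m: "m \<in> {0..t}" "\<And>s. s \<in> {0..t} \<Longrightarrow> D m \<le> D s"
    using continuous_attains_inf[of "{0..t}" D] ab by auto
  define c where "c = D m"
  have c: "0 < c" using g1 g2 m(1) by (auto simp: loewner_solution_def c_def D_def)
  have bd: "c \<le> norm (g1 s - U s)" "c \<le> norm (g2 s - U s)" if "s \<in> {0..t}" for s
    using m(2)[OF that] by (auto simp: c_def D_def)
  have der: "((\<lambda>s. g1 s - g2 s) has_vector_derivative (2 / (g1 s - U s) - 2 / (g2 s - U s))) (at s within {a..b})"
    if "s \<in> {a..b}" for s
    using that ab
    by (intro has_vector_derivative_diff loewner_solution_derivative[OF g1] loewner_solution_derivative[OF g2]) auto
  have le: "norm (2 / (g1 s - U s) - 2 / (g2 s - U s)) \<le> 2 / c\<^sup>2 * (norm (g1 s - g2 s) + 0)"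
    if "s \<in> {a..b}" for s
    using norm_diff_of_velocities[OF bd(1)[of s] bd(2)[of s] c] that ab by simp
  have k: "0 \<le> 2 / c\<^sup>2" by simp
  from gronwall_norm_sq[OF ab(2) der le k] show ?thesis by auto
qed

text \<open>
  Replacing the imaginary part by its maximum with \<open>Im w\<close> makes the vector field
  globally Lipschitz. The modified solution has decreasing imaginary part, hence never notices the
  modification.
\<close>

lemma loewner_backward_exists:
  assumes t: "0 \<le> t" and U: "continuous_on {0..t} U" and w: "0 < Im w"
  shows "\<exists>g. loewner_solution U (g 0) t g \<and> g t = w \<and> (\<forall>s\<in>{0..t}. Im w \<le> Im (g s))"
proof -
  define y where "y = Im w"
  define P where "P z = complex_of_real (Re z) + \<i> * complex_of_real (max (Im z) y)" for z
  define F where "F s z = 2 / (P z - complex_of_real (U s))" for s z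
  have y: "0 < y" using w by (simp add: y_def)
  have PU: "y \<le> norm (P z - complex_of_real a)" for z a
    using abs_Im_le_cmod[of "P z - complex_of_real a"] by (simp add: P_def)
  have ne: "P z - complex_of_real a \<noteq> 0" for z a using PU[of z a] y by auto
  have Plip: "norm (P x - P z) \<le> norm (x - z)" for x z
  proof -
    have "\<bar>max (Im x) y - max (Im z) y\<bar> \<le> \<bar>Im x - Im z\<bar>" by (auto simp: max_def)
    then have "(max (Im x) y - max (Im z) y)\<^sup>2 \<le> (Im x - Im z)\<^sup>2" by (rule abs_le_square_iff[THEN iffD1])
    then show ?thesis unfolding cmod_def by (intro real_sqrt_le_mono) (simp add: P_def)
  qed
  have "\<exists>g. g t = w \<and> (\<forall>s\<in>{0..t}. (g has_vector_derivative F s (g s)) (at s within {0..t}))"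
  proof (rule terminal_value_problem[OF t, of "2 / y\<^sup>2" F w])
    show "0 < 2 / y\<^sup>2" using y by simp
    show "continuous_on {0..t} (\<lambda>s. F s (g s))" if "continuous_on {0..t} g" for g
      unfolding F_def P_def
      by (intro continuous_intros that U) (use ne in \<open>auto simp: P_def\<close>)
    show "norm (F s x - F s z) \<le> 2 / y\<^sup>2 * norm (x - z)" for s x z
    proof -
      have "norm (F s x - F s z) \<le> 2 / y\<^sup>2 * norm ((P x - U s) - (P z - U s))"
        unfolding F_def by (rule norm_diff_of_velocities[OF PU PU y])
      also have "\<dots> \<le> 2 / y\<^sup>2 * norm (x - z)" using Plip by (intro mult_left_mono) auto
      finally show ?thesis .
    qed
  qed
  then obtain g where g: "g t = w"
    "\<And>s. s \<in> {0..t} \<Longrightarrow> (g has_vector_derivative F s (g s)) (at s within {0..t})"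
    by auto
  have Im: "y \<le> Im (g s)" if s: "s \<in> {0..t}" for s
  proof -
    have "- Im (g s) \<le> - Im (g t)"
    proof (rule nondecreasing_within[of s t "\<lambda>r. - Im (g r)"])
      show "s \<le> t" using s by simp
      fix r assume r: "r \<in> {s..t}"
      then have "(g has_vector_derivative F r (g r)) (at r within {s..t})"
        using g(2)[of r] s by (auto intro: has_vector_derivative_within_subset)
      then have "((\<lambda>r. - Im (g r)) has_vector_derivative (- Im (F r (g r)))) (at r within {s..t})"
        by (intro has_vector_derivative_minus bounded_linear.has_vector_derivative[OF bounded_linear_Im])
      then show "((\<lambda>r. - Im (g r)) has_real_derivative - Im (F r (g r))) (at r within {s..t})"
        by (simp add: has_real_derivative_iff_has_vector_derivative)
      show "0 \<le> - Im (F r (g r))"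
        using y by (auto simp: F_def P_def Im_divide intro!: divide_nonpos_nonneg)
    qed
    then show ?thesis by (simp add: g y_def)
  qed
  have Pg: "P (g s) = g s" if "s \<in> {0..t}" for s
    using Im[OF that] by (simp add: P_def complex_eq_iff)
  have "g s \<noteq> complex_of_real (U s)" if "s \<in> {0..t}" for s
    using ne[of "g s" "U s"] Pg[OF that] by simp
  then have "loewner_solution U (g 0) t g"
    using g(2) Pg unfolding loewner_solution_def F_def by simp
  with g(1) Im show ?thesis by (auto simp: y_def)
qed

text \<open>
  The flow line that is at \<open>w\<close> at time \<open>t\<close>, as a function of time; on
  \<open>{0..t}\<close> it is unique. The height bound belongs to the description so that it comes
  with the choice.
\<close>

definition loewner_back :: "(real \<Rightarrow> real) \<Rightarrow> real \<Rightarrow> complex \<Rightarrow> real \<Rightarrow> complex" where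
  "loewner_back U t w =
     (SOME g. loewner_solution U (g 0) t g \<and> g t = w \<and> (\<forall>s\<in>{0..t}. Im w \<le> Im (g s)))"

lemma loewner_back:
  assumes "0 \<le> t" "continuous_on {0..t} U" "0 < Im w"
  shows loewner_back_solution: "loewner_solution U (loewner_back U t w 0) t (loewner_back U t w)"
    and loewner_back_end: "loewner_back U t w t = w"
    and loewner_back_Im: "\<And>s. s \<in> {0..t} \<Longrightarrow> Im w \<le> Im (loewner_back U t w s)"
  using someI_ex[OF loewner_backward_exists[OF assms]] unfolding loewner_back_def by auto

lemma loewner_g_eq:
  assumes "0 \<le> t" "continuous_on {0..t} U" "loewner_solution U z t g"
  shows "loewner_g U t z = g t"
  unfolding loewner_g_def
proof (rule the_equality)
  show "\<exists>g'. loewner_solution U z t g' \<and> g t = g' t" using assms by blast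
  fix w assume "\<exists>g'. loewner_solution U z t g' \<and> w = g' t"
  then obtain g' where g': "loewner_solution U z t g'" "w = g' t" by blast
  then have "g' 0 = g 0" using assms(3) by (simp add: loewner_solution_def)
  then show "w = g t"
    using loewner_solution_unique[OF g'(1) assms(3,2), of 0 t] assms(1) g'(2) by simp
qed

lemma loewner_f_eq:
  assumes t: "0 \<le> t" and U: "continuous_on {0..t} U" and w: "0 < Im w"
  shows "loewner_f U t w = loewner_back U t w 0"
  unfolding loewner_f_def
proof (rule the_inv_into_f_eq)
  note b = loewner_back[OF assms]
  show "inj_on (loewner_g U t) (loewner_domain U t)"
  proof (rule inj_onI)
    fix z1 z2 assume "z1 \<in> loewner_domain U t" "z2 \<in> loewner_domain U t"
      and eq: "loewner_g U t z1 = loewner_g U t z2"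
    then obtain g1 g2 where g: "loewner_solution U z1 t g1" "loewner_solution U z2 t g2"
      by (auto simp: loewner_domain_def)
    then have "g1 t = g2 t" using eq by (simp add: loewner_g_eq[OF t U])
    then have "g1 0 = g2 0" using loewner_solution_unique[OF g U, of 0 t] t by simp
    then show "z1 = z2" using g by (simp add: loewner_solution_def)
  qed
  show "loewner_g U t (loewner_back U t w 0) = w"
    using loewner_g_eq[OF t U b(1)] b(2) by simp
  have "0 < Im (loewner_back U t w 0)" using b(3)[of 0] w t by simp
  then show "loewner_back U t w 0 \<in> loewner_domain U t"
    using b(1) by (auto simp: loewner_domain_def)
qed

text \<open>
  The flow property: following a flow line down to time \<open>s\<close> first does not change its
  starting point.
\<close>

lemma loewner_f_compose:
  assumes t: "0 \<le> t" and U: "continuous_on {0..t} U" and w: "0 < Im w" and s: "s \<in> {0..t}"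
  shows "loewner_f U s (loewner_back U t w s) = loewner_f U t w"
proof -
  note b = loewner_back[OF t U w]
  have U': "continuous_on {0..s} U" using U s by (auto intro: continuous_on_subset)
  have w': "0 < Im (loewner_back U t w s)" using b(3)[OF s] w by simp
  have s0: "0 \<le> s" using s by simp
  note b' = loewner_back[OF s0 U' w']
  have "loewner_solution U (loewner_back U t w 0) s (loewner_back U t w)"
    using loewner_solution_restrict[OF b(1)] s by simp
  from loewner_solution_unique[OF this b'(1) U', of 0 s] b'(2) s0
  show ?thesis by (simp add: loewner_f_eq[OF s0 U' w'] loewner_f_eq[OF t U w])
qed

lemma norm_back_minus_driver_ge:
  assumes "0 \<le> t" "continuous_on {0..t} U" "0 < Im w" "s \<in> {0..t}"
  shows "Im w \<le> norm (loewner_back U t w s - complex_of_real a)"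
    and "loewner_back U t w s - complex_of_real a \<noteq> 0"
proof -
  show "Im w \<le> norm (loewner_back U t w s - complex_of_real a)"
    using loewner_back_Im[OF assms] abs_Im_le_cmod[of "loewner_back U t w s - complex_of_real a"] by simp
  then show "loewner_back U t w s - complex_of_real a \<noteq> 0" using assms(3) by auto
qed

lemma loewner_back_derivative:
  assumes "0 \<le> t" "continuous_on {0..t} U" "0 < Im w" "s \<in> {0..t}"
  shows "(loewner_back U t w has_vector_derivative 2 / (loewner_back U t w s - U s)) (at s within {0..t})"
  using loewner_back_solution[OF assms(1-3)] assms(4) by (simp add: loewner_solution_def)

lemma loewner_back_continuous:
  assumes "0 \<le> t" "continuous_on {0..t} U" "0 < Im w"
  shows "continuous_on {0..t} (loewner_back U t w)"
  by (rule loewner_solution_continuous[OF loewner_back_solution[OF assms]])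

lemma loewner_back_integrand_continuous:
  assumes "0 \<le> t" "continuous_on {0..t} U" "0 < Im w" "0 < Im v"
  shows "continuous_on {0..t} (\<lambda>s. 2 / ((loewner_back U t w s - U s) * (loewner_back U t v s - U s)))"
  by (intro continuous_intros loewner_back_continuous assms)
    (use norm_back_minus_driver_ge(2) assms in auto)

text \<open>
  Solving the linear equation for the difference of two flow lines explicitly turns the difference
  quotient of \<open>f\<^sub>t\<close> into an exponential, whose limit on the diagonal is the
  derivative.
\<close>

lemma loewner_f_diff:
  assumes t: "0 \<le> t" and U: "continuous_on {0..t} U" and w: "0 < Im w" and v: "0 < Im v"
  shows "loewner_f U t w - loewner_f U t v = (w - v) *
    exp (integral {0..t} (\<lambda>s. 2 / ((loewner_back U t w s - U s) * (loewner_back U t v s - U s))))"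
proof -
  define A where "A s = 2 / ((loewner_back U t w s - U s) * (loewner_back U t v s - U s))" for s
  define \<delta> where "\<delta> s = loewner_back U t w s - loewner_back U t v s" for s
  have Ac: "continuous_on {0..t} A"
    unfolding A_def by (rule loewner_back_integrand_continuous[OF assms])
  have der: "((\<lambda>s. \<delta> s * exp (integral {0..s} A)) has_vector_derivative 0) (at s within {0..t})"
    if s: "s \<in> {0..t}" for s
  proof -
    have I: "((\<lambda>s. exp (integral {0..s} A)) has_vector_derivative A s * exp (integral {0..s} A)) (at s within {0..t})"
      using field_vector_diff_chain_within[OF integral_has_vector_derivative[OF Ac s], of exp]
      by (auto simp: o_def intro: DERIV_exp has_field_derivative_at_within)
    have eq: "2 / (loewner_back U t w s - U s) - 2 / (loewner_back U t v s - U s) = - A s * \<delta> s"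
      using diff_of_velocities[OF norm_back_minus_driver_ge(2)[OF t U w s] norm_back_minus_driver_ge(2)[OF t U v s]]
      by (simp add: A_def \<delta>_def)
    have "(\<delta> has_vector_derivative - A s * \<delta> s) (at s within {0..t})"
      unfolding \<delta>_def eq[unfolded \<delta>_def, symmetric]
      by (intro has_vector_derivative_diff loewner_back_derivative t U w v s)
    from has_vector_derivative_mult[OF this I]
    show ?thesis by (simp add: algebra_simps)
  qed
  obtain c where c: "\<And>s. s \<in> {0..t} \<Longrightarrow> \<delta> s * exp (integral {0..s} A) = c"
    using has_vector_derivative_zero_constant[OF _ der] by (metis convex_real_interval(5))
  have "\<delta> 0 * exp (integral {0..0} A) = \<delta> t * exp (integral {0..t} A)"
    using c[of 0] c[of t] t by (simp only: atLeastAtMost_iff order_refl)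
  then show ?thesis
    by (simp add: \<delta>_def A_def[abs_def] loewner_f_eq[OF t U w] loewner_f_eq[OF t U v]
        loewner_back_end[OF t U w] loewner_back_end[OF t U v])
qed

text \<open>
  Different drivers and different endpoints at once: the case \<open>U = V\<close>, \<open>\<eta>
  = 0\<close> serves differentiability, the case of tips at equal height serves continuity in the
  driver.
\<close>

lemma loewner_back_stability:
  assumes t: "0 \<le> t" and U: "continuous_on {0..t} U" and V: "continuous_on {0..t} V"
    and y: "0 < y" "y \<le> Im w" "y \<le> Im v"
    and \<eta>: "\<And>s. s \<in> {0..t} \<Longrightarrow> \<bar>U s - V s\<bar> \<le> \<eta>" and s: "s \<in> {0..t}"
  shows "(norm (loewner_back U t w s - loewner_back V t v s))\<^sup>2 + \<eta>\<^sup>2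
    \<le> exp (3 * (2 / y\<^sup>2) * (t - s)) * ((norm (w - v))\<^sup>2 + \<eta>\<^sup>2)"
proof -
  have w: "0 < Im w" and v: "0 < Im v" using y by auto
  have st: "s \<le> t" using s by simp
  have k: "0 \<le> 2 / y\<^sup>2" by simp
  have \<eta>0: "0 \<le> \<eta>" using \<eta>[OF s] by linarith
  have der: "((\<lambda>s. loewner_back U t w s - loewner_back V t v s) has_vector_derivative
      (2 / (loewner_back U t w r - U r) - 2 / (loewner_back V t v r - V r))) (at r within {s..t})"
    if "r \<in> {s..t}" for r
    using that s
    by (intro has_vector_derivative_diff has_vector_derivative_within_subset[OF loewner_back_derivative]
        t U V w v) auto
  have le: "norm (2 / (loewner_back U t w r - U r) - 2 / (loewner_back V t v r - V r))
      \<le> 2 / y\<^sup>2 * (norm (loewner_back U t w r - loewner_back V t v r) + \<eta>)" if "r \<in> {s..t}" for r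
  proof -
    have r: "r \<in> {0..t}" using that s by auto
    let ?a = "loewner_back U t w r" and ?b = "loewner_back V t v r"
    have "norm (2 / (?a - U r) - 2 / (?b - V r)) \<le> 2 / y\<^sup>2 * norm ((?a - U r) - (?b - V r))"
      using norm_back_minus_driver_ge(1)[OF t U w r, of "U r"]
        norm_back_minus_driver_ge(1)[OF t V v r, of "V r"] y
      by (intro norm_diff_of_velocities) auto
    also have "(?a - U r) - (?b - V r) = (?a - ?b) - of_real (U r - V r)" by simp
    also have "norm \<dots> \<le> norm (?a - ?b) + norm (complex_of_real (U r - V r))" by (rule norm_triangle_ineq4)
    also have "norm (complex_of_real (U r - V r)) \<le> \<eta>" using \<eta>[OF r] by (simp only: norm_of_real)
    finally show ?thesis using k by (simp add: mult_left_mono del: times_divide_eq_left)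
  qed
  from gronwall_norm_sq(1)[OF st der le k \<eta>0] show ?thesis
    by (simp only: loewner_back_end[OF t U w] loewner_back_end[OF t V v])
qed

text \<open>
  Above height \<open>Im w / 2\<close> flow lines depend on their endpoint in a Lipschitz way,
  uniformly in time. Therefore the exponent in the formula for differences converges as the second
  endpoint tends to \<open>w\<close>.
\<close>

lemma loewner_f_has_field_derivative:
  assumes t: "0 \<le> t" and U: "continuous_on {0..t} U" and w: "0 < Im w"
  shows "(loewner_f U t has_field_derivative
    exp (integral {0..t} (\<lambda>s. 2 / (loewner_back U t w s - U s)\<^sup>2))) (at w)"
proof -
  define y where "y = Im w / 2"
  define A where "A v s = 2 / ((loewner_back U t w s - U s) * (loewner_back U t v s - U s))" for v s
  define C where "C = exp (3 / y\<^sup>2 * t)"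
  define M where "M = 2 / (y\<^sup>2 * y) * C"
  have y: "0 < y" "y \<le> Im w" using w by (auto simp: y_def)
  have near: "eventually (\<lambda>v. y < Im v) (at w)"
  proof -
    have "(Im \<longlongrightarrow> Im w) (at w)" by (intro tendsto_intros)
    then show ?thesis using w by (intro order_tendstoD(1)) (auto simp: y_def)
  qed
  have Aint: "A v integrable_on {0..t}" if "0 < Im v" for v
    unfolding A_def by (intro integrable_continuous_real loewner_back_integrand_continuous t U w that)
  have lip: "norm (integral {0..t} (A v) - integral {0..t} (A w)) \<le> M * t * norm (v - w)" if v: "y < Im v" for v
  proof -
    have v0: "0 < Im v" using v y by simp
    have bd: "norm (A v s - A w s) \<le> M * norm (v - w)" if s: "s \<in> {0..t}" for s
    proof -
      define a where "a = loewner_back U t w s - U s"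
      define b where "b = loewner_back U t v s - U s"
      have a: "y \<le> norm a" "a \<noteq> 0"
        using norm_back_minus_driver_ge[OF t U w s, of "U s"] y by (auto simp: a_def)
      have b: "y \<le> norm b" "b \<noteq> 0"
        using norm_back_minus_driver_ge[OF t U v0 s, of "U s"] v by (auto simp: b_def)
      have "(norm (b - a))\<^sup>2 + 0\<^sup>2 \<le> exp (3 * (2 / y\<^sup>2) * (t - s)) * ((norm (v - w))\<^sup>2 + 0\<^sup>2)"
        using loewner_back_stability[OF t U U y(1), of v w 0 s] y v s by (simp add: a_def b_def)
      also have "\<dots> \<le> exp (3 * (2 / y\<^sup>2) * t) * ((norm (v - w))\<^sup>2 + 0\<^sup>2)"
        using s by (intro mult_right_mono) (auto intro!: divide_right_mono)
      also have "\<dots> = (C * norm (v - w))\<^sup>2"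
        by (simp add: C_def power_mult_distrib flip: exp_double)
      finally have "(norm (b - a))\<^sup>2 \<le> (C * norm (v - w))\<^sup>2" by simp
      then have ba: "norm (b - a) \<le> C * norm (v - w)"
        by (rule power2_le_imp_le) (auto simp: C_def)
      have "A v s - A w s = (2 / b - 2 / a) / a"
        unfolding A_def a_def[symmetric] b_def[symmetric] by (simp add: diff_divide_distrib mult.commute)
      also have "\<dots> = - 2 / (a * a * b) * (b - a)"
        unfolding diff_of_velocities[OF b(2) a(2)] by (simp add: mult_ac)
      finally have "A v s - A w s = - 2 / (a * a * b) * (b - a)" .
      then have "norm (A v s - A w s) = 2 / (norm a * norm a * norm b) * norm (b - a)"
        by (simp only: norm_mult norm_divide norm_minus_cancel norm_numeral)
      also have "\<dots> \<le> 2 / (y\<^sup>2 * y) * (C * norm (v - w))"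
        unfolding power2_eq_square using a b y ba
        by (intro mult_mono divide_left_mono mult_pos_pos) auto
      finally show ?thesis by (simp add: M_def)
    qed
    have "norm (integral {0..t} (A v) - integral {0..t} (A w)) = norm (integral {0..t} (\<lambda>s. A v s - A w s))"
      by (simp add: integral_diff Aint v0 w)
    also have "\<dots> \<le> M * norm (v - w) * (t - 0)"
      by (rule integral_bound[OF t])
        (use bd in \<open>auto simp: A_def intro!: continuous_on_diff loewner_back_integrand_continuous t U w v0\<close>)
    finally show ?thesis by (simp add: mult_ac)
  qed
  have "((\<lambda>v. integral {0..t} (A v) - integral {0..t} (A w)) \<longlongrightarrow> 0) (at w)"
  proof (rule Lim_null_comparison)
    show "\<forall>\<^sub>F v in at w. norm (integral {0..t} (A v) - integral {0..t} (A w)) \<le> M * t * norm (v - w)"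
      using near by eventually_elim (rule lip)
    show "((\<lambda>v. M * t * norm (v - w)) \<longlongrightarrow> 0) (at w)"
      by (auto intro!: tendsto_eq_intros)
  qed
  then have "((\<lambda>v. integral {0..t} (A v)) \<longlongrightarrow> integral {0..t} (A w)) (at w)"
    by (simp add: LIM_zero_iff)
  then have "((\<lambda>v. exp (integral {0..t} (A v))) \<longlongrightarrow> exp (integral {0..t} (A w))) (at w)"
    by (rule tendsto_exp)
  moreover have "\<forall>\<^sub>F v in at w. exp (integral {0..t} (A v)) = (loewner_f U t v - loewner_f U t w) / (v - w)"
    using near eventually_neq_at_within[of w]
  proof eventually_elim
    fix v assume v: "y < Im v" "v \<noteq> w"
    then have v0: "0 < Im v" using y by simp
    have "loewner_f U t w - loewner_f U t v = (w - v) * exp (integral {0..t} (A v))"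
      unfolding A_def by (rule loewner_f_diff[OF t U w v0])
    then have "loewner_f U t v - loewner_f U t w = (v - w) * exp (integral {0..t} (A v))"
      by (simp add: algebra_simps)
    then show "exp (integral {0..t} (A v)) = (loewner_f U t v - loewner_f U t w) / (v - w)"
      using v by simp
  qed
  ultimately have "((\<lambda>v. (loewner_f U t v - loewner_f U t w) / (v - w)) \<longlongrightarrow> exp (integral {0..t} (A w))) (at w)"
    by (rule Lim_transform_eventually)
  moreover have "A w = (\<lambda>s. 2 / (loewner_back U t w s - U s)\<^sup>2)"
    by (simp add: A_def[abs_def] power2_eq_square)
  ultimately show ?thesis by (simp add: has_field_derivative_iff)
qed

section \<open>Energy estimates along a flow line\<close>

text \<open>
  Here \<open>q\<close>, \<open>x\<close>, \<open>y\<close> stand for \<open>R\<^sup>2\<close>,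
  \<open>X\<close>, \<open>Y\<close>: the drift of \<open>ln (R / Y)\<close> is a perfect square
  up to the contribution of the driver.
\<close>

lemma aspect_identity:
  fixes q x y :: real
  assumes q: "0 < q" and "q = x\<^sup>2 + y\<^sup>2"
  shows "4 * x\<^sup>2 / q\<^sup>2 = 2 / q + 2 * (x\<^sup>2 - y\<^sup>2) / q\<^sup>2"
proof -
  have "2 / q = 2 * (x\<^sup>2 + y\<^sup>2) / q\<^sup>2"
    using q unfolding assms(2)[symmetric] by (simp add: power2_eq_square)
  then show ?thesis by (simp flip: add_divide_distrib)
qed

lemma derivative_identity:
  fixes q x y :: real
  assumes q: "0 < q" and "q = x\<^sup>2 + y\<^sup>2"
  shows "(- (2 * (x\<^sup>2 - y\<^sup>2) / q\<^sup>2) - - 2 / q) / 2 = 2 * y\<^sup>2 / q\<^sup>2"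
proof -
  have "2 / q = 2 * (x\<^sup>2 + y\<^sup>2) / q\<^sup>2"
    using q unfolding assms(2)[symmetric] by (simp add: power2_eq_square)
  moreover have "- (a / d) - - 2 / q = (b - a) / d" if "2 / q = b / d" for a b d
    using that by (simp add: diff_divide_distrib)
  ultimately have "- (2 * (x\<^sup>2 - y\<^sup>2) / q\<^sup>2) - - 2 / q = (2 * (x\<^sup>2 + y\<^sup>2) - 2 * (x\<^sup>2 - y\<^sup>2)) / q\<^sup>2"
    by blast
  then show ?thesis by simp
qed

text \<open>
  The derivative \<open>u\<close> is carried along as a function of its own, together with an
  exceptional null set, so that identities valid almost everywhere can be used pointwise.
\<close>

locale finite_energy_driver =
  fixes T :: real and U u :: "real \<Rightarrow> real" and N :: "real set"
  assumes T_nonneg: "0 \<le> T"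
    and driver_ac: "absolutely_continuous_path 0 T U"
    and null: "negligible N"
    and driver_deriv: "\<And>s. s \<in> {0<..<T} - N \<Longrightarrow> (U has_real_derivative u s) (at s)"
    and sq_int: "(\<lambda>s. (u s)\<^sup>2) integrable_on {0..T}"
begin

definition energy :: "real \<Rightarrow> real \<Rightarrow> real" where
  "energy s t = integral {s..t} (\<lambda>r. (u r)\<^sup>2)"

lemma sq_integrable: "(\<lambda>r. (u r)\<^sup>2) integrable_on {s..t}" if "0 \<le> s" "t \<le> T"
  by (rule integrable_on_subinterval[OF sq_int]) (use that in auto)

lemma energy_nonneg: "0 \<le> energy s t"
  unfolding energy_def
  by (cases "(\<lambda>r. (u r)\<^sup>2) integrable_on {s..t}") (auto simp: not_integrable_integral intro: integral_nonneg)

lemma energy_mono: "energy s t \<le> energy r v" if "0 \<le> r" "r \<le> s" "t \<le> v" "v \<le> T"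
  unfolding energy_def using that by (intro integral_subset_le sq_integrable) auto

lemma driver_continuous: "continuous_on {0..t} U" if "t \<le> T"
  using absolutely_continuous_imp_continuous_on[OF driver_ac] that by (auto intro: continuous_on_subset)

text \<open>
  Young's inequality in place of Cauchy--Schwarz: the bound is linear in the energy, and the free
  parameter is adapted to the length of the interval or to the size of the energy.
\<close>

lemma driver_increment:
  assumes st: "0 \<le> s" "s \<le> t" "t \<le> T" and k: "0 < k"
  shows "\<bar>U t - U s\<bar> \<le> k / 2 * energy s t + (t - s) / (2 * k)"
proof -
  have ac: "absolutely_continuous_path s t U"
    using absolutely_continuous_path_mono[OF driver_ac] st by simp
  have young: "\<bar>x\<bar> \<le> k / 2 * x\<^sup>2 + 1 / (2 * k)" for x :: real
  proof -
    have "0 \<le> (k * \<bar>x\<bar> - 1)\<^sup>2" by simp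
    then have "2 * k * \<bar>x\<bar> \<le> k\<^sup>2 * x\<^sup>2 + 1" by (simp add: power2_eq_square algebra_simps)
    then show ?thesis using k by (simp add: field_simps power2_eq_square)
  qed
  have young': "- (k / 2) * x\<^sup>2 + - (1 / (2 * k)) \<le> x" "- (k / 2) * x\<^sup>2 + - (1 / (2 * k)) \<le> - x" for x :: real
    using young[of x] by (auto simp: abs_le_iff)
  have int1: "(\<lambda>r. - (k / 2) * (u r)\<^sup>2) integrable_on {s..t}"
    using st by (intro integrable_on_mult_right sq_integrable)
  then have int: "(\<lambda>r. - (k / 2) * (u r)\<^sup>2 + - (1 / (2 * k))) integrable_on {s..t}"
    by (intro integrable_add integrable_const_ivl)
  have val: "integral {s..t} (\<lambda>r. - (k / 2) * (u r)\<^sup>2 + - (1 / (2 * k))) = - (k / 2) * energy s t + - ((t - s) / (2 * k))"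
    unfolding integral_add[OF int1 integrable_const_ivl] energy_def
    using st(2) by (simp only: integral_mult_right) simp
  have "integral {s..t} (\<lambda>r. - (k / 2) * (u r)\<^sup>2 + - (1 / (2 * k))) \<le> U t - U s"
    by (rule absolutely_continuous_increment_ge[OF st(2) ac null _ int young'(1)])
      (use st driver_deriv in auto)
  moreover have "integral {s..t} (\<lambda>r. - (k / 2) * (u r)\<^sup>2 + - (1 / (2 * k))) \<le> - U t - - U s"
  proof (rule absolutely_continuous_increment_ge[OF st(2) _ null _ int young'(2)])
    show "absolutely_continuous_path s t (\<lambda>r. - U r)"
      by (rule absolutely_continuous_path_dominated[OF ac ac, of _ 1]) (auto simp: abs_if)
    show "((\<lambda>r. - U r) has_real_derivative - u x) (at x)" if "x \<in> {s<..<t} - N" for x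
      using driver_deriv[of x] that st by (auto intro!: derivative_eq_intros)
  qed
  ultimately show ?thesis unfolding val by (simp add: abs_le_iff)
qed

text \<open>
  The position \<open>X + \<i> Y\<close> relative to the driver.
\<close>

definition Z :: "real \<Rightarrow> complex \<Rightarrow> real \<Rightarrow> complex" where
  "Z t w r = loewner_back U t w r - complex_of_real (U r)"

lemma Im_Z [simp]: "Im (Z t w r) = Im (loewner_back U t w r)"
  by (simp add: Z_def)

context
  fixes t :: real and w :: complex
  assumes t: "t \<in> {0..T}" and w: "0 < Im w"
begin

lemma time_nonneg: "0 \<le> t" and driver_continuous_upto: "continuous_on {0..t} U"
  using t driver_continuous by auto

lemma Im_Z_ge: "r \<in> {0..t} \<Longrightarrow> Im w \<le> Im (Z t w r)"
  using loewner_back_Im[OF time_nonneg driver_continuous_upto w] by simp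

lemma norm_Z_ge: "r \<in> {0..t} \<Longrightarrow> Im w \<le> norm (Z t w r)"
  unfolding Z_def by (rule norm_back_minus_driver_ge(1)[OF time_nonneg driver_continuous_upto w])

lemma Z_nz: "r \<in> {0..t} \<Longrightarrow> Z t w r \<noteq> 0"
  using norm_Z_ge w by fastforce

lemma Im_Z_le_norm: "r \<in> {0..t} \<Longrightarrow> Im (Z t w r) \<le> norm (Z t w r)"
  using abs_Im_le_cmod[of "Z t w r"] by linarith

lemma Z_end: "Z t w t = w - U t"
  by (simp add: Z_def loewner_back_end[OF time_nonneg driver_continuous_upto w])

lemma Z_continuous: "continuous_on {0..t} (Z t w)"
  unfolding Z_def by (intro continuous_intros loewner_back_continuous time_nonneg driver_continuous_upto w)

lemma back_derivative:
  "r \<in> {0..t} \<Longrightarrow> (loewner_back U t w has_vector_derivative 2 / Z t w r) (at r within {0..t})"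
  unfolding Z_def by (rule loewner_back_derivative[OF time_nonneg driver_continuous_upto w])

lemma back_increment:
  assumes "0 \<le> a" "a \<le> b" "b \<le> t"
  shows "norm (loewner_back U t w b - loewner_back U t w a) \<le> 2 / Im w * (b - a)"
proof -
  have "norm (loewner_back U t w b - loewner_back U t w a) \<le> 2 / Im w * norm (b - a)"
  proof (rule differentiable_bound[where S = "{0..t}"])
    show "(loewner_back U t w has_derivative (\<lambda>x. x *\<^sub>R (2 / Z t w r))) (at r within {0..t})"
      if "r \<in> {0..t}" for r
      using back_derivative[OF that] by (simp add: has_vector_derivative_def)
    show "onorm (\<lambda>x. x *\<^sub>R (2 / Z t w r)) \<le> 2 / Im w" if "r \<in> {0..t}" for r
    proof (rule onorm_le)
      fix x :: real
      have "norm (2 / Z t w r) \<le> 2 / Im w"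
        using norm_Z_ge[OF that] w by (simp add: norm_divide frac_le)
      then have "norm x * norm (2 / Z t w r) \<le> norm x * (2 / Im w)"
        by (rule mult_left_mono) simp
      then show "norm (x *\<^sub>R (2 / Z t w r)) \<le> 2 / Im w * norm x"
        by (simp only: norm_scaleR real_norm_def mult.commute)
    qed
  qed (use assms in auto)
  then show ?thesis using assms by simp
qed

lemma Im_Z_derivative:
  assumes "r \<in> {0..t}"
  shows "((\<lambda>r. Im (Z t w r)) has_real_derivative - 2 * Im (Z t w r) / (norm (Z t w r))\<^sup>2) (at r within {0..t})"
proof -
  have "((\<lambda>r. Im (loewner_back U t w r)) has_vector_derivative Im (2 / Z t w r)) (at r within {0..t})"
    by (rule bounded_linear.has_vector_derivative[OF bounded_linear_Im back_derivative[OF assms]])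
  then show ?thesis
    by (simp add: has_real_derivative_iff_has_vector_derivative Im_divide cmod_power2)
qed

lemma ln_Im_Z_derivative:
  assumes r: "r \<in> {0..t}"
  shows "((\<lambda>r. ln (Im (Z t w r))) has_real_derivative - 2 / (norm (Z t w r))\<^sup>2) (at r within {0..t})"
proof -
  have p: "0 < Im (Z t w r)" using Im_Z_ge[OF r] w by linarith
  have "((\<lambda>r. ln (Im (Z t w r))) has_real_derivative
      (1 / Im (Z t w r)) * (- 2 * Im (Z t w r) / (norm (Z t w r))\<^sup>2)) (at r within {0..t})"
    by (rule DERIV_chain2[where f = ln, OF _ Im_Z_derivative[OF r]]) (use DERIV_ln_divide[OF p] in simp)
  then show ?thesis using p by simp
qed

lemma ln_norm_Z_derivative:
  assumes r: "r \<in> {0<..<t} - N"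
  shows "((\<lambda>r. ln (norm (Z t w r))) has_real_derivative
     2 * ((Re (Z t w r))\<^sup>2 - (Im (Z t w r))\<^sup>2) / (norm (Z t w r))^4
       - Re (Z t w r) * u r / (norm (Z t w r))\<^sup>2) (at r)"
proof -
  have r': "r \<in> {0..t}" and at: "at r within {0..t} = at r"
    using r by (auto intro!: at_within_interior)
  have p: "0 < norm (Z t w r)" using Z_nz[OF r'] by simp
  have dU: "(U has_vector_derivative u r) (at r)"
    using driver_deriv[of r] r t by (simp add: has_real_derivative_iff_has_vector_derivative)
  have "(Z t w has_vector_derivative 2 / Z t w r - complex_of_real (u r)) (at r)"
    unfolding Z_def[of t w, abs_def]
    using back_derivative[OF r'] at
      bounded_linear.has_vector_derivative[OF bounded_linear_of_real dU]
    by (intro has_vector_derivative_diff) (auto simp: Z_def)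
  from has_real_derivative_norm_sq[OF this]
  have d: "((\<lambda>r. (norm (Z t w r))\<^sup>2) has_real_derivative
      2 * (Z t w r \<bullet> (2 / Z t w r - complex_of_real (u r)))) (at r)" .
  have eq: "ln (norm z) = ln ((norm z)\<^sup>2) / 2" for z :: complex
    by (cases "z = 0") (auto simp: ln_realpow)
  have "((\<lambda>r. ln ((norm (Z t w r))\<^sup>2) / 2) has_real_derivative
      (1 / (norm (Z t w r))\<^sup>2) * (2 * (Z t w r \<bullet> (2 / Z t w r - complex_of_real (u r)))) / 2) (at r)"
    by (intro DERIV_cdivide DERIV_chain2[where f = ln, OF _ d] DERIV_ln_divide) (use p in simp)
  moreover have "Z t w r \<bullet> (2 / Z t w r - complex_of_real (u r)) =
      2 * ((Re (Z t w r))\<^sup>2 - (Im (Z t w r))\<^sup>2) / (norm (Z t w r))\<^sup>2 - Re (Z t w r) * u r"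
    by (simp add: inner_complex_def Re_divide Im_divide cmod_power2 power2_eq_square[of "Re _"]
        power2_eq_square[of "Im _"] diff_divide_distrib algebra_simps del: Im_Z)
  moreover have "(1 / q) * (2 * (2 * a / q - b)) / 2 = 2 * a / (q * q) - b / q" for a b q :: real
    by (simp add: diff_divide_distrib)
  ultimately show ?thesis
    by (simp only: eq[symmetric]) (simp add: power4_eq_xxxx power2_eq_square mult.assoc)
qed

text \<open>
  The only rough quantity in the two basic estimates is \<open>ln R\<close>; whatever is added to
  it is differentiable with bounded derivative. Hence the sum is absolutely continuous, and a
  lower bound of its derivative for every slope \<open>\<nu>\<close> of the driver integrates to
  the energy.
\<close>

lemma energy_inequality:
  assumes s: "s \<in> {0..t}"
    and \<psi>: "\<And>r. r \<in> {0..t} \<Longrightarrow> (\<psi> has_real_derivative \<psi>' r) (at r within {0..t})"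
    and M: "\<And>r. r \<in> {0..t} \<Longrightarrow> \<bar>\<psi>' r\<bar> \<le> M"
    and ge: "\<And>r \<nu>. r \<in> {0..t} \<Longrightarrow> - \<kappa> * \<nu>\<^sup>2 \<le> \<psi>' r +
      (2 * ((Re (Z t w r))\<^sup>2 - (Im (Z t w r))\<^sup>2) / (norm (Z t w r))^4
       - Re (Z t w r) * \<nu> / (norm (Z t w r))\<^sup>2)"
  shows "\<psi> s + ln (norm (Z t w s)) \<le> \<psi> t + ln (norm (Z t w t)) + \<kappa> * energy s t"
proof -
  define y where "y = Im w"
  have y: "0 < y" using w by (simp add: y_def)
  \<comment> \<open>\<open>ln R\<close> is \<open>1/y\<close>-Lipschitz in \<open>Z\<close>, and the flow moves with speed at most \<open>2/y\<close>.\<close>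
  define L where "L = M + 1 / y * (1 + 2 / y)"
  define \<phi> where "\<phi> r = \<psi> r + ln (norm (Z t w r))" for r
  have ac: "absolutely_continuous_path s t \<phi>"
  proof (rule absolutely_continuous_path_dominated)
    show "absolutely_continuous_path s t U"
      using absolutely_continuous_path_mono[OF driver_ac] s t by simp
    show "absolutely_continuous_path s t (\<lambda>x. x)" by (rule absolutely_continuous_path_ident)
    fix a b assume ab: "s \<le> a" "a \<le> b" "b \<le> t"
    have a: "a \<in> {0..t}" and b: "b \<in> {0..t}" using ab s by auto
    have "0 \<le> M" using M[OF a] by linarith
    have 1: "\<bar>\<psi> b - \<psi> a\<bar> \<le> M * \<bar>b - a\<bar>"
      using field_differentiable_bound[of "{0..t}" \<psi> \<psi>' M b a] \<psi> M a b by simp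
    have lnd: "ln x - ln x' \<le> \<bar>x - x'\<bar> / y" if "y \<le> x" "y \<le> x'" for x x'
    proof -
      have "ln x - ln x' \<le> (x - x') / x'" using that y by (intro ln_diff_le) auto
      also have "\<dots> \<le> \<bar>x - x'\<bar> / x'" using that y by (intro divide_right_mono) auto
      also have "\<dots> \<le> \<bar>x - x'\<bar> / y" using that y by (intro divide_left_mono) auto
      finally show ?thesis .
    qed
    have "\<bar>ln (norm (Z t w b)) - ln (norm (Z t w a))\<bar> \<le> \<bar>norm (Z t w b) - norm (Z t w a)\<bar> / y"
      using lnd[of "norm (Z t w b)" "norm (Z t w a)"] lnd[of "norm (Z t w a)" "norm (Z t w b)"]
        norm_Z_ge[OF a] norm_Z_ge[OF b] by (simp add: y_def abs_le_iff abs_minus_commute)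
    also have "\<bar>norm (Z t w b) - norm (Z t w a)\<bar> \<le> norm (Z t w b - Z t w a)" by (rule norm_triangle_ineq3)
    also have "Z t w b - Z t w a = (loewner_back U t w b - loewner_back U t w a) - of_real (U b - U a)"
      by (simp add: Z_def)
    also have "norm \<dots> \<le> norm (loewner_back U t w b - loewner_back U t w a) + norm (complex_of_real (U b - U a))"
      by (rule norm_triangle_ineq4)
    also have "\<dots> \<le> 2 / y * (b - a) + \<bar>U b - U a\<bar>"
      using back_increment[of a b] a b ab unfolding norm_of_real y_def by (intro add_mono) auto
    finally have 2: "\<bar>ln (norm (Z t w b)) - ln (norm (Z t w a))\<bar> \<le> (2 / y * (b - a) + \<bar>U b - U a\<bar>) / y"
      using y by (simp add: divide_right_mono)
    have "\<bar>\<phi> b - \<phi> a\<bar> \<le> M * \<bar>b - a\<bar> + (2 / y * (b - a) + \<bar>U b - U a\<bar>) / y"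
      unfolding \<phi>_def using 1 2 by linarith
    also have "\<dots> \<le> L * (\<bar>U b - U a\<bar> + \<bar>b - a\<bar>)"
    proof -
      have "L * (\<bar>U b - U a\<bar> + \<bar>b - a\<bar>) - (M * \<bar>b - a\<bar> + (2 / y * (b - a) + \<bar>U b - U a\<bar>) / y)
         = M * \<bar>U b - U a\<bar> + (2 / (y * y)) * \<bar>U b - U a\<bar> + 1 / y * \<bar>b - a\<bar>"
        using y ab by (simp add: L_def field_simps)
      also have "\<dots> \<ge> 0" using y \<open>0 \<le> M\<close> by simp
      finally show ?thesis by linarith
    qed
    finally show "\<bar>\<phi> b - \<phi> a\<bar> \<le> L * (\<bar>U b - U a\<bar> + \<bar>b - a\<bar>)" .
  qed
  have "integral {s..t} (\<lambda>r. - \<kappa> * (u r)\<^sup>2) \<le> \<phi> t - \<phi> s"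
  proof (rule absolutely_continuous_increment_ge[OF _ ac null])
    show "s \<le> t" using s by simp
    show "(\<lambda>r. - \<kappa> * (u r)\<^sup>2) integrable_on {s..t}"
      using s t by (intro integrable_on_mult_right sq_integrable) auto
    fix r assume r: "r \<in> {s<..<t} - N"
    then have r': "r \<in> {0<..<t} - N" "r \<in> {0..t}" and at: "at r within {0..t} = at r"
      using s by (auto intro!: at_within_interior)
    show "(\<phi> has_real_derivative \<psi>' r + (2 * ((Re (Z t w r))\<^sup>2 - (Im (Z t w r))\<^sup>2) / (norm (Z t w r))^4
       - Re (Z t w r) * u r / (norm (Z t w r))\<^sup>2)) (at r)"
      unfolding \<phi>_def using \<psi>[OF r'(2)] at by (intro DERIV_add ln_norm_Z_derivative r'(1)) auto
    show "- \<kappa> * (u r)\<^sup>2 \<le> \<psi>' r + (2 * ((Re (Z t w r))\<^sup>2 - (Im (Z t w r))\<^sup>2) / (norm (Z t w r))^4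
       - Re (Z t w r) * u r / (norm (Z t w r))\<^sup>2)" by (rule ge[OF r'(2)])
  qed
  then show ?thesis by (simp add: \<phi>_def energy_def)
qed

lemma norm_Z_sq: "(norm (Z t w r))\<^sup>2 = (Re (Z t w r))\<^sup>2 + (Im (Z t w r))\<^sup>2"
  by (rule cmod_power2)

text \<open>
  With \<open>a = X / R\<^sup>2\<close>, the derivative of \<open>ln (R / Y)\<close> is \<open>4
  a\<^sup>2 - a \<nu> = (2 a - \<nu> / 4)\<^sup>2 - \<nu>\<^sup>2 / 16\<close>.
\<close>

lemma aspect_ratio_bound:
  assumes s: "s \<in> {0..t}"
  shows "norm (Z t w s) / Im (Z t w s) \<le> norm (w - U t) / Im w * exp (energy s t / 16)"
proof -
  have "- ln (Im (Z t w s)) + ln (norm (Z t w s)) \<le> - ln (Im (Z t w t)) + ln (norm (Z t w t)) + 1 / 16 * energy s t"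
  proof (rule energy_inequality[OF s, where \<psi>' = "\<lambda>r. 2 / (norm (Z t w r))\<^sup>2" and M = "2 / (Im w)\<^sup>2"])
    fix r assume r: "r \<in> {0..t}"
    show "((\<lambda>r. - ln (Im (Z t w r))) has_real_derivative 2 / (norm (Z t w r))\<^sup>2) (at r within {0..t})"
      using DERIV_minus[OF ln_Im_Z_derivative[OF r]] by simp
    show "\<bar>2 / (norm (Z t w r))\<^sup>2\<bar> \<le> 2 / (Im w)\<^sup>2"
      using norm_Z_ge[OF r] w by (auto intro!: divide_left_mono power_mono mult_pos_pos)
    fix \<nu>
    define q where "q = (norm (Z t w r))\<^sup>2"
    have q: "0 < q" using Z_nz[OF r] by (simp add: q_def)
    have q2: "(norm (Z t w r))^4 = q\<^sup>2" by (simp add: q_def)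
    have "0 \<le> (2 * Re (Z t w r) / q - \<nu> / 4)\<^sup>2" by simp
    also have "\<dots> = 4 * (Re (Z t w r))\<^sup>2 / q\<^sup>2 - Re (Z t w r) * \<nu> / q + \<nu>\<^sup>2 / 16"
      using q by (simp add: power2_eq_square field_simps)
    also have "4 * (Re (Z t w r))\<^sup>2 / q\<^sup>2 = 2 / q + 2 * ((Re (Z t w r))\<^sup>2 - (Im (Z t w r))\<^sup>2) / q\<^sup>2"
      by (rule aspect_identity[OF q]) (simp only: q_def norm_Z_sq)
    finally show "- (1 / 16) * \<nu>\<^sup>2 \<le> 2 / (norm (Z t w r))\<^sup>2 +
        (2 * ((Re (Z t w r))\<^sup>2 - (Im (Z t w r))\<^sup>2) / (norm (Z t w r))^4
         - Re (Z t w r) * \<nu> / (norm (Z t w r))\<^sup>2)"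
      unfolding q2 q_def[symmetric] by simp
  qed
  then have le: "ln (norm (Z t w s)) - ln (Im (Z t w s)) \<le> ln (norm (Z t w t)) - ln (Im (Z t w t)) + energy s t / 16"
    by simp
  have tt: "t \<in> {0..t}" using t by simp
  have pos: "0 < Im (Z t w r)" "0 < norm (Z t w r)" if "r \<in> {0..t}" for r
    using Im_Z_ge[OF that] Z_nz[OF that] w by auto
  have "norm (Z t w s) / Im (Z t w s) = exp (ln (norm (Z t w s)) - ln (Im (Z t w s)))"
    using pos[OF s] by (simp add: exp_diff del: Im_Z)
  also have "\<dots> \<le> exp (ln (norm (Z t w t)) - ln (Im (Z t w t)) + energy s t / 16)" using le by simp
  also have "\<dots> = norm (Z t w t) / Im (Z t w t) * exp (energy s t / 16)"
    using pos[OF tt] by (simp add: exp_diff exp_add del: Im_Z)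
  finally show ?thesis by (simp add: Z_end del: Im_Z)
qed

text \<open>
  By the previous lemma \<open>Y\<^sup>2 / R\<^sup>2\<close> stays bounded below, and \<open>- 4
  Y\<^sup>2 / R\<^sup>2\<close> is the derivative of \<open>Y\<^sup>2\<close>. The constant is
  rounded so that the same power of the energy exponential appears as in the derivative bound.
\<close>

lemma height_growth:
  assumes s: "s \<in> {0..t}" and A: "norm (w - U t) \<le> A * Im w"
  shows "(Im w)\<^sup>2 + (t - s) / (A\<^sup>2 * exp (energy s t / 4)) \<le> (Im (loewner_back U t w s))\<^sup>2"
proof -
  define K where "K = A\<^sup>2 * exp (energy s t / 4)"
  have tt: "t \<in> {0..t}" using t by simp
  have A1: "1 \<le> A"
  proof -
    have "Im w \<le> A * Im w" using A norm_Z_ge[OF tt] by (simp add: Z_end)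
    then show ?thesis using w by simp
  qed
  have K: "0 < K" using A1 by (simp add: K_def)
  have ratio: "(norm (Z t w r))\<^sup>2 \<le> K * (Im (Z t w r))\<^sup>2" if r: "r \<in> {s..t}" for r
  proof -
    have r': "r \<in> {0..t}" using r s by auto
    have p: "0 < Im (Z t w r)" using Im_Z_ge[OF r'] w by linarith
    have "norm (Z t w r) / Im (Z t w r) \<le> norm (w - U t) / Im w * exp (energy r t / 16)"
      by (rule aspect_ratio_bound[OF r'])
    also have "\<dots> \<le> A * exp (energy s t / 8)"
    proof (rule mult_mono)
      show "norm (w - U t) / Im w \<le> A" using A w by (simp add: field_simps)
      have "energy r t \<le> energy s t" using r s t by (intro energy_mono) auto
      then show "exp (energy r t / 16) \<le> exp (energy s t / 8)" using energy_nonneg[of s t] by simp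
    qed (use A1 in auto)
    finally have "norm (Z t w r) \<le> A * exp (energy s t / 8) * Im (Z t w r)"
      using p by (simp add: field_simps)
    then have "(norm (Z t w r))\<^sup>2 \<le> (A * exp (energy s t / 8) * Im (Z t w r))\<^sup>2"
      by (rule power_mono) simp
    also have "\<dots> = K * (Im (Z t w r))\<^sup>2"
      by (simp add: K_def power_mult_distrib flip: exp_double)
    finally show ?thesis .
  qed
  have "- (Im (Z t w s))\<^sup>2 - s / K \<le> - (Im (Z t w t))\<^sup>2 - t / K"
  proof (rule nondecreasing_within[of s t "\<lambda>r. - (Im (Z t w r))\<^sup>2 - r / K"])
    show "s \<le> t" using s by simp
    fix r assume r: "r \<in> {s..t}"
    then have r': "r \<in> {0..t}" using s by auto
    have "((\<lambda>r. Im (Z t w r)) has_real_derivative - 2 * Im (Z t w r) / (norm (Z t w r))\<^sup>2) (at r within {s..t})"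
      using s by (intro DERIV_subset[OF Im_Z_derivative[OF r']]) auto
    from DERIV_diff[OF DERIV_minus[OF DERIV_power[OF this, of 2]] DERIV_cdivide[OF DERIV_ident, of K]]
    show "((\<lambda>r. - (Im (Z t w r))\<^sup>2 - r / K) has_real_derivative
        4 * (Im (Z t w r))\<^sup>2 / (norm (Z t w r))\<^sup>2 - 1 / K) (at r within {s..t})"
      by (simp add: power2_eq_square mult_ac del: Im_Z)
    have "1 / K \<le> (Im (Z t w r))\<^sup>2 / (norm (Z t w r))\<^sup>2"
      using ratio[OF r] K Z_nz[OF r'] by (simp add: field_simps del: Im_Z)
    moreover have "0 \<le> (Im (Z t w r))\<^sup>2 / (norm (Z t w r))\<^sup>2" by simp
    moreover have "0 \<le> 4 * a / b - 1 / K" if "1 / K \<le> a / b" "0 \<le> a / b" for a b :: real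
      using that by linarith
    ultimately show "0 \<le> 4 * (Im (Z t w r))\<^sup>2 / (norm (Z t w r))\<^sup>2 - 1 / K" by blast
  qed
  then show ?thesis by (simp add: K_def Z_end diff_divide_distrib loewner_back_end[OF time_nonneg driver_continuous_upto w])
qed

text \<open>
  Half of \<open>- \<Lambda> + 2 ln R - ln Y\<close> is treated, in order to have \<open>ln
  R\<close> with coefficient one. With \<open>a = X / R\<^sup>2\<close> its derivative is \<open>2
  a\<^sup>2 - a \<nu> = 2 (a - \<nu> / 4)\<^sup>2 - \<nu>\<^sup>2 / 8\<close>. At the starting
  point \<open>R\<close> is estimated from below by \<open>Y\<close>, at the endpoint it is known.
\<close>

lemma deriv_bound:
  "norm (deriv (loewner_f U t) w) \<le> (norm (w - U t))\<^sup>2 / (Im w * Im (loewner_f U t w)) * exp (energy 0 t / 4)"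
proof -
  define A where "A r = 2 / (Z t w r)\<^sup>2" for r
  define \<Lambda> where "\<Lambda> r = integral {0..r} (\<lambda>r. Re (A r))" for r
  have s0: "0 \<in> {0..t}" and tt: "t \<in> {0..t}" using t by auto
  have Ac: "continuous_on {0..t} A"
    unfolding A_def by (intro continuous_intros Z_continuous) (use Z_nz in auto)
  \<comment> \<open>Expanding \<open>2 / Z\<^sup>2\<close> by the conjugate of \<open>Z\<^sup>2\<close>.\<close>
  have ReA: "Re (A r) = 2 * ((Re (Z t w r))\<^sup>2 - (Im (Z t w r))\<^sup>2) / (norm (Z t w r))^4" for r
  proof -
    have "A r = 2 * (cnj (Z t w r))\<^sup>2 / (Z t w r * cnj (Z t w r))\<^sup>2"
      by (cases "Z t w r = 0") (auto simp: A_def power_mult_distrib)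
    also have "Z t w r * cnj (Z t w r) = of_real ((norm (Z t w r))\<^sup>2)"
      by (simp only: complex_norm_square)
    also have "2 * (cnj (Z t w r))\<^sup>2 / (of_real ((norm (Z t w r))\<^sup>2))\<^sup>2 =
       2 * (cnj (Z t w r))\<^sup>2 / of_real ((norm (Z t w r))^4)"
      by (simp flip: of_real_power power_mult)
    finally show ?thesis
      by (simp only: Re_divide_of_real) (simp add: power2_eq_square)
  qed
  have "deriv (loewner_f U t) w = exp (integral {0..t} A)"
    unfolding A_def Z_def by (rule DERIV_imp_deriv[OF loewner_f_has_field_derivative[OF time_nonneg driver_continuous_upto w]])
  then have "norm (deriv (loewner_f U t) w) = exp (Re (integral {0..t} A))" by simp
  also have "Re (integral {0..t} A) = \<Lambda> t"
    using integral_linear[OF integrable_continuous_real[OF Ac] bounded_linear_Re]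
    by (simp add: \<Lambda>_def o_def)
  finally have deriv: "norm (deriv (loewner_f U t) w) = exp (\<Lambda> t)" .
  have "(- \<Lambda> 0 - ln (Im (Z t w 0))) / 2 + ln (norm (Z t w 0)) \<le>
     (- \<Lambda> t - ln (Im (Z t w t))) / 2 + ln (norm (Z t w t)) + 1 / 8 * energy 0 t"
  proof (rule energy_inequality[OF s0, where \<psi>' = "\<lambda>r. 2 * (Im (Z t w r))\<^sup>2 / (norm (Z t w r))^4"
        and M = "2 / (Im w)\<^sup>2"])
    fix r assume r: "r \<in> {0..t}"
    define q where "q = (norm (Z t w r))\<^sup>2"
    have q: "0 < q" using Z_nz[OF r] by (simp add: q_def)
    have q2: "(norm (Z t w r))^4 = q\<^sup>2" by (simp add: q_def)
    have qe: "q = (Re (Z t w r))\<^sup>2 + (Im (Z t w r))\<^sup>2" unfolding q_def by (rule norm_Z_sq)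
    have "(\<Lambda> has_real_derivative Re (A r)) (at r within {0..t})"
      unfolding \<Lambda>_def has_real_derivative_iff_has_vector_derivative
      by (rule integral_has_vector_derivative[OF _ r]) (intro continuous_intros Ac)
    from DERIV_cdivide[OF DERIV_diff[OF DERIV_minus[OF this] ln_Im_Z_derivative[OF r]], of 2]
    have "((\<lambda>r. (- \<Lambda> r - ln (Im (Z t w r))) / 2) has_real_derivative
        (- Re (A r) - - 2 / q) / 2) (at r within {0..t})" by (simp only: q_def)
    moreover have "(- Re (A r) - - 2 / q) / 2 = 2 * (Im (Z t w r))\<^sup>2 / q\<^sup>2"
      unfolding ReA q2 by (rule derivative_identity[OF q qe])
    ultimately show "((\<lambda>r. (- \<Lambda> r - ln (Im (Z t w r))) / 2) has_real_derivative
        2 * (Im (Z t w r))\<^sup>2 / (norm (Z t w r))^4) (at r within {0..t})" unfolding q2 by (simp only:)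
    have "2 * (Im (Z t w r))\<^sup>2 / q\<^sup>2 \<le> 2 * q / q\<^sup>2"
      using qe by (intro divide_right_mono) auto
    also have "\<dots> = 2 / q" using q by (simp add: power2_eq_square)
    also have "\<dots> \<le> 2 / (Im w)\<^sup>2"
      unfolding q_def using norm_Z_ge[OF r] w Z_nz[OF r]
      by (intro divide_left_mono power_mono) auto
    finally show "\<bar>2 * (Im (Z t w r))\<^sup>2 / (norm (Z t w r))^4\<bar> \<le> 2 / (Im w)\<^sup>2" unfolding q2 by simp
    fix \<nu>
    have "0 \<le> 2 * (Re (Z t w r) / q - \<nu> / 4)\<^sup>2" by simp
    also have "\<dots> = 2 * (Re (Z t w r))\<^sup>2 / q\<^sup>2 - Re (Z t w r) * \<nu> / q + \<nu>\<^sup>2 / 8"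
      using q by (simp add: power2_eq_square field_simps)
    also have "2 * (Re (Z t w r))\<^sup>2 / q\<^sup>2 =
        2 * (Im (Z t w r))\<^sup>2 / q\<^sup>2 + 2 * ((Re (Z t w r))\<^sup>2 - (Im (Z t w r))\<^sup>2) / q\<^sup>2"
      by (simp add: algebra_simps flip: add_divide_distrib del: Im_Z)
    finally show "- (1 / 8) * \<nu>\<^sup>2 \<le> 2 * (Im (Z t w r))\<^sup>2 / (norm (Z t w r))^4 +
        (2 * ((Re (Z t w r))\<^sup>2 - (Im (Z t w r))\<^sup>2) / (norm (Z t w r))^4
         - Re (Z t w r) * \<nu> / (norm (Z t w r))\<^sup>2)"
      unfolding q2 q_def[symmetric] by simp
  qed
  then have le: "\<Lambda> t \<le> 2 * ln (norm (Z t w t)) - ln (Im (Z t w t)) + ln (Im (Z t w 0)) - 2 * ln (norm (Z t w 0))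
      + energy 0 t / 4"
    by (simp add: \<Lambda>_def field_simps del: Im_Z)
  have pos: "0 < Im (Z t w r)" "0 < norm (Z t w r)" if "r \<in> {0..t}" for r
    using Im_Z_ge[OF that] Z_nz[OF that] w by auto
  have "ln (Im (Z t w 0)) - 2 * ln (norm (Z t w 0)) \<le> - ln (Im (Z t w 0))"
    using Im_Z_le_norm[OF s0] pos[OF s0] by (simp add: ln_le_cancel_iff del: Im_Z)
  with le have "\<Lambda> t \<le> 2 * ln (norm (Z t w t)) - (ln (Im (Z t w t)) + ln (Im (Z t w 0))) + energy 0 t / 4"
    by linarith
  then have "exp (\<Lambda> t) \<le> exp (2 * ln (norm (Z t w t)) - (ln (Im (Z t w t)) + ln (Im (Z t w 0))) + energy 0 t / 4)"
    by simp
  also have "\<dots> = (norm (Z t w t))\<^sup>2 / (Im (Z t w t) * Im (Z t w 0)) * exp (energy 0 t / 4)"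
    using pos[OF s0] pos[OF tt] by (simp add: exp_add exp_diff exp_double del: Im_Z)
  finally show ?thesis
    unfolding deriv by (simp add: Z_end loewner_f_eq[OF time_nonneg driver_continuous_upto w] loewner_back_end[OF time_nonneg driver_continuous_upto w])
qed

lemma loewner_f_differentiable: "(loewner_f U t has_field_derivative deriv (loewner_f U t) w) (at w)"
  using loewner_f_has_field_derivative[OF time_nonneg driver_continuous_upto w] DERIV_imp_deriv by metis

lemma Im_loewner_f_ge:
  assumes A: "norm (w - U t) \<le> A * Im w"
  shows "sqrt ((Im w)\<^sup>2 + t / (A\<^sup>2 * exp (energy 0 T / 4))) \<le> Im (loewner_f U t w)"
    and "Im w \<le> Im (loewner_f U t w)"
proof -
  have s0: "0 \<in> {0..t}" using t by simp
  show ge: "Im w \<le> Im (loewner_f U t w)"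
    using loewner_back_Im[OF time_nonneg driver_continuous_upto w s0] by (simp add: loewner_f_eq[OF time_nonneg driver_continuous_upto w])
  have "t / (A\<^sup>2 * exp (energy 0 T / 4)) \<le> t / (A\<^sup>2 * exp (energy 0 t / 4))"
  proof (cases "A = 0")
    case False
    have "energy 0 t \<le> energy 0 T" using t by (intro energy_mono) auto
    then show ?thesis using t False by (intro divide_left_mono) auto
  qed simp
  then have "(Im w)\<^sup>2 + t / (A\<^sup>2 * exp (energy 0 T / 4)) \<le> (Im (loewner_f U t w))\<^sup>2"
    using height_growth[OF s0 A] by (simp add: loewner_f_eq[OF time_nonneg driver_continuous_upto w])
  then show "sqrt ((Im w)\<^sup>2 + t / (A\<^sup>2 * exp (energy 0 T / 4))) \<le> Im (loewner_f U t w)"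
    using ge w by (intro real_le_lsqrt) auto
qed

end

end

section \<open>The trace of a finite-energy driver\<close>

lemma Im_above_tip [simp]: "Im (above_tip U t y) = y"
  by (simp add: above_tip_def)

lemma above_tip_minus_driver [simp]: "above_tip U t y - complex_of_real (U t) = \<i> * complex_of_real y"
  by (simp add: above_tip_def)

lemma sqrt_increment_le:
  assumes "0 < a" "a \<le> y\<^sup>2 + c" "0 \<le> c" "0 \<le> y"
  shows "sqrt (y\<^sup>2 + c) - sqrt c \<le> y\<^sup>2 / sqrt a"
proof -
  define p where "p = sqrt (y\<^sup>2 + c)"
  define q where "q = sqrt c"
  have p: "sqrt a \<le> p" "0 < p" "0 \<le> q"
    using assms by (auto simp: p_def q_def intro!: add_nonneg_pos)
  have "(p - q) * (p + q) = y\<^sup>2"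
    using assms by (simp add: p_def q_def algebra_simps)
  then have "p - q = y\<^sup>2 / (p + q)" using p by (simp add: field_simps)
  also have "\<dots> \<le> y\<^sup>2 / sqrt a" using p assms by (intro divide_left_mono mult_pos_pos) auto
  finally show ?thesis by (simp add: p_def q_def)
qed

lemma sqrt_increment_le_linear:
  assumes "0 \<le> c" "0 \<le> y"
  shows "sqrt (y\<^sup>2 + c) - sqrt c \<le> y"
proof -
  have "sqrt (y\<^sup>2 + c) \<le> sqrt (y\<^sup>2) + sqrt c"
    using assms by (intro sqrt_add_le_add_sqrt) auto
  then show ?thesis using assms by simp
qed

lemma norm_diff_via_approximants:
  fixes x y x' y' :: "'a::real_normed_vector"
  shows "norm (x - y) \<le> norm (x' - y') + norm (y' - y) + norm (x' - x)"
  using norm_triangle_ineq4[of "(x' - y') + (y' - y)" "x' - x"] norm_triangle_ineq[of "x' - y'" "y' - y"]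
  by simp

context finite_energy_driver
begin

text \<open>
  The distortion factor of the derivative bound, for the energy on the complete time interval.
\<close>

definition E :: real where "E = exp (energy 0 T / 4)"

lemma E_ge_1: "1 \<le> E" and E_pos: "0 < E"
  using energy_nonneg[of 0 T] by (auto simp: E_def)

lemma deriv_above_tip_bound:
  assumes t: "t \<in> {0..T}" and y: "0 < y"
  shows "norm (deriv (loewner_f U t) (above_tip U t y)) \<le> exp (energy 0 t / 4)"
proof -
  have w: "0 < Im (above_tip U t y)" using y by simp
  have ge: "y \<le> Im (loewner_f U t (above_tip U t y))"
    using Im_loewner_f_ge(2)[OF t w, of 1] y by (simp add: norm_mult)
  have "norm (deriv (loewner_f U t) (above_tip U t y))
      \<le> y\<^sup>2 / (y * Im (loewner_f U t (above_tip U t y))) * exp (energy 0 t / 4)"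
    using deriv_bound[OF t w] y by (simp add: norm_mult)
  also have "\<dots> \<le> 1 * exp (energy 0 t / 4)"
    using ge y by (intro mult_right_mono) (auto simp: power2_eq_square field_simps)
  finally show ?thesis by simp
qed

text \<open>
  In a cone with apex at the tip the height of \<open>f\<^sub>t w\<close> may be replaced by its
  lower bound from the growth of the height, which leaves only explicit quantities.
\<close>

lemma deriv_cone_bound:
  assumes t: "t \<in> {0..T}" and w: "0 < Im w" and A: "norm (w - U t) \<le> A * Im w"
  shows "norm (deriv (loewner_f U t) w) \<le>
    (norm (w - U t))\<^sup>2 / (Im w * sqrt ((Im w)\<^sup>2 + t / (A\<^sup>2 * E))) * E"
proof -
  have t0: "0 \<le> t" using t by simp
  have pos: "0 < sqrt ((Im w)\<^sup>2 + t / (A\<^sup>2 * E))"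
    using w t0 E_pos by (auto intro!: add_pos_nonneg)
  have "norm (deriv (loewner_f U t) w) \<le>
      (norm (w - U t))\<^sup>2 / (Im w * Im (loewner_f U t w)) * exp (energy 0 t / 4)"
    by (rule deriv_bound[OF t w])
  also have "\<dots> \<le> (norm (w - U t))\<^sup>2 / (Im w * sqrt ((Im w)\<^sup>2 + t / (A\<^sup>2 * E))) * E"
  proof (rule mult_mono)
    have le: "sqrt ((Im w)\<^sup>2 + t / (A\<^sup>2 * E)) \<le> Im (loewner_f U t w)"
      unfolding E_def by (rule Im_loewner_f_ge(1)[OF t w A])
    have "Im w * sqrt ((Im w)\<^sup>2 + t / (A\<^sup>2 * E)) \<le> Im w * Im (loewner_f U t w)"
      by (rule mult_left_mono[OF le]) (use w in simp)
    moreover have "0 < Im w * sqrt ((Im w)\<^sup>2 + t / (A\<^sup>2 * E))"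
      using w pos by (rule mult_pos_pos)
    ultimately show "(norm (w - U t))\<^sup>2 / (Im w * Im (loewner_f U t w))
        \<le> (norm (w - U t))\<^sup>2 / (Im w * sqrt ((Im w)\<^sup>2 + t / (A\<^sup>2 * E)))"
      by (intro frac_le) auto
    show "exp (energy 0 t / 4) \<le> E"
      unfolding E_def using energy_mono[of 0 0 t T] t by simp
  qed (use w pos in auto)
  finally show ?thesis .
qed

text \<open>
  A primitive in \<open>y\<close> of the cone bound on the vertical line, where the aperture is
  \<open>1\<close>.
\<close>

definition tip_modulus :: "real \<Rightarrow> real \<Rightarrow> real" where
  "tip_modulus t y = E * sqrt (y\<^sup>2 + t / E)"

lemma vertical_increment:
  assumes t: "t \<in> {0..T}" and vy: "0 < v" "v \<le> y"
  shows "norm (loewner_f U t (above_tip U t y) - loewner_f U t (above_tip U t v)) \<le> tip_modulus t y - tip_modulus t v"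
proof (cases "v = y")
  case False
  then have "v < y" using vy by simp
  have t0: "0 \<le> t / E" using t E_pos by simp
  have der: "((\<lambda>x. loewner_f U t (above_tip U t x)) has_vector_derivative
      \<i> * deriv (loewner_f U t) (above_tip U t x)) (at x)" if "0 < x" for x
  proof -
    have "(above_tip U t has_vector_derivative \<i>) (at x)"
      unfolding above_tip_def[abs_def]
      by (auto intro!: derivative_eq_intros)
    moreover have "(loewner_f U t has_field_derivative deriv (loewner_f U t) (above_tip U t x)) (at (above_tip U t x))"
      using that by (intro loewner_f_differentiable t) simp
    ultimately show ?thesis
      using field_vector_diff_chain_at[of "above_tip U t" \<i> x "loewner_f U t"] by (simp add: o_def)
  qed
  have hder: "((\<lambda>x. tip_modulus t x) has_real_derivative x / sqrt (x\<^sup>2 + t / E) * E) (at x)" if "0 < x" for x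
  proof -
    have p: "0 < x\<^sup>2 + t / E" using that t0 by (intro add_pos_nonneg) auto
    have "((\<lambda>x. x\<^sup>2 + t / E) has_real_derivative 2 * x) (at x)"
      by (auto intro!: derivative_eq_intros)
    from DERIV_chain2[OF DERIV_real_sqrt[OF p] this]
    have "((\<lambda>x. sqrt (x\<^sup>2 + t / E)) has_real_derivative inverse (sqrt (x\<^sup>2 + t / E)) / 2 * (2 * x)) (at x)" .
    note d = DERIV_cmult[OF this, of E]
    have eq: "E * (inverse (sqrt (x\<^sup>2 + t / E)) / 2 * (2 * x)) = x / sqrt (x\<^sup>2 + t / E) * E"
      using p by (simp only: divide_inverse) (simp add: mult.commute)
    show ?thesis unfolding tip_modulus_def by (rule DERIV_cong[OF d eq])
  qed
  show ?thesis
  proof (rule differentiable_bound_general[OF \<open>v < y\<close>])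
    show "continuous_on {v..y} (\<lambda>x. loewner_f U t (above_tip U t x))"
    proof (rule continuous_on_vector_derivative)
      fix x assume "x \<in> {v..y}"
      then have "0 < x" using vy by simp
      then show "((\<lambda>x. loewner_f U t (above_tip U t x)) has_vector_derivative
          \<i> * deriv (loewner_f U t) (above_tip U t x)) (at x within {v..y})"
        by (rule has_vector_derivative_at_within[OF der])
    qed
    show "continuous_on {v..y} (tip_modulus t)"
      unfolding tip_modulus_def[abs_def] by (intro continuous_intros)
    fix x assume x: "v < x" "x < y"
    then have x0: "0 < x" using vy by simp
    show "((\<lambda>x. loewner_f U t (above_tip U t x)) has_vector_derivative
      \<i> * deriv (loewner_f U t) (above_tip U t x)) (at x)" by (rule der[OF x0])
    show "(tip_modulus t has_vector_derivative x / sqrt (x\<^sup>2 + t / E) * E) (at x)"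
      using hder[OF x0] by (simp add: has_real_derivative_iff_has_vector_derivative)
    have "norm (deriv (loewner_f U t) (above_tip U t x)) \<le> x\<^sup>2 / (x * sqrt (x\<^sup>2 + t / E)) * E"
      using deriv_cone_bound[OF t, of "above_tip U t x" 1] x0 by (simp add: norm_mult)
    then show "norm (\<i> * deriv (loewner_f U t) (above_tip U t x)) \<le> x / sqrt (x\<^sup>2 + t / E) * E"
      using x0 by (simp add: norm_mult power2_eq_square)
  qed
qed simp

lemma tip_modulus_tendsto: "(tip_modulus t \<longlongrightarrow> tip_modulus t 0) (at_right 0)"
  unfolding tip_modulus_def[abs_def] by (intro tendsto_intros)

text \<open>
  Increments along the vertical line are dominated by those of \<open>tip_modulus\<close>, which
  is continuous at \<open>0\<close>: this gives both convergence and its rate.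
\<close>

lemma tip_limit_exists:
  assumes t: "t \<in> {0..T}"
  shows "\<exists>l. ((\<lambda>y. loewner_f U t (above_tip U t y)) \<longlongrightarrow> l) (at_right 0) \<and>
    (\<forall>y>0. norm (loewner_f U t (above_tip U t y) - l) \<le> tip_modulus t y - tip_modulus t 0)"
proof -
  define f where "f y = loewner_f U t (above_tip U t y)" for y
  define x where "x n = inverse (real (Suc n))" for n
  have x: "0 < x n" for n by (simp add: x_def)
  have xlim: "x \<longlonglongrightarrow> 0" unfolding x_def[abs_def] by (rule LIMSEQ_inverse_real_of_nat)
  have le: "norm (f a - f b) \<le> \<bar>tip_modulus t a - tip_modulus t b\<bar>" if "0 < a" "0 < b" for a b
    using vertical_increment[OF t that(1), of b] vertical_increment[OF t that(2), of a]
    by (cases "a \<le> b") (auto simp: f_def norm_minus_commute)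
  have hlim: "(\<lambda>n. tip_modulus t (x n)) \<longlonglongrightarrow> tip_modulus t 0"
    unfolding tip_modulus_def by (intro tendsto_intros xlim)
  have "Cauchy (\<lambda>n. f (x n))"
  proof (rule CauchyI)
    fix e :: real assume "0 < e"
    then obtain M where "\<And>m n. m \<ge> M \<Longrightarrow> n \<ge> M \<Longrightarrow> norm (tip_modulus t (x m) - tip_modulus t (x n)) < e"
      using CauchyD[OF LIMSEQ_imp_Cauchy[OF hlim]] by blast
    then show "\<exists>M. \<forall>m\<ge>M. \<forall>n\<ge>M. norm (f (x m) - f (x n)) < e"
      by (intro exI[of _ M] allI impI le_less_trans[OF le[OF x x]]) (simp only: real_norm_def)
  qed
  then obtain l where l: "(\<lambda>n. f (x n)) \<longlonglongrightarrow> l"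
    using Cauchy_convergent_iff convergent_def by blast
  have bd: "norm (f y - l) \<le> tip_modulus t y - tip_modulus t 0" if y: "0 < y" for y
  proof (rule tendsto_le[OF sequentially_bot])
    show "(\<lambda>n. norm (f y - f (x n))) \<longlonglongrightarrow> norm (f y - l)" by (intro tendsto_intros l)
    show "(\<lambda>n. tip_modulus t y - tip_modulus t (x n)) \<longlonglongrightarrow> tip_modulus t y - tip_modulus t 0" by (intro tendsto_intros hlim)
    have "\<forall>\<^sub>F n in sequentially. x n < y" by (rule order_tendstoD(2)[OF xlim y])
    then show "\<forall>\<^sub>F n in sequentially. norm (f y - f (x n)) \<le> tip_modulus t y - tip_modulus t (x n)"
      unfolding f_def by eventually_elim (rule vertical_increment[OF t x less_imp_le])
  qed
  have "((\<lambda>y. f y - l) \<longlongrightarrow> 0) (at_right 0)"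
  proof (rule Lim_null_comparison)
    show "\<forall>\<^sub>F y in at_right 0. norm (f y - l) \<le> tip_modulus t y - tip_modulus t 0"
      using bd by (auto simp: eventually_at_right_field intro: exI[of _ 1])
    show "((\<lambda>y. tip_modulus t y - tip_modulus t 0) \<longlongrightarrow> 0) (at_right 0)"
      using tendsto_diff[OF tip_modulus_tendsto tendsto_const, of t "tip_modulus t 0"] by simp
  qed
  then have "(f \<longlongrightarrow> l) (at_right 0)" by (simp add: LIM_zero_iff)
  with bd show ?thesis unfolding f_def by blast
qed

lemma trace_limit:
  assumes t: "t \<in> {0..T}"
  shows "((\<lambda>y. loewner_f U t (above_tip U t y)) \<longlongrightarrow> loewner_trace U t) (at_right 0)"
    and "0 < y \<Longrightarrow> norm (loewner_f U t (above_tip U t y) - loewner_trace U t) \<le> tip_modulus t y - tip_modulus t 0"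
proof -
  obtain l where l: "((\<lambda>y. loewner_f U t (above_tip U t y)) \<longlongrightarrow> l) (at_right 0)"
    "\<And>y. 0 < y \<Longrightarrow> norm (loewner_f U t (above_tip U t y) - l) \<le> tip_modulus t y - tip_modulus t 0"
    using tip_limit_exists[OF t] by blast
  have "loewner_trace U t = l"
    unfolding loewner_trace_def using l(1) by (intro tendsto_Lim) auto
  with l show "((\<lambda>y. loewner_f U t (above_tip U t y)) \<longlongrightarrow> loewner_trace U t) (at_right 0)"
    "0 < y \<Longrightarrow> norm (loewner_f U t (above_tip U t y) - loewner_trace U t) \<le> tip_modulus t y - tip_modulus t 0" by auto
qed

lemma trace_Im_nonneg:
  assumes t: "t \<in> {0..T}"
  shows "0 \<le> Im (loewner_trace U t)"
proof (rule tendsto_lowerbound)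
  show "((\<lambda>y. Im (loewner_f U t (above_tip U t y))) \<longlongrightarrow> Im (loewner_trace U t)) (at_right 0)"
    by (intro tendsto_intros trace_limit(1)[OF t])
  have "0 \<le> Im (loewner_f U t (above_tip U t y))" if "0 < y" for y
    using Im_loewner_f_ge(2)[OF t, of "above_tip U t y" 1] that by (simp add: norm_mult)
  then show "\<forall>\<^sub>F y in at_right 0. 0 \<le> Im (loewner_f U t (above_tip U t y))"
    by (auto simp: eventually_at_right_field intro: exI[of _ 1])
qed simp

text \<open>
  At height \<open>y = \<surd>(t - s)\<close> the flow from \<open>s\<close> to \<open>t\<close>
  moves points by at most \<open>2 y\<close>, and the driver moves by a multiple of
  \<open>y\<close> as well. Writing \<open>f\<^sub>t = f\<^sub>s \<circ> (flow)\<close>, both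
  points are images under \<open>f\<^sub>s\<close>, and the segment between their preimages
  \<open>p\<close> and \<open>q\<close> lies above height \<open>y\<close> in a cone of aperture
  \<open>A\<close>.
\<close>

lemma horizontal_increment:
  assumes st: "0 \<le> s" "s < t" "t \<le> T" and y: "y = sqrt (t - s)"
  shows "norm (loewner_f U t (above_tip U t y) - loewner_f U s (above_tip U s y))
    \<le> (4 + energy 0 T)^4 * (E * sqrt E) * ((t - s) / sqrt t)"
proof -
  define S where "S = energy 0 T"
  define A where "A = 4 + S"
  define p where "p = loewner_back U t (above_tip U t y) s"
  define q where "q = above_tip U s y"
  have S0: "0 \<le> S" by (simp add: S_def energy_nonneg)
  have A: "1 \<le> A" "0 \<le> A" using S0 by (auto simp: A_def)
  have t: "t \<in> {0..T}" and s: "s \<in> {0..T}" and s': "s \<in> {0..t}" using st by auto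
  have y0: "0 < y" and y2: "y\<^sup>2 = t - s" using st by (auto simp: y)
  have tp: "0 < t" using st by simp
  have w: "0 < Im (above_tip U t y)" using y0 by simp
  have c: "continuous_on {0..t} U" by (rule driver_continuous) (use st in simp)
  have fp: "loewner_f U t (above_tip U t y) = loewner_f U s p"
    unfolding p_def using loewner_f_compose[OF _ c w s'] st by simp
  have Imp: "y \<le> Im p" unfolding p_def using loewner_back_Im[OF _ c w s'] st by simp
  have "norm (p - above_tip U t y) \<le> 2 / y * (t - s)"
    unfolding p_def using back_increment[OF t w, of s t] loewner_back_end[OF _ c w] st
    by (simp add: norm_minus_commute)
  also have "\<dots> = 2 * y" using y0 by (simp add: y2[symmetric] power2_eq_square)
  finally have 1: "norm (p - above_tip U t y) \<le> 2 * y" .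
  have "\<bar>U t - U s\<bar> \<le> y / 2 * energy s t + (t - s) / (2 * y)"
    using st y0 by (intro driver_increment) auto
  also have "\<dots> \<le> y / 2 * S + y / 2"
    using energy_mono[of 0 s t T] st y0
    by (intro add_mono mult_left_mono) (auto simp: S_def y2[symmetric] power2_eq_square)
  finally have 2: "\<bar>U t - U s\<bar> \<le> y / 2 * S + y / 2" .
  have "p - q = (p - above_tip U t y) + of_real (U t - U s)"
    by (simp add: q_def above_tip_def)
  then have "norm (p - q) \<le> norm (p - above_tip U t y) + \<bar>U t - U s\<bar>"
    by (metis norm_of_real norm_triangle_ineq)
  also have "\<dots> \<le> 2 * y + (y / 2 * S + y / 2)" using 1 2 by linarith
  also have "\<dots> \<le> (3 + S) * y" using y0 mult_nonneg_nonneg[OF S0 less_imp_le[OF y0]] by (simp add: algebra_simps)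
  finally have pq: "norm (p - q) \<le> (3 + S) * y" .
  have seg: "norm (deriv (loewner_f U s) v) \<le> A^3 * (E * sqrt E) * y / sqrt t" and Imv: "0 < Im v"
    if v: "v \<in> closed_segment p q" for v
  proof -
    have "closed_segment p q \<subseteq> {z. Im z \<ge> y}"
      by (rule closed_segment_subset[OF _ _ convex_halfspace_Im_ge]) (use Imp in \<open>auto simp: q_def\<close>)
    with v have Iv: "y \<le> Im v" by auto
    then show v0: "0 < Im v" using y0 by simp
    have "norm (v - q) \<le> norm (p - q)"
      using segment_bound(2)[OF v] by (simp add: norm_minus_commute)
    moreover have "norm (v - U s) \<le> norm (v - q) + y"
    proof -
      have eq: "v - U s = (v - q) + \<i> * of_real y" by (simp add: q_def above_tip_def)
      show ?thesis
        unfolding eq by (rule order_trans[OF norm_triangle_ineq]) (use y0 in \<open>simp add: norm_mult\<close>)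
    qed
    ultimately have vU: "norm (v - U s) \<le> A * y" using pq by (simp add: A_def algebra_simps)
    also have "\<dots> \<le> A * Im v" using Iv A by (intro mult_left_mono) auto
    finally have cone: "norm (v - U s) \<le> A * Im v" .
    have AE: "1 \<le> A\<^sup>2 * E"
      using mult_mono[OF one_le_power[OF A(1), of 2] E_ge_1] A by simp
    have "t / (A\<^sup>2 * E) = (t - s) / (A\<^sup>2 * E) + s / (A\<^sup>2 * E)" by (simp add: diff_divide_distrib)
    also have "(t - s) / (A\<^sup>2 * E) \<le> (t - s) / 1"
      using AE st by (intro divide_left_mono) auto
    also have "(t - s) / 1 \<le> (Im v)\<^sup>2" unfolding y2[symmetric] using Iv y0 by (simp add: power_mono)
    finally have le: "t / (A\<^sup>2 * E) \<le> (Im v)\<^sup>2 + s / (A\<^sup>2 * E)" by simp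
    have "sqrt t / (A * sqrt E) = sqrt (t / (A\<^sup>2 * E))"
      using A by (simp add: real_sqrt_divide real_sqrt_mult)
    also have "\<dots> \<le> sqrt ((Im v)\<^sup>2 + s / (A\<^sup>2 * E))" using le by simp
    finally have low: "sqrt t / (A * sqrt E) \<le> sqrt ((Im v)\<^sup>2 + s / (A\<^sup>2 * E))" .
    have pos: "0 < sqrt t / (A * sqrt E)" using tp A E_pos by simp
    have "norm (deriv (loewner_f U s) v) \<le>
        (norm (v - U s))\<^sup>2 / (Im v * sqrt ((Im v)\<^sup>2 + s / (A\<^sup>2 * E))) * E"
      by (rule deriv_cone_bound[OF s v0 cone])
    also have "\<dots> \<le> (A * y)\<^sup>2 / (y * (sqrt t / (A * sqrt E))) * E"
    proof (intro mult_right_mono frac_le)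
      show "(norm (v - U s))\<^sup>2 \<le> (A * y)\<^sup>2" by (rule power_mono[OF vU]) simp
      show "0 < y * (sqrt t / (A * sqrt E))" using y0 pos by (rule mult_pos_pos)
      show "y * (sqrt t / (A * sqrt E)) \<le> Im v * sqrt ((Im v)\<^sup>2 + s / (A\<^sup>2 * E))"
        using Iv low y0 pos by (intro mult_mono) auto
    qed (use E_pos in auto)
    also have "\<dots> = A^3 * (E * sqrt E) * y / sqrt t"
      using y0 tp by (simp add: power2_eq_square power3_eq_cube)
    finally show "norm (deriv (loewner_f U s) v) \<le> A^3 * (E * sqrt E) * y / sqrt t" .
  qed
  have "norm (loewner_f U s p - loewner_f U s q) \<le> (A^3 * (E * sqrt E) * y / sqrt t) * norm (p - q)"
  proof (rule field_differentiable_bound[OF convex_closed_segment[of p q]])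
    show "(loewner_f U s has_field_derivative deriv (loewner_f U s) v) (at v within closed_segment p q)"
      if "v \<in> closed_segment p q" for v
      by (rule has_field_derivative_at_within[OF loewner_f_differentiable[OF s Imv[OF that]]])
  qed (use seg in auto)
  also have "\<dots> \<le> (A^3 * (E * sqrt E) * y / sqrt t) * (A * y)"
  proof (rule mult_left_mono)
    have "(3 + S) * y \<le> A * y" using y0 by (intro mult_right_mono) (auto simp: A_def)
    then show "norm (p - q) \<le> A * y" using pq by linarith
  qed (use A E_pos y0 tp in auto)
  also have "\<dots> = A^4 * (E * sqrt E) * (y\<^sup>2 / sqrt t)"
    by (simp add: power2_eq_square power4_eq_xxxx power3_eq_cube)
  finally show ?thesis by (simp add: fp q_def A_def S_def y2)
qed

text \<open>
  From \<open>\<gamma>\<^sub>s\<close> up to height \<open>\<surd>(t - s)\<close>, across, and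
  down to \<open>\<gamma>\<^sub>t\<close>. At that height \<open>y\<^sup>2 + r / E \<ge> t /
  E\<close> for both times \<open>r\<close>, so the vertical pieces also carry the denominator
  \<open>\<surd>t\<close> rather than \<open>\<surd>s\<close>. The constant is \<open>768 = 3
  \<sqdot> 4\<^sup>4\<close>: three pieces, and \<open>4 + S \<le> 4 exp (S / 4)\<close>.
\<close>

lemma trace_increment:
  assumes st: "0 \<le> s" "s < t" "t \<le> T"
  shows "norm (loewner_trace U t - loewner_trace U s) \<le> 768 * exp (2 * energy 0 T) * ((t - s) / sqrt t)"
proof -
  define y where "y = sqrt (t - s)"
  define S where "S = energy 0 T"
  define B where "B = (4 + S)^4 * (E * sqrt E) * ((t - s) / sqrt t)"
  have S0: "0 \<le> S" by (simp add: S_def energy_nonneg)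
  have y0: "0 < y" and y2: "y\<^sup>2 = t - s" using st by (auto simp: y_def)
  have tp: "0 < t" using st by simp
  have one: "1 \<le> (4 + S)^4" using S0 by (intro one_le_power) auto
  have vert: "norm (loewner_f U r (above_tip U r y) - loewner_trace U r) \<le> B" if r: "s \<le> r" "r \<le> t" for r
  proof -
    have r': "r \<in> {0..T}" using r st by simp
    have "t / E = (t - s) / E + s / E" by (simp add: diff_divide_distrib)
    also have "\<dots> \<le> (t - s) / 1 + r / E"
      using E_ge_1 E_pos st r by (intro add_mono divide_left_mono divide_right_mono) auto
    finally have le: "t / E \<le> y\<^sup>2 + r / E" by (simp add: y2)
    have "norm (loewner_f U r (above_tip U r y) - loewner_trace U r) \<le> tip_modulus r y - tip_modulus r 0"
      by (rule trace_limit(2)[OF r' y0])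
    also have "\<dots> = E * (sqrt (y\<^sup>2 + r / E) - sqrt (r / E))" by (simp add: tip_modulus_def algebra_simps)
    also have "\<dots> \<le> E * (y\<^sup>2 / sqrt (t / E))"
      using le tp E_pos y0 r st by (intro mult_left_mono sqrt_increment_le) auto
    also have "\<dots> = 1 * ((E * sqrt E) * ((t - s) / sqrt t))" by (simp add: y2 real_sqrt_divide)
    also have "\<dots> \<le> (4 + S)^4 * ((E * sqrt E) * ((t - s) / sqrt t))"
      using one E_pos st tp by (intro mult_right_mono) auto
    finally show ?thesis by (simp add: B_def mult.assoc)
  qed
  have mid: "norm (loewner_f U t (above_tip U t y) - loewner_f U s (above_tip U s y)) \<le> B"
    unfolding B_def S_def by (rule horizontal_increment[OF st y_def])
  have "norm (loewner_trace U t - loewner_trace U s) \<le>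
      norm (loewner_f U t (above_tip U t y) - loewner_f U s (above_tip U s y))
      + norm (loewner_f U s (above_tip U s y) - loewner_trace U s)
      + norm (loewner_f U t (above_tip U t y) - loewner_trace U t)"
    by (rule norm_diff_via_approximants)
  also have "\<dots> \<le> B + B + B"
    using st by (intro add_mono mid vert) auto
  also have "B + B + B = 3 * ((4 + S)^4 * (E * sqrt E)) * ((t - s) / sqrt t)" by (simp add: B_def)
  also have "\<dots> \<le> 3 * (256 * exp S * exp S) * ((t - s) / sqrt t)"
  proof (intro mult_right_mono mult_left_mono mult_mono)
    have "4 + S \<le> 4 * exp (S / 4)" using exp_ge_add_one_self[of "S / 4"] by linarith
    then have "(4 + S)^4 \<le> (4 * exp (S / 4))^4" using S0 by (intro power_mono) auto
    also have "\<dots> = 256 * exp S" by (simp add: power_mult_distrib flip: exp_of_nat_mult)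
    finally show "(4 + S)^4 \<le> 256 * exp S" .
    have "E * sqrt E \<le> E * E"
      using E_ge_1 E_pos by (intro mult_left_mono real_le_lsqrt) (auto simp: power2_eq_square)
    also have "\<dots> \<le> exp S" unfolding E_def S_def[symmetric] exp_add[symmetric] using S0 by simp
    finally show "E * sqrt E \<le> exp S" .
  qed (use st tp E_pos in auto)
  also have "\<dots> = 768 * exp (2 * S) * ((t - s) / sqrt t)" by (simp add: exp_double power2_eq_square)
  finally show ?thesis by (simp add: S_def)
qed

text \<open>
  Let \<open>\<delta>\<close> be the difference of the flow lines that end at the two tips, on the
  common time interval \<open>{0..s}\<close>. The first one has height at least \<open>c\<close>,
  the second at least \<open>q\<close>, so \<open>\<bar>\<delta>\<bar>\<^sup>2\<close> has
  logarithmic derivative at most \<open>4 / (c q)\<close>, which is exactly the decrease of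
  \<open>k q\<close>. The estimate survives the limit \<open>y \<rightarrow> 0\<close> because
  \<open>1 / q\<close> is integrable uniformly in \<open>y\<close>.
\<close>

lemma tips_separated:
  assumes st: "0 \<le> s" "s < t" "t \<le> T" and c: "c = sqrt ((t - s) / E)" and y: "0 < y" "y \<le> c"
  shows "(c - y)\<^sup>2 \<le> (norm (loewner_f U t (above_tip U t y) - loewner_f U s (above_tip U s y)))\<^sup>2 *
    exp (8 * E / c * sqrt (y\<^sup>2 + s / E))"
proof -
  have t: "t \<in> {0..T}" and s: "s \<in> {0..T}" and s': "s \<in> {0..t}" using st by auto
  have cont: "continuous_on {0..t} U" "continuous_on {0..s} U"
    using st by (auto intro!: driver_continuous)
  have wt: "0 < Im (above_tip U t y)" and ws: "0 < Im (above_tip U s y)" using y by auto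
  have c0: "0 < c" using y by simp
  \<comment> \<open>Chosen such that \<open>(k q)' = - 4 / (c q)\<close>.\<close>
  define k where "k = 8 * E / c"
  define q where "q r = sqrt (y\<^sup>2 + (s - r) / E)" for r
  define g1 where "g1 = loewner_back U t (above_tip U t y)"
  define g2 where "g2 = loewner_back U s (above_tip U s y)"
  define \<delta> where "\<delta> r = g1 r - g2 r" for r
  have E: "exp (energy r v / 4) \<le> E" if "0 \<le> r" "v \<le> T" for r v
    unfolding E_def using energy_mono[of 0 r v T] that by simp
  have Im1: "c \<le> Im (g1 r)" if r: "r \<in> {0..s}" for r
  proof -
    have r': "r \<in> {0..t}" using r st by auto
    have "(t - s) / E \<le> (t - r) / exp (energy r t / 4)"
      using r st E[of r t] by (intro frac_le) auto
    then have "c\<^sup>2 \<le> y\<^sup>2 + (t - r) / exp (energy r t / 4)"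
      using st E_pos by (simp add: c add_increasing)
    also have "\<dots> \<le> (Im (g1 r))\<^sup>2"
      using height_growth[OF t wt r', of 1] y by (simp add: g1_def norm_mult)
    finally have "c\<^sup>2 \<le> (Im (g1 r))\<^sup>2" .
    moreover have "0 \<le> Im (g1 r)"
      using Im_Z_ge[OF t wt r'] y by (simp add: g1_def)
    ultimately show ?thesis by (rule power2_le_imp_le)
  qed
  have Im2: "q r \<le> Im (g2 r)" if r: "r \<in> {0..s}" for r
  proof -
    have "(s - r) / E \<le> (s - r) / exp (energy r s / 4)"
      using r st E[of r s] by (intro frac_le) auto
    then have "y\<^sup>2 + (s - r) / E \<le> (Im (g2 r))\<^sup>2"
      using height_growth[OF s ws r, of 1] y by (simp add: g2_def norm_mult)
    moreover have "0 \<le> Im (g2 r)"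
      using Im_Z_ge[OF s ws r] y by (simp add: g2_def)
    ultimately show ?thesis unfolding q_def by (intro real_le_lsqrt) auto
  qed
  have ypos: "0 < y\<^sup>2 + (s - r) / E" if "r \<in> {0..s}" for r
    using that y E_pos by (intro add_pos_nonneg) auto
  have q0: "0 < q r" if "r \<in> {0..s}" for r using ypos[OF that] by (simp add: q_def)
  have "- ((norm (\<delta> 0))\<^sup>2 * exp (k * q 0)) \<le> - ((norm (\<delta> s))\<^sup>2 * exp (k * q s))"
  proof (rule nondecreasing_within[OF st(1), of "\<lambda>r. - ((norm (\<delta> r))\<^sup>2 * exp (k * q r))"])
    fix r assume r: "r \<in> {0..s}"
    define a where "a = g1 r - U r"
    define b where "b = g2 r - U r"
    have r': "r \<in> {0..t}" using r st by auto
    have "(\<delta> has_vector_derivative 2 / a - 2 / b) (at r within {0..s})"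
      unfolding \<delta>_def[abs_def] a_def b_def g1_def g2_def using r st
      by (intro has_vector_derivative_diff
          has_vector_derivative_within_subset[OF loewner_back_derivative[OF _ cont(1) wt r']]
          loewner_back_derivative[OF _ cont(2) ws r]) auto
    note d1 = has_real_derivative_norm_sq[OF this]
    have "((\<lambda>r. y\<^sup>2 + (s - r) / E) has_real_derivative - 1 / E) (at r within {0..s})"
      using E_pos by (auto intro!: derivative_eq_intros)
    from DERIV_chain2[OF DERIV_real_sqrt[OF ypos[OF r]] this]
    have "(q has_real_derivative inverse (q r) / 2 * (- 1 / E)) (at r within {0..s})"
      unfolding q_def[abs_def] .
    from DERIV_chain2[OF DERIV_exp DERIV_cmult[OF this, of k]]
    have d2: "((\<lambda>r. exp (k * q r)) has_real_derivative
        exp (k * q r) * (k * (inverse (q r) / 2 * (- 1 / E)))) (at r within {0..s})" .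
    have kq: "k * (inverse (q r) / 2 * (- 1 / E)) = - (4 / (c * q r))"
      using E_pos by (simp add: k_def field_simps)
    show "((\<lambda>r. - ((norm (\<delta> r))\<^sup>2 * exp (k * q r))) has_real_derivative
       exp (k * q r) * ((4 / (c * q r)) * (norm (\<delta> r))\<^sup>2 - 2 * (\<delta> r \<bullet> (2 / a - 2 / b)))) (at r within {0..s})"
      using DERIV_minus[OF DERIV_mult[OF d1 d2]] unfolding kq by (simp add: algebra_simps)
    have na: "c \<le> norm a" "a \<noteq> 0"
      using Im1[OF r] abs_Im_le_cmod[of a] c0 by (auto simp: a_def)
    have nb: "q r \<le> norm b" "b \<noteq> 0"
      using Im2[OF r] abs_Im_le_cmod[of b] q0[OF r] by (auto simp: b_def)
    have "2 / a - 2 / b = - (2 / (a * b)) * \<delta> r"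
      using diff_of_velocities[OF na(2) nb(2)] by (simp add: a_def b_def \<delta>_def)
    then have "norm (2 / a - 2 / b) = 2 / (norm a * norm b) * norm (\<delta> r)"
      by (simp only: norm_mult norm_minus_cancel norm_divide norm_numeral)
    also have "\<dots> \<le> 2 / (c * q r) * norm (\<delta> r)"
      using na nb c0 q0[OF r] by (intro mult_right_mono divide_left_mono mult_mono mult_pos_pos) auto
    finally have nd: "norm (2 / a - 2 / b) \<le> 2 / (c * q r) * norm (\<delta> r)" .
    have "\<delta> r \<bullet> (2 / a - 2 / b) \<le> norm (\<delta> r) * norm (2 / a - 2 / b)" by (rule norm_cauchy_schwarz)
    also have "\<dots> \<le> norm (\<delta> r) * (2 / (c * q r) * norm (\<delta> r))" by (intro mult_left_mono nd) simp
    finally have "2 * (\<delta> r \<bullet> (2 / a - 2 / b)) \<le> (4 / (c * q r)) * (norm (\<delta> r))\<^sup>2"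
      by (simp add: power2_eq_square)
    then show "0 \<le> exp (k * q r) * ((4 / (c * q r)) * (norm (\<delta> r))\<^sup>2 - 2 * (\<delta> r \<bullet> (2 / a - 2 / b)))"
      by simp
  qed
  then have main: "(norm (\<delta> s))\<^sup>2 * exp (k * q s) \<le> (norm (\<delta> 0))\<^sup>2 * exp (k * q 0)" by simp
  have ss: "s \<in> {0..s}" using st by simp
  have "c - y \<le> Im (\<delta> s)"
    using Im1[OF ss] loewner_back_end[OF st(1) cont(2) ws] by (simp add: \<delta>_def g2_def)
  also have "\<dots> \<le> norm (\<delta> s)" using abs_Im_le_cmod[of "\<delta> s"] by linarith
  finally have "(c - y)\<^sup>2 \<le> (norm (\<delta> s))\<^sup>2 * 1" using y by (simp add: power_mono)
  also have "\<dots> \<le> (norm (\<delta> s))\<^sup>2 * exp (k * q s)"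
    using q0[OF ss] c0 E_pos by (intro mult_left_mono) (auto simp: k_def)
  also note main
  also have "\<delta> 0 = loewner_f U t (above_tip U t y) - loewner_f U s (above_tip U s y)"
    using loewner_f_eq[OF _ cont(1) wt] loewner_f_eq[OF _ cont(2) ws] st by (simp add: \<delta>_def g1_def g2_def)
  finally show ?thesis by (simp add: k_def q_def)
qed

lemma trace_neq:
  assumes st: "0 \<le> s" "s < t" "t \<le> T"
  shows "loewner_trace U t \<noteq> loewner_trace U s"
proof
  assume eq: "loewner_trace U t = loewner_trace U s"
  define c where "c = sqrt ((t - s) / E)"
  have c0: "0 < c" using st E_pos by (simp add: c_def)
  have t: "t \<in> {0..T}" and s: "s \<in> {0..T}" using st by auto
  have "(c - 0)\<^sup>2 \<le> (norm (loewner_trace U t - loewner_trace U s))\<^sup>2 * exp (8 * E / c * sqrt (0\<^sup>2 + s / E))"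
  proof (rule tendsto_le[of "at_right (0::real)"])
    show "((\<lambda>y. (c - y)\<^sup>2) \<longlongrightarrow> (c - 0)\<^sup>2) (at_right 0)" by (intro tendsto_intros)
    show "((\<lambda>y. (norm (loewner_f U t (above_tip U t y) - loewner_f U s (above_tip U s y)))\<^sup>2 *
        exp (8 * E / c * sqrt (y\<^sup>2 + s / E))) \<longlongrightarrow>
        (norm (loewner_trace U t - loewner_trace U s))\<^sup>2 * exp (8 * E / c * sqrt (0\<^sup>2 + s / E))) (at_right 0)"
      by (intro tendsto_intros trace_limit(1) t s)
    show "\<forall>\<^sub>F y in at_right 0. (c - y)\<^sup>2 \<le>
        (norm (loewner_f U t (above_tip U t y) - loewner_f U s (above_tip U s y)))\<^sup>2 *
        exp (8 * E / c * sqrt (y\<^sup>2 + s / E))"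
      using c0 tips_separated[OF st c_def]
      by (auto simp: eventually_at_right_field intro!: exI[of _ c])
  qed simp
  then show False using eq c0 by simp
qed

end

text \<open>
  Approximating both traces from height \<open>y\<close> costs at most \<open>exp (S / 4)
  y\<close> each. At this fixed height the flow lines of the two drivers are compared by
  Gronwall's inequality.
\<close>

lemma trace_stability:
  assumes "finite_energy_driver T U u N" "finite_energy_driver T V v M"
    and S: "finite_energy_driver.energy u 0 T \<le> S" "finite_energy_driver.energy v 0 T \<le> S"
    and t: "t \<in> {0..T}" and y: "0 < y"
    and \<eta>: "\<And>s. s \<in> {0..T} \<Longrightarrow> \<bar>U s - V s\<bar> \<le> \<eta>"
  shows "norm (loewner_trace U t - loewner_trace V t) \<le> 2 * exp (S / 4) * y + 2 * \<eta> * exp (3 * T / y\<^sup>2)"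
proof -
  interpret U: finite_energy_driver T U u N by fact
  interpret V: finite_energy_driver T V v M by fact
  let ?a = "loewner_f U t (above_tip U t y)" and ?b = "loewner_f V t (above_tip V t y)"
  have t0: "0 \<le> t" "t \<le> T" using t by auto
  have \<eta>0: "0 \<le> \<eta>" using \<eta>[OF t] by linarith
  have 1: "norm (?a - loewner_trace U t) \<le> exp (S / 4) * y"
  proof -
    have "norm (?a - loewner_trace U t) \<le> U.tip_modulus t y - U.tip_modulus t 0" by (rule U.trace_limit(2)[OF t y])
    also have "\<dots> = U.E * (sqrt (y\<^sup>2 + t / U.E) - sqrt (t / U.E))" by (simp add: U.tip_modulus_def algebra_simps)
    also have "\<dots> \<le> exp (S / 4) * y"
      using S(1) y t0 U.E_pos by (intro mult_mono sqrt_increment_le_linear) (auto simp: U.E_def)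
    finally show ?thesis .
  qed
  have 2: "norm (?b - loewner_trace V t) \<le> exp (S / 4) * y"
  proof -
    have "norm (?b - loewner_trace V t) \<le> V.tip_modulus t y - V.tip_modulus t 0" by (rule V.trace_limit(2)[OF t y])
    also have "\<dots> = V.E * (sqrt (y\<^sup>2 + t / V.E) - sqrt (t / V.E))" by (simp add: V.tip_modulus_def algebra_simps)
    also have "\<dots> \<le> exp (S / 4) * y"
      using S(2) y t0 V.E_pos by (intro mult_mono sqrt_increment_le_linear) (auto simp: V.E_def)
    finally show ?thesis .
  qed
  have 3: "norm (?a - ?b) \<le> 2 * \<eta> * exp (3 * T / y\<^sup>2)"
  proof -
    have cU: "continuous_on {0..t} U" and cV: "continuous_on {0..t} V"
      using U.driver_continuous V.driver_continuous t0 by auto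
    have w: "0 < Im (above_tip U t y)" "0 < Im (above_tip V t y)" using y by auto
    have tips: "norm (above_tip U t y - above_tip V t y) \<le> \<eta>"
      using \<eta>[OF t] by (simp add: above_tip_def flip: of_real_diff)
    have "(norm (?a - ?b))\<^sup>2 + \<eta>\<^sup>2 \<le> exp (3 * (2 / y\<^sup>2) * (t - 0)) *
        ((norm (above_tip U t y - above_tip V t y))\<^sup>2 + \<eta>\<^sup>2)"
      unfolding loewner_f_eq[OF t0(1) cU w(1)] loewner_f_eq[OF t0(1) cV w(2)]
      using t0 y \<eta> by (intro loewner_back_stability cU cV) auto
    also have "\<dots> \<le> exp (2 * (3 * T / y\<^sup>2)) * (\<eta>\<^sup>2 + \<eta>\<^sup>2)"
      using t0 tips y \<eta>0 by (intro mult_mono add_mono power_mono) (auto simp: divide_right_mono)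
    also have "\<dots> \<le> (2 * \<eta> * exp (3 * T / y\<^sup>2))\<^sup>2"
      unfolding exp_double by (simp add: power_mult_distrib)
    finally have "(norm (?a - ?b))\<^sup>2 \<le> (2 * \<eta> * exp (3 * T / y\<^sup>2))\<^sup>2"
      using zero_le_power2[of \<eta>] by linarith
    then show ?thesis by (rule power2_le_imp_le) (use \<eta>0 in simp)
  qed
  have "norm (loewner_trace U t - loewner_trace V t)
      \<le> norm (?a - ?b) + norm (?b - loewner_trace V t) + norm (?a - loewner_trace U t)"
    by (rule norm_diff_via_approximants)
  then show ?thesis using 1 2 3 by linarith
qed

section \<open>Path spaces and continuity of the Schramm--Loewner map\<close>

text \<open>
  The derivatives within \<open>{0..t}\<close> and within \<open>{0..T}\<close> differ at most at
  endpoints, so the driver on the complete interval determines the energy norms for all times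
  \<open>t\<close>.
\<close>

lemma finite_energy_imp_driver:
  assumes T: "0 \<le> T" and U: "U \<in> finite_energy T"
  obtains N where "finite_energy_driver T U (path_deriv T U) N"
    "\<And>t. t \<in> {0..T} \<Longrightarrow> finite_energy_driver.energy (path_deriv T U) 0 t = (energy_norm t U)\<^sup>2"
proof -
  have ac: "absolutely_continuous_path 0 T U"
    and ae: "AE s in lebesgue_on {0..T}. U differentiable (at s within {0..T})"
    and sq: "set_integrable lebesgue {0..T} (\<lambda>s. (path_deriv T U s)\<^sup>2)"
    using U by (auto simp: finite_energy_def)
  have "AE s in lebesgue. s \<in> {0..T} \<longrightarrow> U differentiable (at s within {0..T})"
    using ae by (simp add: AE_restrict_space_iff)
  then obtain N where N: "N \<in> null_sets lebesgue"
    "{s. \<not> (s \<in> {0..T} \<longrightarrow> U differentiable (at s within {0..T}))} \<subseteq> N"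
    by (auto simp: eventually_ae_filter)
  interpret finite_energy_driver T U "path_deriv T U" N
  proof
    show "negligible N" using N(1) by (simp add: negligible_iff_null_sets)
    fix s assume s: "s \<in> {0<..<T} - N"
    then have "s \<in> {0..T}" "s \<notin> N" by auto
    then have "U differentiable (at s within {0..T})" using N(2) by blast
    then have "(U has_vector_derivative path_deriv T U s) (at s within {0..T})"
      unfolding path_deriv_def by (rule vector_derivative_works[THEN iffD1])
    moreover have "at s within {0..T} = at s" using s by (intro at_within_interior) auto
    ultimately show "(U has_real_derivative path_deriv T U s) (at s)"
      by (simp add: has_real_derivative_iff_has_vector_derivative)
  next
    show "(\<lambda>s. (path_deriv T U s)\<^sup>2) integrable_on {0..T}"
      using sq by (rule set_lebesgue_integral_eq_integral)
  qed (fact T ac)+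
  have "energy 0 t = (energy_norm t U)\<^sup>2" if t: "t \<in> {0..T}" for t
  proof -
    have eq: "(path_deriv t U s)\<^sup>2 = (path_deriv T U s)\<^sup>2" if "s \<in> {0..t} - {0, t}" for s
    proof -
      have "at s within {0..t} = at s" "at s within {0..T} = at s"
        using that t by (auto intro!: at_within_interior)
      then show ?thesis by (simp add: path_deriv_def)
    qed
    have "(\<lambda>s. (path_deriv T U s)\<^sup>2) integrable_on {0..t}" using t by (intro sq_integrable) auto
    then have "(\<lambda>s. (path_deriv t U s)\<^sup>2) integrable_on {0..t}"
      by (rule integrable_spike[where S = "{0, t}"]) (use eq in auto)
    then have abs: "set_integrable lebesgue {0..t} (\<lambda>s. (path_deriv t U s)\<^sup>2)"
      by (rule nonnegative_absolutely_integrable_1) simp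
    have "(energy_norm t U)\<^sup>2 = (LINT s:{0..t}|lebesgue. (path_deriv t U s)\<^sup>2)"
      unfolding energy_norm_def
      by (rule real_sqrt_pow2) (auto simp: set_lebesgue_integral_def intro!: integral_nonneg)
    also have "\<dots> = integral {0..t} (\<lambda>s. (path_deriv t U s)\<^sup>2)"
      by (rule set_lebesgue_integral_eq_integral(2)[OF abs])
    also have "\<dots> = energy 0 t"
      unfolding energy_def by (rule integral_spike[where S = "{0, t}"]) (use eq in auto)
    finally show ?thesis by simp
  qed
  with finite_energy_driver_axioms show thesis by (rule that)
qed

lemma energy_norm_nonneg: "0 \<le> energy_norm t h"
  by (auto simp: energy_norm_def set_lebesgue_integral_def intro!: integral_nonneg)

lemma drivers_imp_finite_energy: "U \<in> drivers T \<Longrightarrow> U \<in> finite_energy T"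
  by (simp add: drivers_def)

definition trace_constant :: "real \<Rightarrow> (real \<Rightarrow> real) \<Rightarrow> real" where
  "trace_constant T U = 768 * exp (2 * (energy_norm T U)\<^sup>2)"

lemma trace_constant_pos: "0 < trace_constant T U"
  by (simp add: trace_constant_def)

lemma driver_trace_increment:
  assumes U: "U \<in> drivers T" and st: "0 \<le> s" "s < t" "t \<le> T"
  shows "norm (loewner_trace U t - loewner_trace U s) \<le> trace_constant T U * ((t - s) / sqrt t)"
proof -
  have T: "0 \<le> T" using st by simp
  obtain N where N: "finite_energy_driver T U (path_deriv T U) N"
    "\<And>t. t \<in> {0..T} \<Longrightarrow> finite_energy_driver.energy (path_deriv T U) 0 t = (energy_norm t U)\<^sup>2"
    using finite_energy_imp_driver[OF T drivers_imp_finite_energy[OF U]] by blast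
  show ?thesis
    using finite_energy_driver.trace_increment[OF N(1) st] T by (simp add: N(2) trace_constant_def)
qed

lemma driver_trace_holder:
  assumes U: "U \<in> drivers T" and st: "0 \<le> s" "s < t" "t \<le> T"
  shows "norm (loewner_trace U t - loewner_trace U s) \<le> trace_constant T U * sqrt (t - s)"
proof -
  have "(t - s) / sqrt t \<le> (t - s) / sqrt (t - s)"
    using st by (intro divide_left_mono mult_pos_pos) auto
  also have "\<dots> = sqrt (t - s)" using st by (simp add: real_div_sqrt)
  finally have "trace_constant T U * ((t - s) / sqrt t) \<le> trace_constant T U * sqrt (t - s)"
    using trace_constant_pos[of T U] by (intro mult_left_mono) auto
  with driver_trace_increment[OF assms] show ?thesis by linarith
qed

lemma driver_trace_sqrt_increment:
  assumes U: "U \<in> drivers T" and st: "0 \<le> s" "s \<le> t" "t \<le> T"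
  shows "norm (loewner_trace U t - loewner_trace U s) \<le> 2 * trace_constant T U * (sqrt t - sqrt s)"
proof (cases "s = t")
  case False
  then have "s < t" using st by simp
  then have t: "0 < sqrt t" and s: "0 \<le> sqrt s" "sqrt s \<le> sqrt t" using st by auto
  have "t - s = (sqrt t - sqrt s) * (sqrt t + sqrt s)"
    using st by (simp add: algebra_simps)
  then have "(t - s) / sqrt t = (sqrt t - sqrt s) * ((sqrt t + sqrt s) / sqrt t)" by simp
  also have "\<dots> \<le> (sqrt t - sqrt s) * 2"
    using t s by (intro mult_left_mono) (auto simp: field_simps)
  finally have "trace_constant T U * ((t - s) / sqrt t) \<le> trace_constant T U * ((sqrt t - sqrt s) * 2)"
    using trace_constant_pos[of T U] by (intro mult_left_mono) auto
  with driver_trace_increment[OF U st(1) \<open>s < t\<close> st(3)] show ?thesis by (simp add: algebra_simps)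
qed simp

lemma driver_trace_lipschitz_sqrt_time:
  assumes U: "U \<in> drivers T"
  shows "(2 * trace_constant T U)-lipschitz_on {0..sqrt T} (\<lambda>t. loewner_trace U (t\<^sup>2))"
proof (rule lipschitz_onI)
  have le: "norm (loewner_trace U (b\<^sup>2) - loewner_trace U (a\<^sup>2)) \<le> 2 * trace_constant T U * (b - a)"
    if "0 \<le> a" "a \<le> b" "b \<le> sqrt T" for a b
  proof -
    have "b\<^sup>2 \<le> T" using that by (simp add: real_le_rsqrt sqrt_ge_absD)
    then show ?thesis
      using driver_trace_sqrt_increment[OF U, of "a\<^sup>2" "b\<^sup>2"] that by (simp add: power_mono)
  qed
  fix a b assume "a \<in> {0..sqrt T}" "b \<in> {0..sqrt T}"
  then show "dist (loewner_trace U (a\<^sup>2)) (loewner_trace U (b\<^sup>2)) \<le> 2 * trace_constant T U * dist a b"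
    using le[of a b] le[of b a]
    by (cases "a \<le> b") (auto simp: dist_norm norm_minus_commute abs_if)
qed (use trace_constant_pos[of T U] in simp)

lemma driver_trace_lipschitz_away_from_0:
  assumes U: "U \<in> drivers T" and \<delta>: "0 < \<delta>"
  shows "(trace_constant T U / sqrt \<delta>)-lipschitz_on {\<delta>..T} (loewner_trace U)"
proof (rule lipschitz_onI)
  have le: "norm (loewner_trace U b - loewner_trace U a) \<le> trace_constant T U / sqrt \<delta> * (b - a)"
    if "\<delta> \<le> a" "a \<le> b" "b \<le> T" for a b
  proof (cases "a = b")
    case False
    then have "norm (loewner_trace U b - loewner_trace U a) \<le> trace_constant T U * ((b - a) / sqrt b)"
      using that \<delta> by (intro driver_trace_increment[OF U]) auto
    also have "\<dots> \<le> trace_constant T U * ((b - a) / sqrt \<delta>)"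
      using that \<delta> trace_constant_pos[of T U]
      by (intro mult_left_mono divide_left_mono mult_pos_pos) auto
    finally show ?thesis by simp
  qed simp
  fix a b assume "a \<in> {\<delta>..T}" "b \<in> {\<delta>..T}"
  then show "dist (loewner_trace U a) (loewner_trace U b) \<le> trace_constant T U / sqrt \<delta> * dist a b"
    using le[of a b] le[of b a]
    by (cases "a \<le> b") (auto simp: dist_norm norm_minus_commute abs_if)
qed (use trace_constant_pos[of T U] \<delta> in simp)

lemma driver_trace_continuous:
  assumes U: "U \<in> drivers T"
  shows "continuous_on {0..T} (loewner_trace U)"
proof -
  have "continuous_on {0..T} ((\<lambda>t. loewner_trace U (t\<^sup>2)) \<circ> sqrt)"
  proof (rule continuous_on_compose)
    show "continuous_on {0..T} sqrt" by (intro continuous_intros)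
    show "continuous_on (sqrt ` {0..T}) (\<lambda>t. loewner_trace U (t\<^sup>2))"
      by (rule continuous_on_subset[OF lipschitz_on_continuous_on[OF driver_trace_lipschitz_sqrt_time[OF U]]])
        auto
  qed
  then show ?thesis
    by (rule continuous_on_cong[THEN iffD1, rotated 2]) auto
qed

lemma driver_trace_exists:
  assumes T: "0 \<le> T" and U: "U \<in> drivers T"
  shows "loewner_trace_exists T U" "inj_on (loewner_trace U) {0..T}"
    and "loewner_trace U ` {0..T} \<subseteq> {z. 0 \<le> Im z}"
proof -
  obtain N where N: "finite_energy_driver T U (path_deriv T U) N"
    using finite_energy_imp_driver[OF T drivers_imp_finite_energy[OF U]] by blast
  interpret finite_energy_driver T U "path_deriv T U" N by fact
  show "loewner_trace_exists T U"
    unfolding loewner_trace_exists_def using driver_trace_continuous[OF U] trace_limit(1) by blast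
  show "inj_on (loewner_trace U) {0..T}"
  proof (rule linorder_inj_onI)
    show "loewner_trace U s \<noteq> loewner_trace U t" if "s < t" "s \<in> {0..T}" "t \<in> {0..T}" for s t
      using trace_neq[of s t] that by auto
  qed auto
  show "loewner_trace U ` {0..T} \<subseteq> {z. 0 \<le> Im z}" using trace_Im_nonneg by auto
qed

lemma holder_seminorm_le:
  assumes "\<And>s t. 0 \<le> s \<Longrightarrow> s < t \<Longrightarrow> t \<le> T \<Longrightarrow> norm (x t - x s) \<le> C * (t - s) powr \<alpha>"
  shows "holder_seminorm \<alpha> T x \<le> ennreal C"
  unfolding holder_seminorm_def
proof (rule SUP_least, clarify)
  fix s t :: real assume st: "0 \<le> s" "s < t" "t \<le> T"
  then show "ennreal (norm (x t - x s) / \<bar>t - s\<bar> powr \<alpha>) \<le> ennreal C"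
    using assms[OF st] by (intro ennreal_leI) (simp add: field_simps)
qed

lemma sup_norm_le:
  assumes "\<And>t. t \<in> {0..T} \<Longrightarrow> norm (x t) \<le> C"
  shows "sup_norm T x \<le> ennreal C"
  unfolding sup_norm_def using assms by (intro SUP_least ennreal_leI)

lemma sup_norm_lessD:
  assumes "sup_norm T x < ennreal \<delta>" "t \<in> {0..T}"
  shows "norm (x t) \<le> \<delta>"
proof -
  have "ennreal (norm (x t)) \<le> sup_norm T x"
    unfolding sup_norm_def using assms(2) by (rule SUP_upper)
  also note assms(1)
  finally show ?thesis using ennreal_less_iff[of "norm (x t)" \<delta>] by simp
qed

lemma sup_norm_finite:
  assumes "continuous_on {0..T} x"
  shows "sup_norm T x < \<infinity>"
proof -
  have "bounded (x ` {0..T})"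
    by (rule compact_imp_bounded[OF compact_continuous_image[OF assms compact_Icc]])
  then obtain C where "\<And>t. t \<in> {0..T} \<Longrightarrow> norm (x t) \<le> C"
    unfolding bounded_iff by (meson imageI)
  then have "sup_norm T x \<le> ennreal C" by (rule sup_norm_le)
  then show ?thesis by (simp add: le_less_trans)
qed

lemma variation_le:
  assumes p: "1 \<le> p" and C: "0 \<le> C"
    and le: "\<And>n \<tau>. mono_on {..n} \<tau> \<Longrightarrow> \<tau> ` {..n} \<subseteq> {0..T} \<Longrightarrow>
      (\<Sum>i<n. norm (x (\<tau> (Suc i)) - x (\<tau> i)) powr p) \<le> C powr p"
  shows "variation p T x \<le> ennreal C"
  unfolding variation_def
proof (rule SUP_least, clarify)
  fix n :: nat and \<tau> :: "nat \<Rightarrow> real"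
  assume "mono_on {..n} \<tau>" "\<tau> ` {..n} \<subseteq> {0..T}"
  then have "(\<Sum>i<n. norm (x (\<tau> (Suc i)) - x (\<tau> i)) powr p) powr (1 / p) \<le> (C powr p) powr (1 / p)"
    using p by (intro powr_mono2 le sum_nonneg) auto
  also have "\<dots> = C" using p C by (simp add: powr_powr)
  finally show "ennreal ((\<Sum>i<n. norm (x (\<tau> (Suc i)) - x (\<tau> i)) powr p) powr (1 / p)) \<le> ennreal C"
    by (rule ennreal_leI)
qed

text \<open>
  Increments over short times are small by the \<open>1/2\<close>-Hoelder bound, those over long
  times by uniform smallness.
\<close>

lemma holder_norm_interpolation:
  assumes T: "0 < T" and H: "0 \<le> H" and \<epsilon>: "0 < \<epsilon>" and e: "0 < e"
  shows "\<exists>\<eta>>0. \<forall>x :: real \<Rightarrow> 'a::real_normed_vector. (\<forall>t\<in>{0..T}. norm (x t) \<le> \<eta>) \<longrightarrow>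
    (\<forall>s t. 0 \<le> s \<and> s < t \<and> t \<le> T \<longrightarrow> norm (x t - x s) \<le> H * sqrt (t - s)) \<longrightarrow>
    holder_norm (1 / 2 - \<epsilon>) T x < ennreal e"
proof -
  define \<alpha> where "\<alpha> = 1 / 2 - \<epsilon>"
  define \<rho> where "\<rho> = (e / (4 * (H + 1))) powr (1 / \<epsilon>)"
  \<comment> \<open>The exponent \<open>\<alpha>\<close> may have either sign; \<open>M\<close> bounds \<open>r powr (- \<alpha>)\<close> on \<open>[\<rho>, T]\<close> in both cases.\<close>
  define M where "M = \<rho> powr (- \<alpha>) + T powr (- \<alpha>)"
  define \<eta> where "\<eta> = min (e / 4) (e / (8 * M))"
  have \<rho>0: "0 < \<rho>" using e H by (simp add: \<rho>_def)
  have \<rho>: "H * \<rho> powr \<epsilon> \<le> e / 4"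
    using \<epsilon> e H by (simp add: \<rho>_def powr_powr field_simps)
  have M: "0 < M" using \<rho>0 T by (simp add: M_def add_pos_pos)
  have \<eta>: "0 < \<eta>" "\<eta> \<le> e / 4" "2 * \<eta> * M \<le> e / 4"
  proof -
    show "0 < \<eta>" "\<eta> \<le> e / 4" using e M by (auto simp: \<eta>_def)
    have "\<eta> * M \<le> e / (8 * M) * M" using M by (intro mult_right_mono) (auto simp: \<eta>_def)
    then show "2 * \<eta> * M \<le> e / 4" using M by simp
  qed
  have "holder_norm \<alpha> T x < ennreal e"
    if sup: "\<forall>t\<in>{0..T}. norm (x t) \<le> \<eta>"
      and hol: "\<forall>s t. 0 \<le> s \<and> s < t \<and> t \<le> T \<longrightarrow> norm (x t - x s) \<le> H * sqrt (t - s)"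
    for x :: "real \<Rightarrow> 'a"
  proof -
    have "holder_seminorm \<alpha> T x \<le> ennreal (e / 4)"
    proof (rule holder_seminorm_le)
      fix s t assume st: "0 \<le> s" "s < t" "t \<le> T"
      define r where "r = t - s"
      have r: "0 < r" "r \<le> T" using st by (auto simp: r_def)
      show "norm (x t - x s) \<le> e / 4 * (t - s) powr \<alpha>"
      proof (cases "r \<le> \<rho>")
        case True
        have "norm (x t - x s) \<le> H * sqrt r" using hol st by (simp add: r_def)
        also have "sqrt r = r powr \<epsilon> * r powr \<alpha>"
          using r by (simp add: \<alpha>_def powr_half_sqrt flip: powr_add)
        also have "H * (r powr \<epsilon> * r powr \<alpha>) \<le> (H * \<rho> powr \<epsilon>) * r powr \<alpha>"
          using True r \<epsilon> H by (simp add: mult.assoc[symmetric] mult_mono powr_mono2)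
        also have "\<dots> \<le> e / 4 * r powr \<alpha>" using \<rho> by (rule mult_right_mono) simp
        finally show ?thesis by (simp add: r_def)
      next
        case False
        have "r powr (- \<alpha>) \<le> M"
        proof (cases "0 \<le> \<alpha>")
          case True
          have "r powr (- \<alpha>) \<le> \<rho> powr (- \<alpha>)"
            using False True \<rho>0 by (intro powr_mono2') auto
          then show ?thesis by (simp add: M_def add_increasing2)
        next
          case neg: False
          have "r powr (- \<alpha>) \<le> T powr (- \<alpha>)"
            using r neg by (intro powr_mono2) auto
          then show ?thesis by (simp add: M_def add_increasing)
        qed
        then have "1 \<le> M * r powr \<alpha>"
          using r by (simp add: powr_minus field_simps)
        then have "2 * \<eta> * 1 \<le> 2 * \<eta> * (M * r powr \<alpha>)" using \<eta>(1) by (intro mult_left_mono) auto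
        also have "\<dots> \<le> e / 4 * r powr \<alpha>"
          using mult_right_mono[OF \<eta>(3), of "r powr \<alpha>"] by (simp add: mult.assoc)
        finally have "2 * \<eta> \<le> e / 4 * r powr \<alpha>" by simp
        moreover have "norm (x t - x s) \<le> norm (x t) + norm (x s)" by (rule norm_triangle_ineq4)
        moreover have "norm (x t) \<le> \<eta>" "norm (x s) \<le> \<eta>" using sup st by auto
        ultimately show ?thesis by (simp add: r_def)
      qed
    qed
    moreover have "sup_norm T x \<le> ennreal (e / 4)"
      using sup \<eta>(2) by (intro sup_norm_le) force
    ultimately have "holder_norm \<alpha> T x \<le> ennreal (e / 4) + ennreal (e / 4)"
      unfolding holder_norm_def by (intro add_mono)
    also have "\<dots> < ennreal e" using e by (simp add: ennreal_plus[symmetric] ennreal_less_iff del: ennreal_plus)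
    finally show ?thesis .
  qed
  then show ?thesis using \<eta>(1) unfolding \<alpha>_def by (intro exI[of _ \<eta>]) auto
qed

lemma sum_powr_interpolation:
  fixes a :: "nat \<Rightarrow> real"
  assumes "\<And>i. i < n \<Longrightarrow> 0 \<le> a i" "\<And>i. i < n \<Longrightarrow> a i \<le> D" "(\<Sum>i<n. a i) \<le> V" "0 \<le> \<epsilon>" "0 \<le> D"
  shows "(\<Sum>i<n. a i powr (1 + \<epsilon>)) \<le> D powr \<epsilon> * V"
proof -
  have "(\<Sum>i<n. a i powr (1 + \<epsilon>)) \<le> (\<Sum>i<n. D powr \<epsilon> * a i)"
  proof (rule sum_mono)
    fix i assume "i \<in> {..<n}"
    then have i: "i < n" by simp
    have "a i powr (1 + \<epsilon>) = a i powr \<epsilon> * a i"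
      using assms(1)[OF i] by (cases "a i = 0") (auto simp: powr_add)
    also have "\<dots> \<le> D powr \<epsilon> * a i"
      using assms(1,2)[OF i] assms(4) by (intro mult_right_mono powr_mono2) auto
    finally show "a i powr (1 + \<epsilon>) \<le> D powr \<epsilon> * a i" .
  qed
  also have "\<dots> = D powr \<epsilon> * (\<Sum>i<n. a i)" by (simp add: sum_distrib_left)
  also have "\<dots> \<le> D powr \<epsilon> * V" using assms(3) by (intro mult_left_mono) auto
  finally show ?thesis .
qed

text \<open>
  One factor of each term of the \<open>(1 + \<epsilon>)\<close>-variation sum is kept for the
  bounded \<open>1\<close>-variation, the remaining power \<open>\<epsilon>\<close> is small
  uniformly.
\<close>

lemma variation_norm_interpolation:
  assumes V: "0 \<le> V" and \<epsilon>: "0 < \<epsilon>" and e: "0 < e"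
  shows "\<exists>\<eta>>0. \<forall>x :: real \<Rightarrow> 'a::real_normed_vector. (\<forall>t\<in>{0..T}. norm (x t) \<le> \<eta>) \<longrightarrow>
    (\<forall>n \<tau>. mono_on {..n} \<tau> \<and> \<tau> ` {..n} \<subseteq> {0..T} \<longrightarrow>
       (\<Sum>i<n. norm (x (\<tau> (Suc i)) - x (\<tau> i))) \<le> V) \<longrightarrow>
    variation_norm (1 + \<epsilon>) T x < ennreal e"
proof -
  define p where "p = 1 + \<epsilon>"
  \<comment> \<open>Solves \<open>d powr \<epsilon> * (V + 1) = (e / 4) powr p\<close>.\<close>
  define d where "d = (((e / 4) powr p) / (V + 1)) powr (1 / \<epsilon>)"
  define \<eta> where "\<eta> = min (e / 4) (d / 2)"
  have d0: "0 < d" using e V by (simp add: d_def)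
  have d: "d powr \<epsilon> * V \<le> (e / 4) powr p"
    using \<epsilon> e V by (simp add: d_def powr_powr field_simps)
  have \<eta>: "0 < \<eta>" "\<eta> \<le> e / 4" "2 * \<eta> \<le> d" using e d0 by (auto simp: \<eta>_def)
  have "variation_norm p T x < ennreal e"
    if sup: "\<forall>t\<in>{0..T}. norm (x t) \<le> \<eta>"
      and var: "\<forall>n \<tau>. mono_on {..n} \<tau> \<and> \<tau> ` {..n} \<subseteq> {0..T} \<longrightarrow>
       (\<Sum>i<n. norm (x (\<tau> (Suc i)) - x (\<tau> i))) \<le> V"
    for x :: "real \<Rightarrow> 'a"
  proof -
    have "variation p T x \<le> ennreal (e / 4)"
    proof (rule variation_le)
      fix n :: nat and \<tau> :: "nat \<Rightarrow> real" assume \<tau>: "mono_on {..n} \<tau>" "\<tau> ` {..n} \<subseteq> {0..T}"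
      have "(\<Sum>i<n. norm (x (\<tau> (Suc i)) - x (\<tau> i)) powr p) \<le> d powr \<epsilon> * V"
        unfolding p_def
      proof (rule sum_powr_interpolation)
        fix i assume "i < n"
        then have "Suc i \<in> {..n}" "i \<in> {..n}" by auto
        then have "\<tau> (Suc i) \<in> {0..T}" "\<tau> i \<in> {0..T}" using \<tau>(2) by blast+
        then have "norm (x (\<tau> (Suc i))) \<le> \<eta>" "norm (x (\<tau> i)) \<le> \<eta>" using sup by auto
        then show "norm (x (\<tau> (Suc i)) - x (\<tau> i)) \<le> d"
          using norm_triangle_ineq4[of "x (\<tau> (Suc i))" "x (\<tau> i)"] \<eta>(3) by linarith
      qed (use var \<tau> \<epsilon> d0 in auto)
      with d show "(\<Sum>i<n. norm (x (\<tau> (Suc i)) - x (\<tau> i)) powr p) \<le> (e / 4) powr p" by linarith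
    qed (use \<epsilon> e in \<open>auto simp: p_def\<close>)
    moreover have "sup_norm T x \<le> ennreal (e / 4)"
      using sup \<eta>(2) by (intro sup_norm_le) force
    ultimately have "variation_norm p T x \<le> ennreal (e / 4) + ennreal (e / 4)"
      unfolding variation_norm_def by (intro add_mono)
    also have "\<dots> < ennreal e" using e by (simp add: ennreal_plus[symmetric] ennreal_less_iff del: ennreal_plus)
    finally show ?thesis .
  qed
  then show ?thesis using \<eta>(1) unfolding p_def by (intro exI[of _ \<eta>]) auto
qed

lemma driver_trace_variation_sum:
  assumes T: "0 \<le> T" and U: "U \<in> drivers T" and \<tau>: "mono_on {..n} \<tau>" "\<tau> ` {..n} \<subseteq> {0..T}"
  shows "(\<Sum>i<n. norm (loewner_trace U (\<tau> (Suc i)) - loewner_trace U (\<tau> i))) \<le> 2 * trace_constant T U * sqrt T"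
proof -
  have mem: "\<tau> i \<in> {0..T}" if "i \<le> n" for i using \<tau>(2) that by auto
  have "(\<Sum>i<n. norm (loewner_trace U (\<tau> (Suc i)) - loewner_trace U (\<tau> i)))
      \<le> (\<Sum>i<n. 2 * trace_constant T U * (sqrt (\<tau> (Suc i)) - sqrt (\<tau> i)))"
  proof (rule sum_mono)
    fix i assume i: "i \<in> {..<n}"
    then have "\<tau> i \<le> \<tau> (Suc i)" using \<tau>(1) by (auto intro: mono_onD)
    then show "norm (loewner_trace U (\<tau> (Suc i)) - loewner_trace U (\<tau> i))
        \<le> 2 * trace_constant T U * (sqrt (\<tau> (Suc i)) - sqrt (\<tau> i))"
      using mem[of i] mem[of "Suc i"] i by (intro driver_trace_sqrt_increment[OF U]) auto
  qed
  also have "\<dots> = 2 * trace_constant T U * (sqrt (\<tau> n) - sqrt (\<tau> 0))"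
    unfolding sum_distrib_left[symmetric] using sum_lessThan_telescope[of "\<lambda>i. sqrt (\<tau> i)" n] by simp
  also have "\<dots> \<le> 2 * trace_constant T U * sqrt T"
  proof (rule mult_left_mono)
    have "sqrt (\<tau> n) \<le> sqrt T" "0 \<le> sqrt (\<tau> 0)" using mem[of n] mem[of 0] by auto
    then show "sqrt (\<tau> n) - sqrt (\<tau> 0) \<le> sqrt T" by linarith
  qed (use trace_constant_pos[of T U] in simp)
  finally show ?thesis .
qed

lemma driver_trace_in_holder_space:
  assumes T: "0 \<le> T" and U: "U \<in> drivers T" and \<epsilon>: "0 < \<epsilon>"
  shows "loewner_trace U \<in> holder_space (1 / 2 - \<epsilon>) T {z. 0 \<le> Im z}"
proof -
  have "holder_seminorm (1 / 2 - \<epsilon>) T (loewner_trace U) \<le> ennreal (trace_constant T U * T powr \<epsilon>)"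
  proof (rule holder_seminorm_le)
    fix s t assume st: "0 \<le> s" "s < t" "t \<le> T"
    have "norm (loewner_trace U t - loewner_trace U s) \<le> trace_constant T U * sqrt (t - s)"
      by (rule driver_trace_holder[OF U st])
    also have "sqrt (t - s) = (t - s) powr \<epsilon> * (t - s) powr (1 / 2 - \<epsilon>)"
      using st by (simp add: powr_half_sqrt flip: powr_add)
    also have "trace_constant T U * ((t - s) powr \<epsilon> * (t - s) powr (1 / 2 - \<epsilon>)) \<le>
        trace_constant T U * (T powr \<epsilon> * (t - s) powr (1 / 2 - \<epsilon>))"
      using st \<epsilon> trace_constant_pos[of T U]
      by (intro mult_left_mono mult_right_mono powr_mono2) auto
    finally show "norm (loewner_trace U t - loewner_trace U s)
        \<le> trace_constant T U * T powr \<epsilon> * (t - s) powr (1 / 2 - \<epsilon>)" by simp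
  qed
  then have "holder_seminorm (1 / 2 - \<epsilon>) T (loewner_trace U) < \<infinity>" by (simp add: le_less_trans)
  with sup_norm_finite[OF driver_trace_continuous[OF U]]
  have "holder_norm (1 / 2 - \<epsilon>) T (loewner_trace U) < \<infinity>" by (simp add: holder_norm_def)
  with driver_trace_continuous[OF U] driver_trace_exists(3)[OF T U] show ?thesis
    by (simp add: holder_space_def)
qed

lemma driver_trace_variation_finite:
  assumes T: "0 \<le> T" and U: "U \<in> drivers T" and p: "1 \<le> p"
  shows "variation p T (loewner_trace U) < \<infinity>"
proof -
  define V where "V = 2 * trace_constant T U * sqrt T"
  have V: "0 \<le> V" using T trace_constant_pos[of T U] by (simp add: V_def)
  have "variation p T (loewner_trace U) \<le> ennreal V"
  proof (rule variation_le[OF p V])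
    fix n :: nat and \<tau> :: "nat \<Rightarrow> real" assume \<tau>: "mono_on {..n} \<tau>" "\<tau> ` {..n} \<subseteq> {0..T}"
    have sum: "(\<Sum>i<n. norm (loewner_trace U (\<tau> (Suc i)) - loewner_trace U (\<tau> i))) \<le> V"
      unfolding V_def by (rule driver_trace_variation_sum[OF T U \<tau>])
    have "(\<Sum>i<n. norm (loewner_trace U (\<tau> (Suc i)) - loewner_trace U (\<tau> i)) powr (1 + (p - 1))) \<le> V powr (p - 1) * V"
    proof (rule sum_powr_interpolation[OF _ _ sum])
      fix i assume i: "i < n"
      have "norm (loewner_trace U (\<tau> (Suc i)) - loewner_trace U (\<tau> i))
          \<le> (\<Sum>i<n. norm (loewner_trace U (\<tau> (Suc i)) - loewner_trace U (\<tau> i)))"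
        using i by (intro member_le_sum) auto
      with sum show "norm (loewner_trace U (\<tau> (Suc i)) - loewner_trace U (\<tau> i)) \<le> V" by linarith
    qed (use p V in auto)
    also have "V powr (p - 1) * V = V powr p" using V by (cases "V = 0") (auto simp: powr_diff)
    finally show "(\<Sum>i<n. norm (loewner_trace U (\<tau> (Suc i)) - loewner_trace U (\<tau> i)) powr p) \<le> V powr p" by simp
  qed
  then show ?thesis by (simp add: le_less_trans)
qed

text \<open>
  The height \<open>y\<close> is fixed first, depending on the energy bound and on
  \<open>\<eta>\<close> alone; only then is \<open>\<delta>\<close> chosen to beat the Gronwall
  factor, which blows up as \<open>y\<close> tends to \<open>0\<close>.
\<close>

lemma trace_uniform_closeness:
  assumes T: "0 \<le> T" and \<eta>: "0 < \<eta>"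
  shows "\<exists>\<delta>>0. \<forall>U\<in>drivers T. \<forall>V\<in>drivers T. energy_norm T U \<le> R \<longrightarrow> energy_norm T V \<le> R \<longrightarrow>
    (\<forall>s\<in>{0..T}. \<bar>U s - V s\<bar> \<le> \<delta>) \<longrightarrow>
    (\<forall>t\<in>{0..T}. norm (loewner_trace U t - loewner_trace V t) \<le> \<eta>)"
proof -
  define y where "y = \<eta> / (4 * exp (R\<^sup>2 / 4))"
  define \<delta> where "\<delta> = \<eta> / (4 * exp (3 * T / y\<^sup>2))"
  have y: "0 < y" and \<delta>: "0 < \<delta>" using \<eta> by (auto simp: y_def \<delta>_def)
  have "norm (loewner_trace U t - loewner_trace V t) \<le> \<eta>"
    if U: "U \<in> drivers T" and V: "V \<in> drivers T" and R: "energy_norm T U \<le> R" "energy_norm T V \<le> R"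
      and close: "\<forall>s\<in>{0..T}. \<bar>U s - V s\<bar> \<le> \<delta>" and t: "t \<in> {0..T}" for U V t
  proof -
    obtain N where N: "finite_energy_driver T U (path_deriv T U) N"
      "\<And>t. t \<in> {0..T} \<Longrightarrow> finite_energy_driver.energy (path_deriv T U) 0 t = (energy_norm t U)\<^sup>2"
      using finite_energy_imp_driver[OF T drivers_imp_finite_energy[OF U]] by blast
    obtain M where M: "finite_energy_driver T V (path_deriv T V) M"
      "\<And>t. t \<in> {0..T} \<Longrightarrow> finite_energy_driver.energy (path_deriv T V) 0 t = (energy_norm t V)\<^sup>2"
      using finite_energy_imp_driver[OF T drivers_imp_finite_energy[OF V]] by blast
    have sq: "(energy_norm T W)\<^sup>2 \<le> R\<^sup>2" if "energy_norm T W \<le> R" for W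
      using that energy_norm_nonneg by (rule power_mono)
    have "norm (loewner_trace U t - loewner_trace V t) \<le> 2 * exp (R\<^sup>2 / 4) * y + 2 * \<delta> * exp (3 * T / y\<^sup>2)"
      using T sq[OF R(1)] sq[OF R(2)] close
      by (intro trace_stability[OF N(1) M(1) _ _ t y]) (auto simp: N(2) M(2))
    also have "\<dots> = \<eta>" by (simp add: y_def \<delta>_def)
    finally show ?thesis .
  qed
  with \<delta> show ?thesis by blast
qed

text \<open>
  The derivative of the difference is the difference of the derivatives almost everywhere; its
  square is integrable since it is measurable, the derivatives themselves being integrable by the
  fundamental theorem of calculus. The second part keeps the energy bounded near a given driver.
\<close>

lemma finite_energy_diff:
  assumes T: "0 \<le> T" and u: "u \<in> finite_energy T" and v: "v \<in> finite_energy T"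
  shows "v - u \<in> finite_energy T" "(energy_norm T v)\<^sup>2 \<le> 2 * (energy_norm T u)\<^sup>2 + 2 * (energy_norm T (v - u))\<^sup>2"
proof -
  obtain N where N: "finite_energy_driver T u (path_deriv T u) N"
    "\<And>t. t \<in> {0..T} \<Longrightarrow> finite_energy_driver.energy (path_deriv T u) 0 t = (energy_norm t u)\<^sup>2"
    using finite_energy_imp_driver[OF T u] by blast
  obtain M where M: "finite_energy_driver T v (path_deriv T v) M"
    "\<And>t. t \<in> {0..T} \<Longrightarrow> finite_energy_driver.energy (path_deriv T v) 0 t = (energy_norm t v)\<^sup>2"
    using finite_energy_imp_driver[OF T v] by blast
  interpret u: finite_energy_driver T u "path_deriv T u" N by fact
  interpret v: finite_energy_driver T v "path_deriv T v" M by fact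
  define Q where "Q = insert 0 (insert T (N \<union> M))"
  have Q: "negligible Q" using u.null v.null by (simp add: Q_def)
  have at: "at s within {0..T} = at s" if "s \<in> {0..T} - Q" for s
    using that by (intro at_within_interior) (auto simp: Q_def)
  have du: "(u has_real_derivative path_deriv T u s) (at s)"
    and dv: "(v has_real_derivative path_deriv T v s) (at s)" if "s \<in> {0..T} - Q" for s
    using u.driver_deriv[of s] v.driver_deriv[of s] that by (auto simp: Q_def)
  have dd: "path_deriv T (v - u) s = path_deriv T v s - path_deriv T u s" if s: "s \<in> {0..T} - Q" for s
  proof -
    have "((v - u) has_vector_derivative (path_deriv T v s - path_deriv T u s)) (at s)"
      using DERIV_diff[OF dv[OF s] du[OF s]]
      by (simp add: has_real_derivative_iff_has_vector_derivative fun_diff_def)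
    then show ?thesis unfolding path_deriv_def[of T "v - u"] at[OF s] by (rule vector_derivative_at)
  qed
  have "absolutely_continuous_path 0 T (v - u)"
    by (rule absolutely_continuous_path_dominated[OF v.driver_ac u.driver_ac, of _ 1]) auto
  moreover have "AE s in lebesgue_on {0..T}. (v - u) differentiable (at s within {0..T})"
  proof -
    have "AE s in lebesgue_on {0..T}. u differentiable (at s within {0..T})"
      "AE s in lebesgue_on {0..T}. v differentiable (at s within {0..T})"
      using u v by (auto simp: finite_energy_def)
    then show ?thesis
      by eventually_elim (simp add: fun_diff_def differentiable_diff)
  qed
  moreover have sq: "(\<lambda>s. (path_deriv T v s - path_deriv T u s)\<^sup>2) integrable_on {0..T}"
  proof (rule measurable_bounded_by_integrable_imp_integrable)
    have "path_deriv T u integrable_on {0..T}" "path_deriv T v integrable_on {0..T}"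
      using absolutely_continuous_ftc[OF T u.driver_ac Q] absolutely_continuous_ftc[OF T v.driver_ac Q] du dv at
      by (auto simp: integrable_on_def)
    then have "path_deriv T u \<in> borel_measurable (lebesgue_on {0..T})"
      "path_deriv T v \<in> borel_measurable (lebesgue_on {0..T})"
      by (auto intro: integrable_imp_measurable)
    then show "(\<lambda>s. (path_deriv T v s - path_deriv T u s)\<^sup>2) \<in> borel_measurable (lebesgue_on {0..T})"
      by measurable
    show "(\<lambda>s. 2 * (path_deriv T v s)\<^sup>2 + 2 * (path_deriv T u s)\<^sup>2) integrable_on {0..T}"
      by (intro integrable_add integrable_on_mult_right u.sq_int v.sq_int)
    fix s
    have "0 \<le> (path_deriv T v s + path_deriv T u s)\<^sup>2" by simp
    then have "(path_deriv T v s - path_deriv T u s)\<^sup>2 \<le> 2 * (path_deriv T v s)\<^sup>2 + 2 * (path_deriv T u s)\<^sup>2"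
      by (simp add: power2_eq_square algebra_simps)
    then show "norm ((path_deriv T v s - path_deriv T u s)\<^sup>2) \<le> 2 * (path_deriv T v s)\<^sup>2 + 2 * (path_deriv T u s)\<^sup>2"
      by simp
  qed auto
  moreover from sq have int: "(\<lambda>s. (path_deriv T (v - u) s)\<^sup>2) integrable_on {0..T}"
    by (rule integrable_spike[OF _ Q]) (use dd in auto)
  then have "set_integrable lebesgue {0..T} (\<lambda>s. (path_deriv T (v - u) s)\<^sup>2)"
    by (rule nonnegative_absolutely_integrable_1) simp
  ultimately show mem: "v - u \<in> finite_energy T" by (simp add: finite_energy_def)
  obtain L where L: "\<And>t. t \<in> {0..T} \<Longrightarrow>
      finite_energy_driver.energy (path_deriv T (v - u)) 0 t = (energy_norm t (v - u))\<^sup>2"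
      "finite_energy_driver T (v - u) (path_deriv T (v - u)) L"
    using finite_energy_imp_driver[OF T mem] by blast
  have e: "(energy_norm T (v - u))\<^sup>2 = integral {0..T} (\<lambda>s. (path_deriv T v s - path_deriv T u s)\<^sup>2)"
    using L(1)[of T] T finite_energy_driver.energy_def[OF L(2)]
      integral_spike[OF Q, of "{0..T}" "\<lambda>s. (path_deriv T (v - u) s)\<^sup>2" "\<lambda>s. (path_deriv T v s - path_deriv T u s)\<^sup>2"] dd
    by simp
  have "(energy_norm T v)\<^sup>2 = integral {0..T} (\<lambda>s. (path_deriv T v s)\<^sup>2)"
    using M(2)[of T] T v.energy_def by simp
  also have "\<dots> \<le> integral {0..T} (\<lambda>s. 2 * (path_deriv T u s)\<^sup>2 + 2 * (path_deriv T v s - path_deriv T u s)\<^sup>2)"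
  proof (rule integral_le)
    fix s
    have "0 \<le> (path_deriv T v s - 2 * path_deriv T u s)\<^sup>2" by simp
    then show "(path_deriv T v s)\<^sup>2 \<le> 2 * (path_deriv T u s)\<^sup>2 + 2 * (path_deriv T v s - path_deriv T u s)\<^sup>2"
      by (simp add: power2_eq_square algebra_simps)
  qed (intro integrable_add integrable_on_mult_right u.sq_int v.sq_int sq)+
  also have "\<dots> = 2 * (energy_norm T u)\<^sup>2 + 2 * (energy_norm T (v - u))\<^sup>2"
    using N(2)[of T] T u.energy_def e
    by (subst integral_add) (auto intro!: integrable_on_mult_right u.sq_int sq)
  finally show "(energy_norm T v)\<^sup>2 \<le> 2 * (energy_norm T u)\<^sup>2 + 2 * (energy_norm T (v - u))\<^sup>2" .
qed

text \<open>
  The parameter of the increment estimate is chosen as \<open>1 / \<delta>\<close>, which balances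
  its two terms.
\<close>

lemma energy_norm_controls_uniform_distance:
  assumes T: "0 \<le> T" and u: "u \<in> drivers T" and v: "v \<in> drivers T"
    and \<delta>: "0 < \<delta>" "energy_norm T (v - u) \<le> \<delta>" and t: "t \<in> {0..T}"
  shows "\<bar>v t - u t\<bar> \<le> \<delta> * (1 + T) / 2"
proof -
  have mem: "v - u \<in> finite_energy T"
    using u v by (intro finite_energy_diff T) (auto simp: drivers_def)
  obtain N where N: "finite_energy_driver T (v - u) (path_deriv T (v - u)) N"
    "\<And>t. t \<in> {0..T} \<Longrightarrow> finite_energy_driver.energy (path_deriv T (v - u)) 0 t = (energy_norm t (v - u))\<^sup>2"
    using finite_energy_imp_driver[OF T mem] by blast
  interpret finite_energy_driver T "v - u" "path_deriv T (v - u)" N by fact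
  have "\<bar>(v - u) t - (v - u) 0\<bar> \<le> (1 / \<delta>) / 2 * energy 0 t + (t - 0) / (2 * (1 / \<delta>))"
    using t \<delta> by (intro driver_increment) auto
  also have "\<dots> \<le> (1 / \<delta>) / 2 * \<delta>\<^sup>2 + T / (2 * (1 / \<delta>))"
  proof (intro add_mono mult_left_mono divide_right_mono)
    have "energy 0 t \<le> energy 0 T" using t by (intro energy_mono) auto
    also have "\<dots> = (energy_norm T (v - u))\<^sup>2" using T by (simp add: N(2))
    also have "\<dots> \<le> \<delta>\<^sup>2" using \<delta>(2) energy_norm_nonneg by (rule power_mono)
    finally show "energy 0 t \<le> \<delta>\<^sup>2" .
  qed (use t \<delta> in auto)
  also have "\<dots> = \<delta> * (1 + T) / 2" using \<delta>(1) by (simp add: power2_eq_square algebra_simps add_divide_distrib)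
  finally show ?thesis using u v by (simp add: drivers_def)
qed

lemma trace_constant_mono:
  assumes "energy_norm T U \<le> R"
  shows "trace_constant T U \<le> 768 * exp (2 * R\<^sup>2)"
  using power_mono[OF assms energy_norm_nonneg, of 2] by (simp add: trace_constant_def)

text \<open>
  Bounded energy makes the Hoelder constants of all traces uniform, as interpolation requires.
\<close>

lemma trace_map_holder_continuous:
  assumes T: "0 < T" and \<epsilon>: "0 < \<epsilon>" and B: "B \<subseteq> drivers T" and R: "\<forall>U\<in>B. energy_norm T U \<le> R"
  shows "norm_continuous_on (sup_norm T) (holder_norm (1 / 2 - \<epsilon>) T) B loewner_trace"
  unfolding norm_continuous_on_def
proof (intro ballI allI impI)
  fix u and e :: real assume u: "u \<in> B" and e: "0 < e"
  define C where "C = 768 * exp (2 * R\<^sup>2)"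
  have C: "0 \<le> 2 * C" by (simp add: C_def)
  obtain \<eta> where \<eta>: "0 < \<eta>" "\<And>x :: real \<Rightarrow> complex. (\<forall>t\<in>{0..T}. norm (x t) \<le> \<eta>) \<Longrightarrow>
    (\<forall>s t. 0 \<le> s \<and> s < t \<and> t \<le> T \<longrightarrow> norm (x t - x s) \<le> 2 * C * sqrt (t - s)) \<Longrightarrow>
    holder_norm (1 / 2 - \<epsilon>) T x < ennreal e"
    using holder_norm_interpolation[OF T C \<epsilon> e, where 'a = complex] by blast
  have T0: "0 \<le> T" using T by simp
  obtain \<delta> where \<delta>: "0 < \<delta>" "\<And>U V. U \<in> drivers T \<Longrightarrow> V \<in> drivers T \<Longrightarrow> energy_norm T U \<le> R \<Longrightarrow>
    energy_norm T V \<le> R \<Longrightarrow> (\<forall>s\<in>{0..T}. \<bar>U s - V s\<bar> \<le> \<delta>) \<Longrightarrow>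
    (\<forall>t\<in>{0..T}. norm (loewner_trace U t - loewner_trace V t) \<le> \<eta>)"
    using trace_uniform_closeness[OF T0 \<eta>(1), of R] by blast
  have "holder_norm (1 / 2 - \<epsilon>) T (loewner_trace v - loewner_trace u) < ennreal e"
    if v: "v \<in> B" and close: "sup_norm T (v - u) < ennreal \<delta>" for v
  proof (rule \<eta>(2))
    have ud: "u \<in> drivers T" and vd: "v \<in> drivers T" using u v B by auto
    have uR: "energy_norm T u \<le> R" and vR: "energy_norm T v \<le> R" using R u v by auto
    have "\<forall>s\<in>{0..T}. \<bar>v s - u s\<bar> \<le> \<delta>" using sup_norm_lessD[OF close] by simp
    from \<delta>(2)[OF vd ud vR uR this]
    show "\<forall>t\<in>{0..T}. norm ((loewner_trace v - loewner_trace u) t) \<le> \<eta>" by simp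
    show "\<forall>s t. 0 \<le> s \<and> s < t \<and> t \<le> T \<longrightarrow>
        norm ((loewner_trace v - loewner_trace u) t - (loewner_trace v - loewner_trace u) s) \<le> 2 * C * sqrt (t - s)"
    proof (intro allI impI)
      fix s t assume st: "0 \<le> s \<and> s < t \<and> t \<le> T"
      have bd: "norm (loewner_trace w t - loewner_trace w s) \<le> C * sqrt (t - s)"
        if "w \<in> drivers T" "energy_norm T w \<le> R" for w
      proof -
        have "norm (loewner_trace w t - loewner_trace w s) \<le> trace_constant T w * sqrt (t - s)"
          using st by (intro driver_trace_holder that) auto
        also have "\<dots> \<le> C * sqrt (t - s)"
          using st trace_constant_mono[OF that(2)] unfolding C_def by (intro mult_right_mono) auto
        finally show ?thesis .
      qed
      have "(loewner_trace v - loewner_trace u) t - (loewner_trace v - loewner_trace u) s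
          = (loewner_trace v t - loewner_trace v s) - (loewner_trace u t - loewner_trace u s)" by simp
      then have "norm ((loewner_trace v - loewner_trace u) t - (loewner_trace v - loewner_trace u) s) \<le>
          norm (loewner_trace v t - loewner_trace v s) + norm (loewner_trace u t - loewner_trace u s)"
        by (simp only: norm_triangle_ineq4)
      then show "norm ((loewner_trace v - loewner_trace u) t - (loewner_trace v - loewner_trace u) s) \<le> 2 * C * sqrt (t - s)"
        using bd[OF vd vR] bd[OF ud uR] by linarith
    qed
  qed
  with \<delta>(1) show "\<exists>\<delta>>0. \<forall>v\<in>B. sup_norm T (v - u) < ennreal \<delta> \<longrightarrow>
      holder_norm (1 / 2 - \<epsilon>) T (loewner_trace v - loewner_trace u) < ennreal e" by blast
qed

text \<open>
  Closeness in energy norm keeps the energy below \<open>R\<^sup>2\<close> and implies uniform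
  closeness of the drivers, so the uniform estimate for the traces applies; their variation is
  uniformly bounded.
\<close>

lemma trace_map_variation_continuous:
  assumes T: "0 < T" and \<epsilon>: "0 < \<epsilon>"
  shows "norm_continuous_on (\<lambda>h. ennreal (energy_norm T h)) (variation_norm (1 + \<epsilon>) T) (drivers T) loewner_trace"
  unfolding norm_continuous_on_def
proof (intro ballI allI impI)
  fix u and e :: real assume u: "u \<in> drivers T" and e: "0 < e"
  define R where "R = sqrt (2 * (energy_norm T u)\<^sup>2 + 2)"
  define V where "V = 2 * (2 * (768 * exp (2 * R\<^sup>2)) * sqrt T)"
  have T0: "0 \<le> T" using T by simp
  have V: "0 \<le> V" using T by (simp add: V_def)
  obtain \<eta> where \<eta>: "0 < \<eta>" "\<And>x :: real \<Rightarrow> complex. (\<forall>t\<in>{0..T}. norm (x t) \<le> \<eta>) \<Longrightarrow>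
    (\<forall>n \<tau>. mono_on {..n} \<tau> \<and> \<tau> ` {..n} \<subseteq> {0..T} \<longrightarrow>
       (\<Sum>i<n. norm (x (\<tau> (Suc i)) - x (\<tau> i))) \<le> V) \<Longrightarrow>
    variation_norm (1 + \<epsilon>) T x < ennreal e"
    using variation_norm_interpolation[OF V \<epsilon> e, where 'a = complex and T = T] by blast
  obtain \<delta>' where \<delta>': "0 < \<delta>'" "\<And>U V. U \<in> drivers T \<Longrightarrow> V \<in> drivers T \<Longrightarrow> energy_norm T U \<le> R \<Longrightarrow>
    energy_norm T V \<le> R \<Longrightarrow> (\<forall>s\<in>{0..T}. \<bar>U s - V s\<bar> \<le> \<delta>') \<Longrightarrow>
    (\<forall>t\<in>{0..T}. norm (loewner_trace U t - loewner_trace V t) \<le> \<eta>)"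
    using trace_uniform_closeness[OF T0 \<eta>(1), of R] by blast
  define \<delta> where "\<delta> = min 1 (\<delta>' / (1 + T))"
  have \<delta>: "0 < \<delta>" "\<delta> \<le> 1" using \<delta>'(1) T by (auto simp: \<delta>_def)
  have \<delta>T: "\<delta> * (1 + T) / 2 \<le> \<delta>'"
  proof -
    have "\<delta> * (1 + T) \<le> \<delta>' / (1 + T) * (1 + T)" using T by (intro mult_right_mono) (auto simp: \<delta>_def)
    then show ?thesis using T \<delta>'(1) by simp
  qed
  have "variation_norm (1 + \<epsilon>) T (loewner_trace v - loewner_trace u) < ennreal e"
    if v: "v \<in> drivers T" and close: "ennreal (energy_norm T (v - u)) < ennreal \<delta>" for v
  proof (rule \<eta>(2))
    have close': "energy_norm T (v - u) \<le> \<delta>"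
      using close \<delta>(1) by (simp add: ennreal_less_iff energy_norm_nonneg)
    then have "(energy_norm T (v - u))\<^sup>2 \<le> 1\<^sup>2" using \<delta>(2) energy_norm_nonneg by (intro power_mono) auto
    then have "(energy_norm T v)\<^sup>2 \<le> R\<^sup>2"
      using finite_energy_diff(2)[OF T0 drivers_imp_finite_energy[OF u] drivers_imp_finite_energy[OF v]]
      by (simp add: R_def)
    then have vR: "energy_norm T v \<le> R" by (rule power2_le_imp_le) (simp add: R_def)
    have uR: "energy_norm T u \<le> R" unfolding R_def by (rule real_le_rsqrt) simp
    have "\<forall>s\<in>{0..T}. \<bar>v s - u s\<bar> \<le> \<delta>'"
      using energy_norm_controls_uniform_distance[OF T0 u v \<delta>(1) close'] \<delta>T by force
    from \<delta>'(2)[OF v u vR uR this]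
    show "\<forall>t\<in>{0..T}. norm ((loewner_trace v - loewner_trace u) t) \<le> \<eta>" by simp
    show "\<forall>n \<tau>. mono_on {..n} \<tau> \<and> \<tau> ` {..n} \<subseteq> {0..T} \<longrightarrow>
       (\<Sum>i<n. norm ((loewner_trace v - loewner_trace u) (\<tau> (Suc i)) - (loewner_trace v - loewner_trace u) (\<tau> i))) \<le> V"
    proof (intro allI impI)
      fix n and \<tau> :: "nat \<Rightarrow> real" assume \<tau>: "mono_on {..n} \<tau> \<and> \<tau> ` {..n} \<subseteq> {0..T}"
      have bd: "(\<Sum>i<n. norm (loewner_trace w (\<tau> (Suc i)) - loewner_trace w (\<tau> i))) \<le> V / 2"
        if w: "w \<in> drivers T" "energy_norm T w \<le> R" for w
      proof -
        have "(\<Sum>i<n. norm (loewner_trace w (\<tau> (Suc i)) - loewner_trace w (\<tau> i))) \<le> 2 * trace_constant T w * sqrt T"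
          using \<tau> by (intro driver_trace_variation_sum T0 w) auto
        also have "\<dots> \<le> 2 * (768 * exp (2 * R\<^sup>2)) * sqrt T"
          using T by (intro mult_right_mono mult_left_mono trace_constant_mono w) auto
        finally show ?thesis by (simp add: V_def mult_ac)
      qed
      have "(\<Sum>i<n. norm ((loewner_trace v - loewner_trace u) (\<tau> (Suc i)) - (loewner_trace v - loewner_trace u) (\<tau> i)))
        \<le> (\<Sum>i<n. norm (loewner_trace v (\<tau> (Suc i)) - loewner_trace v (\<tau> i))
            + norm (loewner_trace u (\<tau> (Suc i)) - loewner_trace u (\<tau> i)))"
      proof (rule sum_mono)
        fix i
        have "(loewner_trace v - loewner_trace u) (\<tau> (Suc i)) - (loewner_trace v - loewner_trace u) (\<tau> i) =
          (loewner_trace v (\<tau> (Suc i)) - loewner_trace v (\<tau> i)) - (loewner_trace u (\<tau> (Suc i)) - loewner_trace u (\<tau> i))"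
          by simp
        then show "norm ((loewner_trace v - loewner_trace u) (\<tau> (Suc i)) - (loewner_trace v - loewner_trace u) (\<tau> i))
          \<le> norm (loewner_trace v (\<tau> (Suc i)) - loewner_trace v (\<tau> i))
            + norm (loewner_trace u (\<tau> (Suc i)) - loewner_trace u (\<tau> i))"
          by (simp only: norm_triangle_ineq4)
      qed
      also have "\<dots> \<le> V" using bd[OF v vR] bd[OF u uR] by (simp add: sum.distrib)
      finally show "(\<Sum>i<n. norm ((loewner_trace v - loewner_trace u) (\<tau> (Suc i))
          - (loewner_trace v - loewner_trace u) (\<tau> i))) \<le> V" .
    qed
  qed
  with \<delta>(1) show "\<exists>\<delta>>0. \<forall>v\<in>drivers T. ennreal (energy_norm T (v - u)) < ennreal \<delta> \<longrightarrow>
      variation_norm (1 + \<epsilon>) T (loewner_trace v - loewner_trace u) < ennreal e" by blast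
qed

theorem theorem2:
  fixes T :: real
  assumes "0 < T"
  shows
    "(\<forall>U\<in>drivers T. \<forall>y>0. \<forall>t\<in>{0..T}.
        cmod (deriv (loewner_f U t) (above_tip U t y)) \<le> exp (1 / 4 * (energy_norm t U)\<^sup>2))
     \<and>
     (\<forall>U\<in>drivers T. loewner_trace_exists T U \<and> inj_on (loewner_trace U) {0..T})
     \<and>
     (\<exists>C>0. \<forall>U\<in>drivers T.
        holder_seminorm (1 / 2) T (loewner_trace U) \<le> ennreal (C * exp (C * (energy_norm T U)\<^sup>2)))
     \<and>
     (\<forall>U\<in>drivers T.
        (\<exists>L. L-lipschitz_on {0..sqrt T} (\<lambda>t. loewner_trace U (t\<^sup>2))) \<and>
        variation 1 T (loewner_trace U) < \<infinity> \<and>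
        (\<forall>\<delta>\<in>{0<..T}. \<exists>L. L-lipschitz_on {\<delta>..T} (loewner_trace U)))
     \<and>
     (\<forall>\<epsilon>>0. \<forall>B\<subseteq>drivers T. (\<exists>R. \<forall>U\<in>B. energy_norm T U \<le> R) \<longrightarrow>
        loewner_trace ` B \<subseteq> holder_space (1 / 2 - \<epsilon>) T {z. 0 \<le> Im z} \<and>
        norm_continuous_on (sup_norm T) (holder_norm (1 / 2 - \<epsilon>) T) B loewner_trace)
     \<and>
     (\<forall>\<epsilon>>0.
        loewner_trace ` drivers T \<subseteq> variation_space (1 + \<epsilon>) T \<and>
        norm_continuous_on (\<lambda>h. ennreal (energy_norm T h)) (variation_norm (1 + \<epsilon>) T)
          (drivers T) loewner_trace)"
proof (intro conjI ballI allI impI)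
  have T: "0 \<le> T" using assms by simp
  fix U :: "real \<Rightarrow> real" assume U: "U \<in> drivers T"
  show "cmod (deriv (loewner_f U t) (above_tip U t y)) \<le> exp (1 / 4 * (energy_norm t U)\<^sup>2)"
    if y: "0 < y" and t: "t \<in> {0..T}" for y t
  proof -
    obtain N where N: "finite_energy_driver T U (path_deriv T U) N"
      "\<And>t. t \<in> {0..T} \<Longrightarrow> finite_energy_driver.energy (path_deriv T U) 0 t = (energy_norm t U)\<^sup>2"
      using finite_energy_imp_driver[OF T drivers_imp_finite_energy[OF U]] by blast
    show ?thesis using finite_energy_driver.deriv_above_tip_bound[OF N(1) t y] by (simp add: N(2)[OF t])
  qed
next
  have T: "0 \<le> T" using assms by simp
  fix U :: "real \<Rightarrow> real" assume U: "U \<in> drivers T"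
  show "loewner_trace_exists T U" "inj_on (loewner_trace U) {0..T}"
    by (rule driver_trace_exists[OF T U])+
next
  show "\<exists>C>0. \<forall>U\<in>drivers T.
        holder_seminorm (1 / 2) T (loewner_trace U) \<le> ennreal (C * exp (C * (energy_norm T U)\<^sup>2))"
  proof (intro exI[of _ 768] conjI ballI)
    fix U assume U: "U \<in> drivers T"
    have "holder_seminorm (1 / 2) T (loewner_trace U) \<le> ennreal (trace_constant T U)"
      using driver_trace_holder[OF U] by (intro holder_seminorm_le) (simp add: powr_half_sqrt)
    also have "\<dots> \<le> ennreal (768 * exp (768 * (energy_norm T U)\<^sup>2))"
      unfolding trace_constant_def by (intro ennreal_leI) simp
    finally show "holder_seminorm (1 / 2) T (loewner_trace U) \<le> ennreal (768 * exp (768 * (energy_norm T U)\<^sup>2))" .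
  qed simp
next
  have T: "0 \<le> T" using assms by simp
  fix U :: "real \<Rightarrow> real" assume U: "U \<in> drivers T"
  show "\<exists>L. L-lipschitz_on {0..sqrt T} (\<lambda>t. loewner_trace U (t\<^sup>2))"
    using driver_trace_lipschitz_sqrt_time[OF U] by blast
  show "variation 1 T (loewner_trace U) < \<infinity>"
    by (rule driver_trace_variation_finite[OF T U]) simp
  show "\<exists>L. L-lipschitz_on {\<delta>..T} (loewner_trace U)" if "\<delta> \<in> {0<..T}" for \<delta>
    using driver_trace_lipschitz_away_from_0[OF U, of \<delta>] that by auto
next
  fix \<epsilon> :: real and B assume \<epsilon>: "0 < \<epsilon>" and B: "B \<subseteq> drivers T"
    and R: "\<exists>R. \<forall>U\<in>B. energy_norm T U \<le> R"
  show "loewner_trace ` B \<subseteq> holder_space (1 / 2 - \<epsilon>) T {z. 0 \<le> Im z}"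
    using driver_trace_in_holder_space[OF _ _ \<epsilon>] B assms by auto
  show "norm_continuous_on (sup_norm T) (holder_norm (1 / 2 - \<epsilon>) T) B loewner_trace"
    using R trace_map_holder_continuous[OF assms \<epsilon> B] by blast
next
  fix \<epsilon> :: real assume \<epsilon>: "0 < \<epsilon>"
  show "loewner_trace ` drivers T \<subseteq> variation_space (1 + \<epsilon>) T"
    using driver_trace_continuous sup_norm_finite[OF driver_trace_continuous]
      driver_trace_variation_finite[of T _ "1 + \<epsilon>"] \<epsilon> assms
    by (auto simp: variation_space_def variation_norm_def)
  show "norm_continuous_on (\<lambda>h. ennreal (energy_norm T h)) (variation_norm (1 + \<epsilon>) T)
          (drivers T) loewner_trace"
    by (rule trace_map_variation_continuous[OF assms \<epsilon>])
qed

end
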